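(* Let $(K,\delta)$ be a differential field of characteristic zero and let $S \subseteq K\setminus\{0\}$ be a finite subset. Let $\langle S\rangle$, $\mathcal A_S$ and $\mathcal A_S'$ be as defined in the context. (1) If $\mathcal A_S' = 0$, then there exists a splitting field $(E,\delta_E)$ of $S$ such that the field extension $E/K$ is finite. (2) If $\mathcal A_S' \neq 0$ and $(E,\delta_E)$ is a splitting field of $S$, then $E$ is transcendental over $K$ (i.e. not algebraic over $K$) and $\mathrm{trdeg}_K(E) \geq \mathrm{rank}(\mathcal A_S')$. (3) This lower bound is sharp: there exists a splitting field $(E,\delta_E)$ of $S$ with $\mathrm{trdeg}_K(E) = \mathrm{rank}(\mathcal A_S')$.
   Context: A differential field $(K,\delta)$ is a field $K$ with a derivation $\delta:K\to K$. A differential extension $(E,\delta_E)$ of $(K,\delta)$ is a field extension $E\supseteq K$ with a derivation $\delta_E$ of $E$ such that $\delta_E|_K=\delta$. For $S\subseteq K\setminus\{0\}$, a splitting field of $S$ is a differential extension $(E,\delta_E)$ of $(K,\delta)$ such that for every $a\in S$ the equation $\delta_E(y)=ay$ has a nonzero solution $y\in E$. Put $\mathcal A=\{a\in K : \delta(y)=nay \text{ has a nonzero solution } y\in K \text{ for some } n\in\mathbb N\}$, where $\mathbb N$ denotes the positive integers; equivalently, $\mathcal A$ is the $\mathbb Q$-span of the logarithmic derivatives $\delta(b)b^{-1}$, $b\in K\setminus\{0\}$. Let $\langle S\rangle$ be the additive subgroup of $K$ generated by $S$ (a finitely generated free abelian group when $S$ is finite), let $\mathcal A_S=\mathcal A\cap\langle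 S\rangle$, and let $\mathcal A_S'$ be a fixed $\mathbb Z$-complement of $\mathcal A_S$ in $\langle S\rangle$, i.e. a subgroup with $\langle S\rangle=\mathcal A_S\oplus\mathcal A_S'$. Rank means rank as a free abelian group. *)

theory Defs
  imports "HOL-Algebra.Algebra" "HOL-Library.Extended_Nat"
begin

section \<open>Differential fields and splitting fields\<close>

definition char_zero :: "('a, 'm) ring_scheme \<Rightarrow> bool"
  where "char_zero R \<longleftrightarrow> (\<forall>n::nat. 0 < n \<longrightarrow> [n] \<cdot>\<^bsub>R\<^esub> \<one>\<^bsub>R\<^esub> \<noteq> \<zero>\<^bsub>R\<^esub>)"

locale differential_field = field K for K (structure) +
  fixes \<delta> :: "'a \<Rightarrow> 'a"
  assumes der_closed: "x \<in> carrier K \<Longrightarrow> \<delta> x \<in> carrier K"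
    and der_add: "\<lbrakk>x \<in> carrier K; y \<in> carrier K\<rbrakk> \<Longrightarrow> \<delta> (x \<oplus> y) = \<delta> x \<oplus> \<delta> y"
    and der_mult: "\<lbrakk>x \<in> carrier K; y \<in> carrier K\<rbrakk> \<Longrightarrow> \<delta> (x \<otimes> y) = \<delta> x \<otimes> y \<oplus> x \<otimes> \<delta> y"

text \<open>The inclusion of \<open>K\<close> in \<open>E\<close> is given by a ring homomorphism \<open>\<iota>\<close> (injective, as \<open>K\<close> and
  \<open>E\<close> are fields), because the carrier of \<open>K\<close> may exhaust its type. The base field inside \<open>E\<close>
  is \<open>\<iota> ` carrier K\<close>.\<close>

locale differential_extension =
  K: differential_field K \<delta> + E: differential_field E \<delta>\<^sub>E
  for K :: "('a, 'm) ring_scheme" and \<delta> and E :: "('e, 'n) ring_scheme" and \<delta>\<^sub>E +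
  fixes \<iota> :: "'a \<Rightarrow> 'e"
  assumes embedding: "\<iota> \<in> ring_hom K E"
    and der_extends: "x \<in> carrier K \<Longrightarrow> \<delta>\<^sub>E (\<iota> x) = \<iota> (\<delta> x)"

definition splitting_field ::
  "('a, 'm) ring_scheme \<Rightarrow> ('a \<Rightarrow> 'a) \<Rightarrow> 'a set \<Rightarrow> ('e, 'n) ring_scheme \<Rightarrow> ('e \<Rightarrow> 'e) \<Rightarrow> ('a \<Rightarrow> 'e) \<Rightarrow> bool"
  where "splitting_field K \<delta> S E \<delta>\<^sub>E \<iota> \<longleftrightarrow>
    differential_extension K \<delta> E \<delta>\<^sub>E \<iota> \<and>
    (\<forall>a\<in>S. \<exists>y\<in>carrier E. y \<noteq> \<zero>\<^bsub>E\<^esub> \<and> \<delta>\<^sub>E y = \<iota> a \<otimes>\<^bsub>E\<^esub> y)"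

section \<open>The groups associated with \<open>S\<close>\<close>

definition log_der_set :: "('a, 'm) ring_scheme \<Rightarrow> ('a \<Rightarrow> 'a) \<Rightarrow> 'a set"
  where "log_der_set K \<delta> =
    {a \<in> carrier K. \<exists>n::nat. 0 < n \<and>
      (\<exists>y\<in>carrier K. y \<noteq> \<zero>\<^bsub>K\<^esub> \<and> \<delta> y = ([n] \<cdot>\<^bsub>K\<^esub> a) \<otimes>\<^bsub>K\<^esub> y)}"

definition additive_span :: "('a, 'm) ring_scheme \<Rightarrow> 'a set \<Rightarrow> 'a set"
  where "additive_span K S = generate (add_monoid K) S"

definition log_der_part :: "('a, 'm) ring_scheme \<Rightarrow> ('a \<Rightarrow> 'a) \<Rightarrow> 'a set \<Rightarrow> 'a set"
  where "log_der_part K \<delta> S = log_der_set K \<delta> \<inter> additive_span K S"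

definition additive_complement :: "('a, 'm) ring_scheme \<Rightarrow> 'a set \<Rightarrow> 'a set \<Rightarrow> 'a set \<Rightarrow> bool"
  where "additive_complement K G H H' \<longleftrightarrow>
    additive_subgroup H' K \<and> H <+>\<^bsub>K\<^esub> H' = G \<and> H \<inter> H' = {\<zero>\<^bsub>K\<^esub>}"

text \<open>The rank of a free abelian group of finite rank; it is unique by
  \<open>isomorphic_free_Abelian_groups\<close>.\<close>

definition free_rank :: "('a, 'm) monoid_scheme \<Rightarrow> nat"
  where "free_rank G = (THE n. G \<cong> free_Abelian_group {..<n})"

definition additive_rank :: "('a, 'm) ring_scheme \<Rightarrow> 'a set \<Rightarrow> nat"
  where "additive_rank K H = free_rank ((add_monoid K)\<lparr>carrier := H\<rparr>)"

section \<open>Transcendence degree\<close>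

context ring
begin

text \<open>\<open>indexed_pset B k\<close> is the polynomial ring over \<open>k\<close> in the variables indexed by \<open>B\<close>, with
  multisets as monomials. Here the elements of \<open>B\<close> are elements of the ring, and each variable is
  evaluated at its own index.\<close>

definition monomial_value :: "'a multiset \<Rightarrow> 'a"
  where "monomial_value m = (\<Otimes>b\<in>set_mset m. b [^] count m b)"

definition indexed_value :: "('a multiset \<Rightarrow> 'a) \<Rightarrow> 'a"
  where "indexed_value P = (\<Oplus>m\<in>{m. P m \<noteq> \<zero>}. P m \<otimes> monomial_value m)"

definition algebraically_independent :: "'a set \<Rightarrow> 'a set \<Rightarrow> bool"
  where "algebraically_independent k B \<longleftrightarrow>
    B \<subseteq> carrier R \<and>
    (\<forall>P \<in> indexed_pset B k. indexed_value P = \<zero> \<longrightarrow> P = indexed_const \<zero>)"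

definition transcendence_basis :: "'a set \<Rightarrow> 'a set \<Rightarrow> bool"
  where "transcendence_basis k B \<longleftrightarrow>
    algebraically_independent k B \<and>
    (\<forall>B'. algebraically_independent k B' \<and> B \<subseteq> B' \<longrightarrow> B' = B)"

text \<open>All transcendence bases of a field extension have the same cardinality. Infinite
  cardinalities are not distinguished from one another.\<close>

definition trdeg :: "'a set \<Rightarrow> enat"
  where "trdeg k =
    (let B = (SOME B. transcendence_basis k B) in if finite B then enat (card B) else \<infinity>)"

definition algebraic_extension :: "'a set \<Rightarrow> bool"
  where "algebraic_extension k \<longleftrightarrow> (\<forall>x\<in>carrier R. (algebraic over k) x)"

end

end

theory Submission
  imports Defs
begin

text \<open>Call \<open>y \<noteq> 0\<close> a solution for \<open>a\<close> if \<open>\<delta> y = a y\<close>. Products of solutions solve for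
  sums, inverses for negatives, so a splitting field of \<open>S\<close> has solutions for the whole
  group \<open>\<langle>S\<rangle>\<close>. The complement \<open>A'\<close> is a quotient of the finitely generated group \<open>\<langle>S\<rangle>\<close> and
  torsion-free, hence free on a finite family \<open>b\<close> (\<open>complement_basis_exists\<close>), and no
  nontrivial integer combination of \<open>b\<close> lies in \<open>\<A>\<close>, because \<open>\<A> \<inter> A' = 0\<close>.

  Lower bound. Let \<open>y\<^sub>j\<close> be a solution for \<open>b\<^sub>j\<close> in any extension. A monomial in the \<open>y\<^sub>j\<close> is
  a solution for the corresponding combination of the \<open>b\<^sub>j\<close>, so distinct monomials are
  eigenvectors of the derivation whose eigenvalues differ by elements outside \<open>\<A>\<close>. A
  shortest linear relation between such eigenvectors over \<open>K\<close>, scaled to have a coefficient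
  1, becomes shorter when it is differentiated and its multiple by one eigenvalue is
  subtracted. The result must be trivial, which exhibits every ratio of coefficients as a
  solution in \<open>K\<close> for a difference of eigenvalues: a contradiction
  (\<open>eigenvectors_independent\<close>). So the \<open>y\<^sub>j\<close> are algebraically independent
  (\<open>solutions_algebraically_independent\<close>). The argument divides by elements of \<open>K\<close> only, so
  it also covers extensions with new constants.

  Existence. For \<open>a \<in> K\<close>, the derivation \<open>D\<close> of \<open>K[X]\<close> that extends \<open>\<delta>\<close> and has \<open>D X = a X\<close>
  yields two extensions with a solution for \<open>a\<close>: the fraction field \<open>K(X)\<close>
  (\<open>adjoin_transcendental\<close>), and, when \<open>n a\<close> has a solution \<open>z\<close> in \<open>K\<close>, the finite extension
  \<open>K[X]/(f)\<close> for an irreducible factor \<open>f\<close> of \<open>X\<^sup>n - z\<close> (\<open>adjoin_root\<close>); the ideal \<open>(f)\<close> is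
  stable under \<open>D\<close> because \<open>X\<^sup>n - z\<close> divides its own derivative and is squarefree. If
  \<open>A' = 0\<close>, then \<open>S \<subseteq> \<A>\<close> and finitely many steps of the second kind suffice. In general the
  steps of the first kind for \<open>b\<close> give \<open>F = K(y\<^sub>1, \<dots>, y\<^sub>r)\<close>; all of \<open>S\<close> lies in the set \<open>\<A>\<close>
  of \<open>F\<close>, so a finite extension \<open>E\<close> of \<open>F\<close> is a splitting field. There the images of the
  \<open>y\<^sub>j\<close> are independent and \<open>E\<close> is algebraic over the field they generate, so its
  transcendence degree is \<open>r\<close> (\<open>trdeg_eq\<close>).

  All fields can be placed on the element type of \<open>K\<close>: a field of characteristic zero is
  infinite, so pairs of lists of its elements, and with them the carriers of both kinds of
  extension, inject into that type (\<open>infinite_lists_encoding\<close>, \<open>relocation\<close>).\<close>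

section \<open>Values of polynomials indexed by ring elements\<close>

text \<open>The constructors of \<open>indexed_pset\<close> are constants, sums, and products with a
  variable. Evaluation at the own indices is computed on each of them, which makes every
  later argument about values an induction on these constructors.\<close>

text \<open>Enlarging the index set by variables of exponent 0 lets two monomials be compared
  over one common set.\<close>

lemma (in cring) monomial_value_superset:
  assumes "finite S" "set_mset m \<subseteq> S" "S \<subseteq> carrier R"
  shows "monomial_value m = (\<Otimes>b\<in>S. b [^] count m b)"
  unfolding monomial_value_def
  by (rule finprod_mono_neutral_cong_left)
    (use assms in \<open>auto simp: not_in_iff intro!: nat_pow_closed\<close>)

lemma (in cring) monomial_value_empty [simp]: "monomial_value {#} = \<one>"
  unfolding monomial_value_def by simp

lemma (in cring) monomial_value_closed [simp]:
  "set_mset m \<subseteq> carrier R \<Longrightarrow> monomial_value m \<in> carrier R"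
  unfolding monomial_value_def by (rule finprod_closed) auto

lemma (in cring) monomial_value_add_mset:
  assumes "set_mset m \<subseteq> carrier R" "i \<in> carrier R"
  shows "monomial_value (add_mset i m) = monomial_value m \<otimes> i"
proof -
  let ?S = "insert i (set_mset m)"
  have S: "finite ?S" "set_mset m \<subseteq> ?S" "set_mset (add_mset i m) \<subseteq> ?S" "?S \<subseteq> carrier R"
    using assms by auto
  have "monomial_value (add_mset i m) = (\<Otimes>b\<in>?S. b [^] count (add_mset i m) b)"
    by (rule monomial_value_superset) (use S in auto)
  also have "\<dots> = (\<Otimes>b\<in>?S. b [^] count m b \<otimes> (if b = i then b else \<one>))"
    by (rule finprod_cong') (use S in \<open>auto simp: nat_pow_Suc\<close>)
  also have "\<dots> = (\<Otimes>b\<in>?S. b [^] count m b) \<otimes> (\<Otimes>b\<in>?S. if b = i then b else \<one>)"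
    by (rule finprod_multf) (use S in auto)
  also have "(\<Otimes>b\<in>?S. if b = i then b else \<one>) = i"
    by (rule finprod_singleton_swap) (use S in auto)
  finally show ?thesis using monomial_value_superset[of ?S m] S by simp
qed

text \<open>These three properties say what the elements of the inductively defined polynomial
  ring look like as coefficient functions.\<close>

lemma (in ring) indexed_psetD:
  assumes "subring k R" "P \<in> indexed_pset B k"
  shows "finite {m. P m \<noteq> \<zero>}" "P m \<in> k" "P m \<noteq> \<zero> \<Longrightarrow> set_mset m \<subseteq> B"
proof -
  have "finite {m. P m \<noteq> \<zero>} \<and> (\<forall>m. P m \<in> k) \<and> (\<forall>m. P m \<noteq> \<zero> \<longrightarrow> set_mset m \<subseteq> B)"
    using assms(2)
  proof (induction rule: indexed_pset.induct)
    case (indexed_const c)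
    have "{m. indexed_const c m \<noteq> \<zero>} \<subseteq> {{#} :: 'b multiset}"
      by (auto simp: indexed_const_def)
    then have "finite {m :: 'b multiset. indexed_const c m \<noteq> \<zero>}"
      using finite_subset by blast
    then show ?case
      using indexed_const subringE(2)[OF assms(1)] by (auto simp: indexed_const_def)
  next
    case (indexed_padd P Q)
    have "{m. indexed_padd P Q m \<noteq> \<zero>} \<subseteq> {m. P m \<noteq> \<zero>} \<union> {m. Q m \<noteq> \<zero>}"
      by (auto simp: indexed_padd_def)
    then have "finite {m. indexed_padd P Q m \<noteq> \<zero>}"
      using indexed_padd finite_subset by blast
    moreover have "indexed_padd P Q m \<in> k" for m
      using indexed_padd subringE(7)[OF assms(1)] by (simp add: indexed_padd_def)
    moreover have "set_mset m \<subseteq> B" if "indexed_padd P Q m \<noteq> \<zero>" for m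
    proof -
      have "P m \<noteq> \<zero> \<or> Q m \<noteq> \<zero>" using that by (auto simp: indexed_padd_def)
      then show ?thesis using indexed_padd by blast
    qed
    ultimately show ?case by blast
  next
    case (indexed_pmult P i)
    have "{m. indexed_pmult P i m \<noteq> \<zero>} \<subseteq> add_mset i ` {m. P m \<noteq> \<zero>}"
      by (auto simp: indexed_pmult_def image_iff split: if_splits) (metis insert_DiffM)
    then have "finite {m. indexed_pmult P i m \<noteq> \<zero>}"
      using indexed_pmult finite_subset by blast
    moreover have "set_mset m \<subseteq> B" if "indexed_pmult P i m \<noteq> \<zero>" for m
    proof -
      have "i \<in># m" "P (m - {#i#}) \<noteq> \<zero>"
        using that by (auto simp: indexed_pmult_def split: if_splits)
      then have "set_mset (m - {#i#}) \<subseteq> B" using indexed_pmult by blast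
      then show ?thesis using \<open>i \<in># m\<close> indexed_pmult.hyps
        by (metis insert_DiffM insert_subset set_mset_add_mset_insert)
    qed
    ultimately show ?case
      using indexed_pmult subringE(2)[OF assms(1)] by (auto simp: indexed_pmult_def)
  qed
  then show "finite {m. P m \<noteq> \<zero>}" "P m \<in> k" "P m \<noteq> \<zero> \<Longrightarrow> set_mset m \<subseteq> B" by auto
qed

lemma (in cring) indexed_value_superset:
  assumes "finite M" "{m. P m \<noteq> \<zero>} \<subseteq> M" "\<And>m. m \<in> M \<Longrightarrow> set_mset m \<subseteq> carrier R"
    "\<And>m. m \<in> M \<Longrightarrow> P m \<in> carrier R"
  shows "indexed_value P = (\<Oplus>m\<in>M. P m \<otimes> monomial_value m)"
  unfolding indexed_value_def
  by (rule add.finprod_mono_neutral_cong_left) (use assms in auto)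

lemma (in ring) indexed_pset_mono:
  assumes "P \<in> indexed_pset A k" "A \<subseteq> B" shows "P \<in> indexed_pset B k"
  using assms(1)
  by (induction rule: indexed_pset.induct) (use assms(2) in \<open>auto intro: indexed_pset.intros\<close>)

lemma (in cring)
  assumes k: "subring k R" and B: "B \<subseteq> carrier R"
  shows indexed_value_closed: "P \<in> indexed_pset B k \<Longrightarrow> indexed_value P \<in> carrier R"
    and indexed_value_padd: "P \<in> indexed_pset B k \<Longrightarrow> Q \<in> indexed_pset B k \<Longrightarrow>
          indexed_value (indexed_padd P Q) = indexed_value P \<oplus> indexed_value Q"
    and indexed_value_pmult: "P \<in> indexed_pset B k \<Longrightarrow> i \<in> B \<Longrightarrow>
          indexed_value (indexed_pmult P i) = indexed_value P \<otimes> i"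
proof -
  note D = indexed_psetD[OF k, of _ B]
  have kc: "k \<subseteq> carrier R" by (rule subringE(1)[OF k])
  have term_closed: "P m \<otimes> monomial_value m \<in> carrier R"
    if "P \<in> indexed_pset B k" "set_mset m \<subseteq> B" for P m
    using D(2)[OF that(1)] that(2) kc B by (intro m_closed monomial_value_closed) auto
  show closed: "indexed_value P \<in> carrier R" if "P \<in> indexed_pset B k" for P
    unfolding indexed_value_def
    by (rule finsum_closed) (use D(3)[OF that] term_closed[OF that] in auto)
  show "indexed_value (indexed_padd P Q) = indexed_value P \<oplus> indexed_value Q"
    if P: "P \<in> indexed_pset B k" and Q: "Q \<in> indexed_pset B k" for P Q
  proof -
    let ?M = "{m. P m \<noteq> \<zero>} \<union> {m. Q m \<noteq> \<zero>}"
    have fin: "finite ?M" using D(1) P Q by auto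
    have M: "set_mset m \<subseteq> B" if "m \<in> ?M" for m using that D(3)[OF P] D(3)[OF Q] by auto
    have c: "P m \<in> carrier R" "Q m \<in> carrier R" for m
      using D(2)[OF P] D(2)[OF Q] kc by auto
    have mc: "monomial_value m \<in> carrier R" if "m \<in> ?M" for m
      using M[OF that] B by (intro monomial_value_closed) auto
    have sup: "indexed_value F = (\<Oplus>m\<in>?M. F m \<otimes> monomial_value m)"
      if "{m. F m \<noteq> \<zero>} \<subseteq> ?M" "\<And>m. F m \<in> carrier R" for F
      by (rule indexed_value_superset) (use fin M B that in auto)
    have "indexed_value (indexed_padd P Q) = (\<Oplus>m\<in>?M. indexed_padd P Q m \<otimes> monomial_value m)"
      by (rule sup) (use c in \<open>auto simp: indexed_padd_def\<close>)
    also have "\<dots> = (\<Oplus>m\<in>?M. P m \<otimes> monomial_value m \<oplus> Q m \<otimes> monomial_value m)"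
      by (rule add.finprod_cong') (use c mc in \<open>auto simp: indexed_padd_def l_distr\<close>)
    also have "\<dots> = (\<Oplus>m\<in>?M. P m \<otimes> monomial_value m) \<oplus> (\<Oplus>m\<in>?M. Q m \<otimes> monomial_value m)"
      by (rule add.finprod_multf) (use c mc in auto)
    also have "\<dots> = indexed_value P \<oplus> indexed_value Q"
      using sup[of P] sup[of Q] c by auto
    finally show ?thesis .
  qed
  show "indexed_value (indexed_pmult P i) = indexed_value P \<otimes> i"
    if P: "P \<in> indexed_pset B k" and i: "i \<in> B" for P i
  proof -
    let ?M = "{m. P m \<noteq> \<zero>}"
    have ic: "i \<in> carrier R" using i B by auto
    have M: "set_mset m \<subseteq> carrier R" if "m \<in> ?M" for m using that D(3)[OF P] B by auto
    have c: "P m \<in> carrier R" for m using D(2)[OF P] kc by auto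
    have supp: "{m. indexed_pmult P i m \<noteq> \<zero>} = add_mset i ` ?M"
      by (auto simp: indexed_pmult_def image_iff split: if_splits) (metis insert_DiffM)
    have "indexed_value (indexed_pmult P i)
        = (\<Oplus>m\<in>add_mset i ` ?M. indexed_pmult P i m \<otimes> monomial_value m)"
      unfolding indexed_value_def supp ..
    also have "\<dots> = (\<Oplus>m\<in>?M. indexed_pmult P i (add_mset i m) \<otimes> monomial_value (add_mset i m))"
      by (rule add.finprod_reindex)
        (use M c ic in \<open>auto simp: indexed_pmult_def monomial_value_add_mset inj_on_def\<close>)
    also have "\<dots> = (\<Oplus>m\<in>?M. (P m \<otimes> monomial_value m) \<otimes> i)"
      by (rule add.finprod_cong')
        (use M c ic in \<open>auto simp: indexed_pmult_def monomial_value_add_mset m_assoc\<close>)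
    also have "\<dots> = indexed_value P \<otimes> i"
      unfolding indexed_value_def
      by (rule finsum_ldistr[symmetric]) (use M c ic D(1)[OF P] in auto)
    finally show ?thesis .
  qed
qed

lemma (in cring) indexed_value_const:
  assumes "c \<in> carrier R" shows "indexed_value (indexed_const c) = c"
proof -
  have "indexed_value (indexed_const c) = (\<Oplus>m\<in>{{#}}. indexed_const c m \<otimes> monomial_value m)"
    by (rule indexed_value_superset) (use assms in \<open>auto simp: indexed_const_def\<close>)
  also have "\<dots> = c" using assms by (simp add: indexed_const_def)
  finally show ?thesis .
qed

section \<open>Algebraic elements over rings of polynomial values\<close>

text \<open>Algebraic dependence on a set \<open>A\<close> is easiest to compute with over the ring \<open>k[A]\<close>,
  and easiest to compose over the field \<open>k(A)\<close>. Clearing denominators identifies the two.\<close>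

text \<open>The ring \<open>k[A]\<close>.\<close>

definition (in ring) polynomial_values :: "'a set \<Rightarrow> 'a set \<Rightarrow> 'a set"
  where "polynomial_values k A = indexed_value ` indexed_pset A k"

lemma (in cring) polynomial_values_incl:
  assumes k: "subring k R" and A: "A \<subseteq> carrier R"
  shows "k \<subseteq> polynomial_values k A" "A \<subseteq> polynomial_values k A"
proof -
  have kc: "k \<subseteq> carrier R" by (rule subringE(1)[OF k])
  show "k \<subseteq> polynomial_values k A"
  proof
    fix c assume "c \<in> k"
    then show "c \<in> polynomial_values k A"
      unfolding polynomial_values_def
      using indexed_value_const[of c] indexed_const[of c k A] kc by force
  qed
  show "A \<subseteq> polynomial_values k A"
  proof
    fix a assume a: "a \<in> A"
    have o: "indexed_const \<one> \<in> indexed_pset A k"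
      by (rule indexed_const) (rule subringE(3)[OF k])
    have "indexed_value (indexed_pmult (indexed_const \<one>) a) = \<one> \<otimes> a"
      using indexed_value_pmult[OF k A o a] indexed_value_const[of \<one>] by simp
    then show "a \<in> polynomial_values k A"
      unfolding polynomial_values_def using indexed_pmult[OF o a] a A by force
  qed
qed

text \<open>Only closure under products needs work: it is proved for a constant factor first,
  then by induction on one of the two polynomials.\<close>

lemma (in cring) polynomial_values_subring:
  assumes k: "subring k R" and A: "A \<subseteq> carrier R"
  shows "subring (polynomial_values k A) R"
proof -
  let ?V = "polynomial_values k A"
  have kc: "k \<subseteq> carrier R" by (rule subringE(1)[OF k])
  note incl = polynomial_values_incl[OF k A]
  have V: "?V \<subseteq> carrier R"
    unfolding polynomial_values_def using indexed_value_closed[OF k A] by auto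
  have add: "x \<oplus> y \<in> ?V" if "x \<in> ?V" "y \<in> ?V" for x y
    using that indexed_value_padd[OF k A, symmetric] indexed_padd[of _ A k]
    unfolding polynomial_values_def by force
  have mult_var: "x \<otimes> a \<in> ?V" if "x \<in> ?V" "a \<in> A" for x a
    using that indexed_value_pmult[OF k A, symmetric] indexed_pmult[of _ A k]
    unfolding polynomial_values_def by force
  have scalar: "c \<otimes> indexed_value P \<in> ?V" if "P \<in> indexed_pset A k" "c \<in> k" for P c
    using that(1)
  proof (induction rule: indexed_pset.induct)
    case (indexed_const d)
    then have "c \<otimes> d \<in> ?V" "indexed_value (indexed_const d) = d"
      using indexed_value_const[of d] incl(1) kc subringE(6)[OF k that(2)] by blast+
    then show ?case by simp
  next
    case (indexed_padd P Q)
    then show ?case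
      using indexed_value_padd[OF k A, of P Q] indexed_value_closed[OF k A] that(2) kc add
      by (auto simp: r_distr)
  next
    case (indexed_pmult P i)
    have "c \<in> carrier R" "i \<in> carrier R" "indexed_value P \<in> carrier R"
      using indexed_value_closed[OF k A] that(2) kc A indexed_pmult by auto
    then have "c \<otimes> indexed_value (indexed_pmult P i) = (c \<otimes> indexed_value P) \<otimes> i"
      using indexed_value_pmult[OF k A, of P i] indexed_pmult by (simp add: m_assoc)
    then show ?case using mult_var indexed_pmult by simp
  qed
  have mult: "x \<otimes> indexed_value P \<in> ?V" if "P \<in> indexed_pset A k" and x: "x \<in> ?V" for P x
    using that(1)
  proof (induction rule: indexed_pset.induct)
    case (indexed_const d)
    obtain Q where "Q \<in> indexed_pset A k" "x = indexed_value Q"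
      using x unfolding polynomial_values_def by auto
    then show ?case
      using indexed_value_const[of d] scalar[of Q d] indexed_const kc indexed_value_closed[OF k A, of Q]
      by (metis m_comm subsetD)
  next
    case (indexed_padd P Q)
    then show ?case
      using indexed_value_padd[OF k A, of P Q] indexed_value_closed[OF k A] that(2) V add
      by (auto simp: r_distr)
  next
    case (indexed_pmult P i)
    have "x \<in> carrier R" "i \<in> carrier R" "indexed_value P \<in> carrier R"
      using indexed_value_closed[OF k A] that(2) V A indexed_pmult by auto
    then have "x \<otimes> indexed_value (indexed_pmult P i) = (x \<otimes> indexed_value P) \<otimes> i"
      using indexed_value_pmult[OF k A, of P i] indexed_pmult by (simp add: m_assoc)
    then show ?case using mult_var indexed_pmult by simp
  qed
  show ?thesis
  proof (rule subringI)
    show "?V \<subseteq> carrier R" by (rule V)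
    show "\<one> \<in> ?V" using incl(1) subringE(3)[OF k] by auto
    have "\<ominus> \<one> \<in> k" using subringE(3,5)[OF k] by auto
    fix x y assume x: "x \<in> ?V" and y: "y \<in> ?V"
    then show "x \<oplus> y \<in> ?V" by (rule add)
    show "x \<otimes> y \<in> ?V" using mult x y unfolding polynomial_values_def by auto
    obtain P where P: "P \<in> indexed_pset A k" "x = indexed_value P"
      using x unfolding polynomial_values_def by auto
    have "\<ominus> x = \<ominus> \<one> \<otimes> x" using x V by (simp add: l_minus subset_iff)
    then show "\<ominus> x \<in> ?V" using scalar[OF P(1) \<open>\<ominus> \<one> \<in> k\<close>] P(2) by simp
  qed
qed

text \<open>The quotients of elements of a subring are closed under all constructors of
  \<open>generate_field\<close>, so they exhaust the field that the subring generates.\<close>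

lemma (in field) generate_field_fractions:
  assumes V: "subring V R" and H: "H \<subseteq> V" and x: "x \<in> generate_field R H"
  shows "\<exists>a\<in>V. \<exists>b\<in>V - {\<zero>}. x = a \<otimes> inv b"
proof -
  note Vc = subringE(1)[OF V] and V1 = subringE(3)[OF V] and V5 = subringE(5)[OF V]
    and V6 = subringE(6)[OF V] and V7 = subringE(7)[OF V]
  have frac: "\<exists>a\<in>V. \<exists>b\<in>V - {\<zero>}. v = a \<otimes> inv b" if "v \<in> V" for v
  proof -
    have "v = v \<otimes> inv \<one>" using that Vc by auto
    moreover have "\<one> \<in> V - {\<zero>}" using V1 by simp
    ultimately show ?thesis using that by blast
  qed
  have ne: "b \<otimes> d \<in> V - {\<zero>}" if "b \<in> V - {\<zero>}" "d \<in> V - {\<zero>}" for b d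
    using that V6[of b d] Vc integral[of b d] by blast
  have U: "b \<in> Units R" "b \<in> carrier R" "inv b \<in> carrier R" "b \<otimes> inv b = \<one>" if "b \<in> V - {\<zero>}" for b
  proof -
    show "b \<in> Units R" using that Vc field_Units by blast
    then show "b \<in> carrier R" "inv b \<in> carrier R" "b \<otimes> inv b = \<one>" by auto
  qed
  have inv_prod: "inv (b \<otimes> d) = inv b \<otimes> inv d" if b: "b \<in> V - {\<zero>}" and d: "d \<in> V - {\<zero>}" for b d
  proof (rule comm_inv_char)
    note Ub = U[OF b] and Ud = U[OF d]
    show "b \<otimes> d \<in> carrier R" "inv b \<otimes> inv d \<in> carrier R" using Ub Ud by auto
    have "b \<otimes> d \<otimes> (inv b \<otimes> inv d) = (b \<otimes> inv b) \<otimes> (d \<otimes> inv d)"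
      using Ub(2,3) Ud(2,3) by algebra
    then show "b \<otimes> d \<otimes> (inv b \<otimes> inv d) = \<one>" using Ub Ud by simp
  qed
  from x show ?thesis
  proof (induction rule: generate_field.induct)
    case one
    then show ?case using frac V1 by blast
  next
    case (incl h)
    then show ?case using frac H by blast
  next
    case (a_inv h)
    then obtain a b where "a \<in> V" "b \<in> V - {\<zero>}" "h = a \<otimes> inv b" by auto
    then have "\<ominus> h = (\<ominus> a) \<otimes> inv b" "\<ominus> a \<in> V"
      using U(3)[of b] subsetD[OF Vc, of a] V5[of a] by (simp_all add: l_minus)
    then show ?case using \<open>b \<in> V - {\<zero>}\<close> by blast
  next
    case (m_inv h)
    then obtain a b where ab: "a \<in> V" "b \<in> V - {\<zero>}" "h = a \<otimes> inv b" by auto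
    then have a: "a \<in> V - {\<zero>}" using m_inv(2) U(3)[of b] by auto
    have "inv h = b \<otimes> inv a"
    proof (rule comm_inv_char)
      show "h \<in> carrier R" "b \<otimes> inv a \<in> carrier R" using ab U[OF a] U[OF ab(2)] by auto
      have "h \<otimes> (b \<otimes> inv a) = (a \<otimes> inv a) \<otimes> (b \<otimes> inv b)"
        unfolding ab(3) using U(2-3)[OF a] U(2-3)[OF ab(2)] by algebra
      then show "h \<otimes> (b \<otimes> inv a) = \<one>" using U[OF a] U[OF ab(2)] by simp
    qed
    then show ?case using a ab by blast
  next
    case (eng_add h1 h2)
    then obtain a b c d where h: "a \<in> V" "b \<in> V - {\<zero>}" "h1 = a \<otimes> inv b"
      "c \<in> V" "d \<in> V - {\<zero>}" "h2 = c \<otimes> inv d" by blast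
    note Ub = U[OF h(2)] and Ud = U[OF h(5)]
    have ac: "a \<in> carrier R" "c \<in> carrier R" using h Vc by auto
    have "(a \<otimes> d \<oplus> c \<otimes> b) \<otimes> inv (b \<otimes> d) = (a \<otimes> d \<oplus> c \<otimes> b) \<otimes> (inv b \<otimes> inv d)"
      by (simp add: inv_prod[OF h(2,5)])
    also have "\<dots> = (a \<otimes> inv b) \<otimes> (d \<otimes> inv d) \<oplus> (c \<otimes> inv d) \<otimes> (b \<otimes> inv b)"
      using Ub(2,3) Ud(2,3) ac by algebra
    also have "\<dots> = h1 \<oplus> h2" using Ub Ud ac h by simp
    finally have "h1 \<oplus> h2 = (a \<otimes> d \<oplus> c \<otimes> b) \<otimes> inv (b \<otimes> d)" by simp
    moreover have "a \<otimes> d \<oplus> c \<otimes> b \<in> V" using h V6 V7 by blast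
    ultimately show ?case using ne[OF h(2,5)] by blast
  next
    case (eng_mult h1 h2)
    then obtain a b c d where h: "a \<in> V" "b \<in> V - {\<zero>}" "h1 = a \<otimes> inv b"
      "c \<in> V" "d \<in> V - {\<zero>}" "h2 = c \<otimes> inv d" by blast
    note Ub = U[OF h(2)] and Ud = U[OF h(5)]
    have ac: "a \<in> carrier R" "c \<in> carrier R" using h Vc by auto
    have "(a \<otimes> c) \<otimes> inv (b \<otimes> d) = (a \<otimes> c) \<otimes> (inv b \<otimes> inv d)"
      by (simp add: inv_prod[OF h(2,5)])
    also have "\<dots> = h1 \<otimes> h2" unfolding h using Ub(2,3) Ud(2,3) ac by algebra
    finally have "h1 \<otimes> h2 = (a \<otimes> c) \<otimes> inv (b \<otimes> d)" by simp
    then show ?case using ne[OF h(2,5)] V6 h by blast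
  qed
qed

text \<open>A polynomial over the fractions becomes one over the subring after multiplication
  with a common denominator of its coefficients, and keeps its roots.\<close>

lemma (in field) algebraic_over_fractions:
  assumes V: "subring V R" and H: "H \<subseteq> V" and x: "x \<in> carrier R"
    and alg: "(algebraic over (generate_field R H)) x"
  shows "(algebraic over V) x"
proof -
  let ?L = "generate_field R H"
  note Vc = subringE(1)[OF V] and V6 = subringE(6)[OF V]
  have Hc: "H \<subseteq> carrier R" using H Vc by auto
  have Lc: "?L \<subseteq> carrier R" by (rule generate_field_incl[OF Hc])
  have clear: "\<exists>d\<in>V - {\<zero>}. \<forall>c\<in>set p. d \<otimes> c \<in> V" if "set p \<subseteq> ?L" for p
    using that
  proof (induction p)
    case Nil
    then show ?case using subringE(3)[OF V] by (intro bexI[of _ \<one>]) auto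
  next
    case (Cons c p)
    then obtain d where d: "d \<in> V - {\<zero>}" "\<forall>c\<in>set p. d \<otimes> c \<in> V" by auto
    obtain a b where ab: "a \<in> V" "b \<in> V - {\<zero>}" "c = a \<otimes> inv b"
      using generate_field_fractions[OF V H, of c] Cons.prems by auto
    have U: "b \<in> carrier R" "inv b \<in> carrier R" "b \<otimes> inv b = \<one>" "a \<in> carrier R" "d \<in> carrier R"
      using ab d Vc field_Units by (auto simp: subset_iff)
    have "(d \<otimes> b) \<otimes> c = (d \<otimes> a) \<otimes> (b \<otimes> inv b)" unfolding ab(3) using U(1,2,4,5) by algebra
    then have "(d \<otimes> b) \<otimes> c \<in> V" using U V6 ab d by simp
    moreover have "(d \<otimes> b) \<otimes> e \<in> V" if "e \<in> set p" for e
    proof -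
      have "e \<in> carrier R" using that Cons.prems Lc by auto
      then have "(d \<otimes> b) \<otimes> e = b \<otimes> (d \<otimes> e)" using U by (simp add: m_ac)
      then show ?thesis using d that ab V6 by auto
    qed
    moreover have "d \<otimes> b \<in> V - {\<zero>}" using ab d U V6 integral[of d b] by blast
    ultimately show ?case by (intro bexI[of _ "d \<otimes> b"]) auto
  qed
  obtain p where p: "p \<in> carrier (?L[X])" "p \<noteq> []" "eval p x = \<zero>"
    using algebraicE[OF subfieldE(1)[OF generate_field_is_subfield[OF Hc]] x alg] .
  have pL: "set p \<subseteq> ?L" "lead_coeff p \<noteq> \<zero>"
    using p unfolding univ_poly_def polynomial_def by auto
  obtain d where d: "d \<in> V - {\<zero>}" "\<forall>c\<in>set p. d \<otimes> c \<in> V" using clear[OF pL(1)] by auto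
  let ?q = "map ((\<otimes>) d) p"
  have dc: "d \<in> carrier R" and pc: "set p \<subseteq> carrier R" using d Vc pL Lc by auto
  have "eval (map ((\<otimes>) d) q) x = d \<otimes> eval q x" if "set q \<subseteq> carrier R" for q
    using that
  proof (induction q)
    case (Cons c q)
    then have "eval q x \<in> carrier R" using x by (intro eval_in_carrier) auto
    then show ?case using Cons x dc by (simp add: r_distr m_assoc)
  qed (use dc in auto)
  from this[OF pc] have "eval ?q x = \<zero>" using p(3) dc by simp
  moreover have "polynomial V ?q"
  proof -
    have "hd ?q = d \<otimes> hd p" using p(2) by (cases p) auto
    then have "hd ?q \<noteq> \<zero>" using pL(2) dc pc d p(2) integral[of d "hd p"] by (cases p) auto
    then show ?thesis unfolding polynomial_def using d(2) by auto
  qed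
  ultimately show ?thesis
    using algebraicI[of ?q V x] p(2) by (simp add: univ_poly_carrier)
qed

text \<open>The finitely many coefficients of an equation for \<open>e\<close> are algebraic and generate a
  finite extension of \<open>L\<close>; adjoining \<open>e\<close> to it keeps the dimension finite.\<close>

lemma (in field) algebraic_trans:
  assumes L: "subfield L R" and e: "e \<in> carrier R"
    and alg: "(algebraic over {x \<in> carrier R. (algebraic over L) x}) e"
  shows "(algebraic over L) e"
proof -
  let ?M = "{x \<in> carrier R. (algebraic over L) x}"
  have M: "subfield ?M R" by (rule subfield_of_algebraics[OF L])
  obtain p where p: "p \<in> carrier (?M[X])" "p \<noteq> []" "eval p e = \<zero>"
    using algebraicE[OF subfieldE(1)[OF M] e alg] .
  have pM: "set p \<subseteq> ?M" "lead_coeff p \<noteq> \<zero>"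
    using p unfolding univ_poly_def polynomial_def by auto
  have pc: "set p \<subseteq> carrier R" and pa: "\<And>x. x \<in> set p \<Longrightarrow> (algebraic over L) x" using pM by auto
  let ?F = "finite_extension L p"
  have F: "subfield ?F R" by (rule finite_extension_is_subfield[OF L pc pa])
  have finF: "finite_dimension L ?F" by (rule finite_extension_finite_dimension(1)[OF L pc pa])
  have "set p \<subseteq> ?F" by (rule finite_extension_mem[OF subfieldE(1)[OF L] pc])
  then have "polynomial ?F p" using pM unfolding polynomial_def by auto
  then have ae: "(algebraic over ?F) e" using algebraicI[of p ?F e] p by (simp add: univ_poly_carrier)
  have "finite_dimension ?F (simple_extension ?F e)"
    using finite_dimension_simple_extension[OF F e] ae by simp
  then have "finite_dimension L (simple_extension ?F e)"
    by (rule telescopic_base_dim(1)[OF L F finF])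
  then show ?thesis
    using finite_dimension_imp_algebraic[OF L simple_extension_is_subring[OF subfieldE(1)[OF F] e]]
      simple_extension_mem[OF subfieldE(1)[OF F] e] by auto
qed

section \<open>Algebraic independence of one more element\<close>

text \<open>A polynomial in the variables \<open>insert x A\<close> is a polynomial in \<open>x\<close> whose coefficients
  are polynomials in the variables \<open>A\<close>. The library's \<open>indexed_eval\<close> assembles the former
  from a list of the latter; the lemmas below show that this commutes with evaluation and
  that every polynomial arises.\<close>

lemma (in ring) indexed_eval_snoc:
  "indexed_eval (Ps @ [P]) x = indexed_padd (indexed_pmult (indexed_eval Ps x) x) P"
  by simp

lemma (in ring) indexed_eval_mem:
  assumes "\<zero> \<in> k" "set Ps \<subseteq> indexed_pset A k"
  shows "indexed_eval Ps x \<in> indexed_pset (insert x A) k"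
  using assms(2)
proof (induction Ps rule: rev_induct)
  case Nil
  then show ?case using indexed_const[OF assms(1)] by simp
next
  case (snoc P Ps)
  then have "P \<in> indexed_pset (insert x A) k" by (auto intro: indexed_pset_mono)
  then show ?case unfolding indexed_eval_snoc
    using snoc by (auto intro!: indexed_padd indexed_pmult)
qed

lemma (in cring) indexed_value_indexed_eval:
  assumes k: "subring k R" and A: "A \<subseteq> carrier R" and x: "x \<in> carrier R"
    and "set Ps \<subseteq> indexed_pset A k"
  shows "indexed_value (indexed_eval Ps x) = eval (map indexed_value Ps) x"
  using assms(4)
proof (induction Ps rule: rev_induct)
  case Nil
  then show ?case using indexed_value_const[OF zero_closed] by simp
next
  case (snoc P Ps)
  have xA: "insert x A \<subseteq> carrier R" using A x by simp
  note k0 = subringE(2)[OF k]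
  have P: "P \<in> indexed_pset (insert x A) k" "P \<in> indexed_pset A k"
    using snoc.prems by (auto intro: indexed_pset_mono)
  have E: "indexed_eval Ps x \<in> indexed_pset (insert x A) k"
    using indexed_eval_mem[OF k0] snoc.prems by auto
  have "indexed_value (indexed_eval (Ps @ [P]) x) = indexed_value (indexed_eval Ps x) \<otimes> x \<oplus> indexed_value P"
    unfolding indexed_eval_snoc
    using indexed_value_padd[OF k xA indexed_pmult[OF E] P(1)] indexed_value_pmult[OF k xA E] by simp
  also have "\<dots> = eval (map indexed_value Ps @ [indexed_value P]) x"
    using snoc indexed_value_closed[OF k A] P(2) x by (subst eval_append_aux) auto
  finally show ?case by simp
qed

text \<open>The polynomials of the form \<open>indexed_eval Ps x\<close> are closed under the constructors:
  sums and products with a variable of \<open>A\<close> act on the coefficients, and multiplication with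
  \<open>x\<close> appends a zero coefficient.\<close>

lemma (in cring) indexed_pset_insert_eval:
  assumes k: "subring k R" and P: "P \<in> indexed_pset (insert x A) k"
  shows "\<exists>Ps. set Ps \<subseteq> indexed_pset A k \<and> P = indexed_eval Ps x"
proof -
  note k0 = subringE(2)[OF k]
  have coeff: "carrier_coeff Q" if "Q \<in> indexed_pset B k" for Q B
    using indexed_pset_in_carrier[OF subringE(1)[OF k] that] .
  have c: "Q m \<in> carrier R" if "Q \<in> indexed_pset B k" for Q m B
    using coeff[OF that] by (rule carrier_coeffE)
  have mem: "indexed_eval Ps x \<in> indexed_pset (insert x A) k" if "set Ps \<subseteq> indexed_pset A k" for Ps
    using indexed_eval_mem[OF k0 that] .
  have add: "\<exists>Rs. set Rs \<subseteq> indexed_pset A k \<and>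
      indexed_padd (indexed_eval Ps x) (indexed_eval Qs x) = indexed_eval Rs x"
    if "set Ps \<subseteq> indexed_pset A k" "set Qs \<subseteq> indexed_pset A k" for Ps Qs
    using that
  proof (induction Ps arbitrary: Qs rule: rev_induct)
    case Nil
    have "indexed_padd (indexed_const \<zero>) (indexed_eval Qs x) = indexed_eval Qs x"
      by (rule indexed_padd_zero(2)) (rule coeff[OF mem[OF Nil(2)]])
    then show ?case using Nil by (auto simp del: indexed_eval.simps simp: indexed_eval.simps[of "[]"])
  next
    case (snoc P Ps)
    show ?case
    proof (cases Qs rule: rev_cases)
      case Nil
      have "indexed_padd (indexed_eval (Ps @ [P]) x) (indexed_const \<zero>) = indexed_eval (Ps @ [P]) x"
        by (rule indexed_padd_zero(1)) (rule coeff[OF mem[OF snoc.prems(1)]])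
      then show ?thesis using Nil snoc.prems
        by (intro exI[of _ "Ps @ [P]"]) (simp del: indexed_eval.simps add: indexed_eval.simps[of "[]"])
    next
      case (snoc Qs' Q)
      obtain Rs where Rs: "set Rs \<subseteq> indexed_pset A k"
        "indexed_padd (indexed_eval Ps x) (indexed_eval Qs' x) = indexed_eval Rs x"
        using snoc.IH[of Qs'] snoc.prems snoc by auto
      have cs: "indexed_eval Ps x m \<in> carrier R" "indexed_eval Qs' x m \<in> carrier R"
        "P m \<in> carrier R" "Q m \<in> carrier R" for m
        using c[OF mem] c[of P A] c[of Q A] snoc.prems snoc by auto
      have "indexed_padd (indexed_eval (Ps @ [P]) x) (indexed_eval Qs x)
          = indexed_padd (indexed_pmult (indexed_padd (indexed_eval Ps x) (indexed_eval Qs' x)) x)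
              (indexed_padd P Q)"
        unfolding snoc indexed_eval_snoc unfolding indexed_padd_def indexed_pmult_def
        using cs by (auto simp: fun_eq_iff a_ac simp del: indexed_eval.simps)
      also have "\<dots> = indexed_eval (Rs @ [indexed_padd P Q]) x"
        unfolding Rs(2) indexed_eval_snoc ..
      finally show ?thesis using Rs(1) snoc.prems snoc
        by (intro exI[of _ "Rs @ [indexed_padd P Q]"])
          (auto intro: indexed_padd simp del: indexed_eval.simps)
    qed
  qed
  have mult: "\<exists>Rs. set Rs \<subseteq> indexed_pset A k \<and>
      indexed_pmult (indexed_eval Ps x) i = indexed_eval Rs x"
    if "set Ps \<subseteq> indexed_pset A k" "i \<in> A" for Ps i
    using that(1)
  proof (induction Ps rule: rev_induct)
    case Nil
    then show ?case by (intro exI[of _ "[]"]) simp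
  next
    case (snoc P Ps)
    obtain Rs where Rs: "set Rs \<subseteq> indexed_pset A k"
      "indexed_pmult (indexed_eval Ps x) i = indexed_eval Rs x" using snoc by auto
    have mem: "a \<in># m - {#b#} \<longleftrightarrow> a \<in># m" if "a \<noteq> b" for a b m
      using that by (simp add: in_diff_count)
    have "indexed_pmult (indexed_eval (Ps @ [P]) x) i
        = indexed_padd (indexed_pmult (indexed_pmult (indexed_eval Ps x) i) x) (indexed_pmult P i)"
      unfolding indexed_eval_snoc unfolding indexed_padd_def indexed_pmult_def
      by (cases "i = x")
        (auto simp: fun_eq_iff add_mset_commute mem simp del: indexed_eval.simps)
    also have "\<dots> = indexed_eval (Rs @ [indexed_pmult P i]) x"
      unfolding Rs(2) indexed_eval_snoc ..
    finally show ?case using Rs(1) snoc.prems that(2)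
      by (intro exI[of _ "Rs @ [indexed_pmult P i]"])
        (auto intro: indexed_pmult simp del: indexed_eval.simps)
  qed
  from P show ?thesis
  proof (induction rule: indexed_pset.induct)
    case (indexed_const d)
    have "indexed_const d = indexed_eval [indexed_const d] x"
      using subringE(1)[OF k] indexed_const
      by (auto simp: indexed_const_def indexed_padd_def indexed_pmult_def fun_eq_iff)
    then show ?case using indexed_pset.indexed_const[OF indexed_const]
      by (intro exI[of _ "[indexed_const d]"]) auto
  next
    case (indexed_padd P Q)
    then show ?case using add by metis
  next
    case (indexed_pmult P i)
    then obtain Ps where Ps: "set Ps \<subseteq> indexed_pset A k" "P = indexed_eval Ps x" by auto
    show ?case
    proof (cases "i \<in> A")
      case True
      then show ?thesis using mult Ps by metis
    next
      case False
      then have i: "i = x" using indexed_pmult by auto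
      have "indexed_pmult P i \<in> indexed_pset (insert x A) k"
        using indexed_pmult by (auto intro: indexed_pset.indexed_pmult)
      then have "indexed_padd (indexed_pmult P i) (indexed_const \<zero>) = indexed_pmult P i"
        by (rule indexed_padd_zero(1)[OF coeff])
      then have "indexed_pmult P i = indexed_eval (Ps @ [indexed_const \<zero>]) x"
        unfolding indexed_eval_snoc i Ps(2) by simp
      then show ?thesis using Ps(1) indexed_pset.indexed_const[OF k0]
        by (intro exI[of _ "Ps @ [indexed_const \<zero>]"]) (auto simp del: indexed_eval.simps)
    qed
  qed
qed

lemma (in ring) algebraically_independent_mono:
  assumes "algebraically_independent k B" "A \<subseteq> B"
  shows "algebraically_independent k A"
  using assms indexed_pset_mono[of _ A k B] unfolding algebraically_independent_def by blast

lemma (in ring) normalize_Nil: "normalize p = [] \<Longrightarrow> set p \<subseteq> {\<zero>}"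
  by (induction p) (auto split: if_splits)

text \<open>Assume \<open>x\<close> is a root of a nonzero polynomial over \<open>k[A]\<close>. Choosing indexed
  polynomials for its coefficients gives a nonzero indexed polynomial with value zero,
  because \<open>x\<close> is a new variable. Conversely a vanishing polynomial in \<open>insert x A\<close> is a
  polynomial relation for \<open>x\<close> over \<open>k[A]\<close>, so its coefficients vanish, and they are values
  of polynomials in the independent set \<open>A\<close>.\<close>

lemma (in field) algebraically_independent_insert:
  assumes k: "subring k R" and A: "A \<subseteq> carrier R" and x: "x \<in> carrier R" "x \<notin> A"
  shows "algebraically_independent k (insert x A) \<longleftrightarrow>
    algebraically_independent k A \<and> (transcendental over (polynomial_values k A)) x"
proof (intro iffI conjI)
  note k0 = subringE(2)[OF k]
  have xA: "insert x A \<subseteq> carrier R" using A x by simp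
  note V = polynomial_values_subring[OF k A]
  assume ind: "algebraically_independent k (insert x A)"
  then show "algebraically_independent k A"
    by (rule algebraically_independent_mono) auto
  show "(transcendental over (polynomial_values k A)) x"
  proof (rule ccontr)
    assume "\<not> (transcendental over (polynomial_values k A)) x"
    then have "(algebraic over (polynomial_values k A)) x" unfolding over_def .
    from algebraicE[OF V x(1) this] obtain p where
      p: "p \<in> carrier ((polynomial_values k A)[X])" "p \<noteq> []" "eval p x = \<zero>" .
    then have pV: "set p \<subseteq> polynomial_values k A" "lead_coeff p \<noteq> \<zero>"
      unfolding univ_poly_def polynomial_def by auto
    define Ps where "Ps = map (inv_into (indexed_pset A k) indexed_value) p"
    have Ps: "set Ps \<subseteq> indexed_pset A k"
      using pV(1) inv_into_into[of _ indexed_value "indexed_pset A k"]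
      unfolding polynomial_values_def Ps_def by auto
    have pPs: "p = map indexed_value Ps"
      using pV(1) f_inv_into_f[of _ indexed_value "indexed_pset A k"]
      unfolding polynomial_values_def Ps_def by (simp add: map_idI subset_iff)
    obtain Q Qs where Q: "Ps = Q # Qs" using p(2) pPs by (cases Ps) auto
    have free: "index_free P x" if "P \<in> set Ps" for P
      using that Ps indexed_psetD(3)[OF k, of P A] x(2) unfolding index_free_def by blast
    have coeff: "carrier_coeff P" if "P \<in> set Ps" for P
      using that Ps indexed_pset_in_carrier[OF subringE(1)[OF k]] by blast
    have "Q \<noteq> indexed_const \<zero>"
      using pV(2) pPs Q indexed_value_const[OF zero_closed] by auto
    then obtain m where "indexed_eval (Q # Qs) x m \<noteq> \<zero>"
      using exists_indexed_eval_monomial'[of Q Qs x "\<exists>m. indexed_eval (Q # Qs) x m \<noteq> \<zero>"] coeff free Q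
      by (auto simp: list_all_iff simp del: indexed_eval.simps)
    moreover have "indexed_eval Ps x = indexed_const \<zero>"
      using ind indexed_eval_mem[OF k0 Ps] indexed_value_indexed_eval[OF k A x(1) Ps] p(3) pPs
      unfolding algebraically_independent_def by auto
    ultimately show False using Q by (simp add: indexed_const_def del: indexed_eval.simps)
  qed
next
  note k0 = subringE(2)[OF k]
  assume "algebraically_independent k A \<and> (transcendental over (polynomial_values k A)) x"
  then have ind: "algebraically_independent k A"
    and tr: "(transcendental over (polynomial_values k A)) x" by auto
  show "algebraically_independent k (insert x A)"
    unfolding algebraically_independent_def
  proof (intro conjI ballI impI)
    show "insert x A \<subseteq> carrier R" using A x by simp
    fix P assume P: "P \<in> indexed_pset (insert x A) k" and P0: "indexed_value P = \<zero>"
    from indexed_pset_insert_eval[OF k P] obtain Ps where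
      Ps: "set Ps \<subseteq> indexed_pset A k" "P = indexed_eval Ps x" by (elim exE conjE)
    let ?p = "map indexed_value Ps"
    have pc: "set ?p \<subseteq> carrier R" using Ps(1) indexed_value_closed[OF k A] by auto
    have "set ?p \<subseteq> polynomial_values k A" using Ps(1) unfolding polynomial_values_def by auto
    then have "normalize ?p \<in> carrier ((polynomial_values k A)[X])"
      using normalize_gives_polynomial by (simp add: univ_poly_def)
    moreover have "eval (normalize ?p) x = \<zero>"
      using eval_normalize[OF pc x(1)] indexed_value_indexed_eval[OF k A x(1) Ps(1)] P0 Ps(2) by simp
    ultimately have "normalize ?p = []" by (rule eval_transcendental[OF tr])
    then have "set ?p \<subseteq> {\<zero>}" by (rule normalize_Nil)
    then have "Q = indexed_const \<zero>" if "Q \<in> set Ps" for Q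
      using that Ps(1) ind unfolding algebraically_independent_def by auto
    then have "indexed_eval Ps x = indexed_const \<zero>"
    proof (induction Ps rule: rev_induct)
      case (snoc Q Ps)
      then have "Q = indexed_const \<zero>" "indexed_eval Ps x = indexed_const \<zero>" by auto
      then show ?case unfolding indexed_eval_snoc
        by (simp add: indexed_padd_const del: indexed_eval.simps)
    qed simp
    then show "P = indexed_const \<zero>" using Ps(2) by simp
  qed
qed

text \<open>The form in which independence is used from here on: a set stays independent exactly
  when elements transcendental over the field generated so far are added.\<close>

lemma (in field) algebraically_independent_insert_field:
  assumes k: "subfield k R" and A: "A \<subseteq> carrier R" and x: "x \<in> carrier R" "x \<notin> A"
  shows "algebraically_independent k (insert x A) \<longleftrightarrow>
    algebraically_independent k A \<and> \<not> (algebraic over (generate_field R (k \<union> A))) x"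
proof -
  let ?V = "polynomial_values k A"
  note kr = subfieldE(1)[OF k]
  have V: "subring ?V R" by (rule polynomial_values_subring[OF kr A])
  have incl: "k \<union> A \<subseteq> ?V" using polynomial_values_incl[OF kr A] by auto
  have kA: "k \<union> A \<subseteq> carrier R" using A subringE(1)[OF kr] by auto
  have G: "subfield (generate_field R (k \<union> A)) R" by (rule generate_field_is_subfield[OF kA])
  have G6: "subring (generate_field R (k \<union> A)) R" using subfieldE(1)[OF G] .
  have "indexed_value P \<in> generate_field R (k \<union> A)" if "P \<in> indexed_pset A k" for P
    using that
  proof (induction rule: indexed_pset.induct)
    case (indexed_const c)
    then have "indexed_value (indexed_const c) = c"
      using indexed_value_const[of c] subringE(1)[OF kr] by blast
    then show ?case using indexed_const by (auto intro: generate_field.incl)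
  next
    case (indexed_padd P Q)
    then show ?case using indexed_value_padd[OF kr A, of P Q] subringE(7)[OF G6] by simp
  next
    case (indexed_pmult P i)
    then show ?case using indexed_value_pmult[OF kr A, of P i] subringE(6)[OF G6]
      by (simp add: generate_field.incl)
  qed
  then have sub: "?V \<subseteq> generate_field R (k \<union> A)" unfolding polynomial_values_def by auto
  have "(algebraic over ?V) x \<longleftrightarrow> (algebraic over (generate_field R (k \<union> A))) x"
    using algebraic_mono[OF sub] algebraic_over_fractions[OF V incl x(1)] by blast
  then show ?thesis
    using algebraically_independent_insert[OF kr A x] unfolding over_def by blast
qed

section \<open>Transcendence degree\<close>

lemma (in field) algebraic_over_generate_field_trans:
  assumes H: "H \<subseteq> carrier R" and H': "H' \<subseteq> carrier R"
    and alg: "\<And>x. x \<in> H' \<Longrightarrow> (algebraic over (generate_field R H)) x"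
    and e: "e \<in> carrier R" "(algebraic over (generate_field R H')) e"
  shows "(algebraic over (generate_field R H)) e"
proof -
  let ?L = "generate_field R H"
  let ?M = "{x \<in> carrier R. (algebraic over ?L) x}"
  have L: "subfield ?L R" by (rule generate_field_is_subfield[OF H])
  have "generate_field R H' \<subseteq> ?M"
    by (rule generate_field_min_subfield1[OF H' subfield_of_algebraics[OF L]]) (use alg H' in auto)
  then have "(algebraic over ?M) e" using e(2) by (rule algebraic_mono)
  then show ?thesis by (rule algebraic_trans[OF L e(1)])
qed

lemma (in field) algebraic_generate_field_mem:
  assumes "H \<subseteq> carrier R" "x \<in> H"
  shows "(algebraic over (generate_field R H)) x"
  using algebraic_self[OF subfieldE(1)[OF generate_field_is_subfield[OF assms(1)]]
      generate_field.incl[OF assms(2)]] .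

text \<open>Steinitz exchange, by induction on the number of elements of \<open>Y\<close> outside \<open>T\<close>. If \<open>y\<close>
  is such an element, then some \<open>x \<in> T\<close> is transcendental over \<open>k(Y - {y})\<close>, since otherwise
  everything, and \<open>y\<close> in particular, would be algebraic over that field. Replacing \<open>y\<close> by
  \<open>x\<close> keeps \<open>Y\<close> independent and of the same size.\<close>

lemma (in field) algebraically_independent_card_le:
  assumes k: "subfield k R" and T: "T \<subseteq> carrier R" "finite T"
    and gen: "\<And>e. e \<in> carrier R \<Longrightarrow> (algebraic over (generate_field R (k \<union> T))) e"
    and Y: "algebraically_independent k Y" "finite Y"
  shows "card Y \<le> card T"
  using Y
proof (induction "card (Y - T)" arbitrary: Y rule: less_induct)
  case less
  have kc: "k \<subseteq> carrier R" by (rule subfieldE(3)[OF k])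
  have Yc: "Y \<subseteq> carrier R" using less.prems unfolding algebraically_independent_def by auto
  show ?case
  proof (cases "Y \<subseteq> T")
    case True
    then show ?thesis using T(2) card_mono by blast
  next
    case False
    then obtain y where y: "y \<in> Y" "y \<notin> T" by auto
    let ?Z = "Y - {y}"
    have Zc: "?Z \<subseteq> carrier R" and yc: "y \<in> carrier R" using Yc y by auto
    have kZ: "k \<union> ?Z \<subseteq> carrier R" and kX: "k \<union> T \<subseteq> carrier R" using kc Zc T by auto
    have Z: "algebraically_independent k ?Z" and ny: "\<not> (algebraic over (generate_field R (k \<union> ?Z))) y"
      using algebraically_independent_insert_field[OF k Zc yc] less.prems(1) y
      by (auto simp: insert_absorb)
    have "\<exists>x\<in>T. \<not> (algebraic over (generate_field R (k \<union> ?Z))) x"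
    proof (rule ccontr)
      assume "\<not> ?thesis"
      then have "(algebraic over (generate_field R (k \<union> ?Z))) x" if "x \<in> k \<union> T" for x
        using that algebraic_generate_field_mem[OF kZ, of x] by auto
      from algebraic_over_generate_field_trans[OF kZ kX this yc gen[OF yc]] ny
      show False by simp
    qed
    then obtain x where x: "x \<in> T" "\<not> (algebraic over (generate_field R (k \<union> ?Z))) x" by auto
    have xc: "x \<in> carrier R" using x T by auto
    have xZ: "x \<notin> ?Z" using x(2) algebraic_generate_field_mem[OF kZ, of x] by blast
    let ?Y' = "insert x ?Z"
    have ind: "algebraically_independent k ?Y'"
      using algebraically_independent_insert_field[OF k Zc xc xZ] Z x(2) by simp
    have fin: "finite ?Y'" using less.prems(2) by simp
    have "?Y' - T \<subset> Y - T" using x y by auto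
    then have "card (?Y' - T) < card (Y - T)" using less.prems(2) by (intro psubset_card_mono) auto
    from less.hyps[OF this ind fin] have "card ?Y' \<le> card T" .
    moreover have "card ?Y' = card Y"
      using xZ less.prems(2) y by (metis card.remove card_insert_disjoint finite_Diff)
    ultimately show ?thesis by simp
  qed
qed

lemma (in field) algebraically_independent_finite:
  assumes k: "subfield k R" and T: "T \<subseteq> carrier R" "finite T"
    and gen: "\<And>e. e \<in> carrier R \<Longrightarrow> (algebraic over (generate_field R (k \<union> T))) e"
    and Y: "algebraically_independent k Y"
  shows "finite Y \<and> card Y \<le> card T"
proof -
  have "finite Y"
  proof (rule ccontr)
    assume "infinite Y"
    from infinite_arbitrarily_large[OF this, of "Suc (card T)"]
    obtain Z where "Z \<subseteq> Y" "finite Z" "card Z = Suc (card T)" by auto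
    moreover from this have "card Z \<le> card T"
      by (intro algebraically_independent_card_le[OF k T gen] algebraically_independent_mono[OF Y])
    ultimately show False by linarith
  qed
  moreover from this have "card Y \<le> card T"
    by (intro algebraically_independent_card_le[OF k T gen Y])
  ultimately show ?thesis by simp
qed

lemma (in field) transcendence_basis_algebraic:
  assumes k: "subfield k R" and B: "transcendence_basis k B" and e: "e \<in> carrier R"
  shows "(algebraic over (generate_field R (k \<union> B))) e"
proof (rule ccontr)
  assume *: "\<not> ?thesis"
  have Bc: "B \<subseteq> carrier R" and ind: "algebraically_independent k B"
    using B unfolding transcendence_basis_def algebraically_independent_def by auto
  have kB: "k \<union> B \<subseteq> carrier R" using Bc subfieldE(3)[OF k] by auto
  have eB: "e \<notin> B" using * algebraic_generate_field_mem[OF kB, of e] by auto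
  then have "algebraically_independent k (insert e B)"
    using algebraically_independent_insert_field[OF k Bc e eB] ind * by simp
  then have "insert e B = B" using B unfolding transcendence_basis_def by blast
  then show False using eB by auto
qed

lemma (in field) algebraically_independent_empty:
  assumes "subfield k R"
  shows "algebraically_independent k {}"
  unfolding algebraically_independent_def
proof (intro conjI ballI impI)
  note kr = subfieldE(1)[OF assms]
  fix P assume P: "P \<in> indexed_pset {} k" and "indexed_value P = \<zero>"
  have "P = indexed_const (P {#})"
    using indexed_psetD(3)[OF kr P] by (force simp: indexed_const_def)
  moreover have "P {#} \<in> carrier R"
    using indexed_psetD(2)[OF kr P] subringE(1)[OF kr] by auto
  ultimately show "P = indexed_const \<zero>"
    using indexed_value_const \<open>indexed_value P = \<zero>\<close> by metis
qed simp

text \<open>A polynomial mentions finitely many variables, which all lie in one member of the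
  chain.\<close>

lemma (in ring) algebraically_independent_Union_chain:
  assumes "subset.chain {B. algebraically_independent k B} C" "C \<noteq> {}"
  shows "algebraically_independent k (\<Union>C)"
  unfolding algebraically_independent_def
proof (intro conjI ballI impI)
  have ind: "algebraically_independent k B" if "B \<in> C" for B
    using that assms(1) unfolding subset.chain_def by auto
  then show "\<Union>C \<subseteq> carrier R" unfolding algebraically_independent_def by auto
  have "\<exists>B\<in>C. P \<in> indexed_pset B k" if "P \<in> indexed_pset (\<Union>C) k" for P
    using that
  proof (induction rule: indexed_pset.induct)
    case (indexed_const c)
    then show ?case using assms(2) indexed_pset.indexed_const by blast
  next
    case (indexed_padd P Q)
    then obtain B B' where B: "B \<in> C" "B' \<in> C" "P \<in> indexed_pset B k" "Q \<in> indexed_pset B' k" by auto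
    then have "B \<subseteq> B' \<or> B' \<subseteq> B" using assms(1) unfolding subset.chain_def by blast
    then show ?case using B indexed_pset_mono indexed_pset.indexed_padd by metis
  next
    case (indexed_pmult P i)
    then obtain B B' where B: "B \<in> C" "B' \<in> C" "P \<in> indexed_pset B k" "i \<in> B'" by auto
    then have "B \<subseteq> B' \<or> B' \<subseteq> B" using assms(1) unfolding subset.chain_def by blast
    then show ?case using B indexed_pset_mono indexed_pset.indexed_pmult by (metis subsetD)
  qed
  then show "P = indexed_const \<zero>"
    if "P \<in> indexed_pset (\<Union>C) k" "indexed_value P = \<zero>" for P
    using that ind unfolding algebraically_independent_def by blast
qed

lemma (in field) transcendence_basis_exists:
  assumes "subfield k R"
  shows "\<exists>B. transcendence_basis k B"
proof -
  have "\<exists>B\<in>{B. algebraically_independent k B}. \<forall>B'\<in>{B. algebraically_independent k B}. B \<subseteq> B' \<longrightarrow> B' = B"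
  proof (rule subset_Zorn_nonempty)
    show "{B. algebraically_independent k B} \<noteq> {}"
      using algebraically_independent_empty[OF assms] by blast
    show "\<Union>C \<in> {B. algebraically_independent k B}"
      if "C \<noteq> {}" "subset.chain {B. algebraically_independent k B} C" for C
      using algebraically_independent_Union_chain[OF that(2,1)] by simp
  qed
  then show ?thesis unfolding transcendence_basis_def by blast
qed

text \<open>The choice in the definition of \<open>trdeg\<close> picks an actual basis, so its value is
  controlled by bounds that hold for every basis.\<close>

lemma (in field) trdeg_basis:
  assumes "subfield k R"
  obtains B where "transcendence_basis k B" "trdeg k = (if finite B then enat (card B) else \<infinity>)"
proof
  show "transcendence_basis k (SOME B. transcendence_basis k B)"
    using someI_ex[OF transcendence_basis_exists[OF assms]] .
qed (simp add: trdeg_def Let_def)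

lemma (in field) trdeg_ge:
  assumes k: "subfield k R" and Y: "algebraically_independent k Y" "finite Y"
  shows "enat (card Y) \<le> trdeg k"
proof -
  obtain B where B: "transcendence_basis k B" "trdeg k = (if finite B then enat (card B) else \<infinity>)"
    using trdeg_basis[OF k] .
  have "B \<subseteq> carrier R"
    using B(1) unfolding transcendence_basis_def algebraically_independent_def by auto
  then have "card Y \<le> card B" if "finite B"
    using algebraically_independent_card_le[OF k _ that transcendence_basis_algebraic[OF k B(1)] Y] by simp
  then show ?thesis using B(2) by simp
qed

lemma (in field) trdeg_eq:
  assumes k: "subfield k R" and Y: "algebraically_independent k Y" "finite Y"
    and gen: "\<And>e. e \<in> carrier R \<Longrightarrow> (algebraic over (generate_field R (k \<union> Y))) e"
  shows "trdeg k = enat (card Y)"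
proof -
  obtain B where B: "transcendence_basis k B" "trdeg k = (if finite B then enat (card B) else \<infinity>)"
    using trdeg_basis[OF k] .
  have "Y \<subseteq> carrier R" using Y(1) unfolding algebraically_independent_def by auto
  then have "finite B \<and> card B \<le> card Y"
    using algebraically_independent_finite[OF k _ Y(2) gen] B(1) unfolding transcendence_basis_def by blast
  then have "trdeg k \<le> enat (card Y)" using B(2) by simp
  then show ?thesis using trdeg_ge[OF k Y] by (rule order.antisym)
qed

lemma (in field) not_algebraic_extension:
  assumes k: "subfield k R" and Y: "algebraically_independent k Y" "Y \<noteq> {}"
  shows "\<not> algebraic_extension k"
proof
  assume alg: "algebraic_extension k"
  obtain y where y: "y \<in> Y" using Y(2) by auto
  have Yc: "Y \<subseteq> carrier R" using Y(1) unfolding algebraically_independent_def by auto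
  have "\<not> (algebraic over (generate_field R (k \<union> (Y - {y})))) y"
    using algebraically_independent_insert_field[OF k, of "Y - {y}" y] Y(1) y Yc
    by (auto simp: insert_absorb)
  moreover have "(algebraic over k) y" using alg y Yc unfolding algebraic_extension_def by auto
  moreover have "k \<subseteq> generate_field R (k \<union> (Y - {y}))" by (auto intro: generate_field.incl)
  ultimately show False using algebraic_mono by blast
qed

section \<open>Bases of finitely generated torsion-free subgroups\<close>

text \<open>The groups here are subgroups of the additive group of a ring, given as the sets of
  integer combinations of a finite family.\<close>

definition (in ring) int_combination :: "('i \<Rightarrow> 'a) \<Rightarrow> ('i \<Rightarrow> int) \<Rightarrow> 'i set \<Rightarrow> 'a"
  where "int_combination b c I = (\<Oplus>i\<in>I. add_pow R (c i) (b i))"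

context ring
begin

lemma int_multiple_zero [simp]: "add_pow R (0::int) x = \<zero>"
  by (simp add: add_pow_def int_pow_def)

lemma int_multiple_one [simp]: "x \<in> carrier R \<Longrightarrow> add_pow R (1::int) x = x"
  using group.int_pow_1[OF a_group, of x] by (simp add: add_pow_def)

lemma int_multiple_closed [simp]: "x \<in> carrier R \<Longrightarrow> add_pow R (i::int) x \<in> carrier R"
  using group.int_pow_closed[OF a_group, of x i] by (simp add: add_pow_def)

lemma int_multiple_of_zero [simp]: "add_pow R (i::int) \<zero> = \<zero>"
  using group.int_pow_one[OF a_group, of i] by (simp add: add_pow_def)

lemma int_multiple_add_left:
  "x \<in> carrier R \<Longrightarrow> add_pow R (i + j :: int) x = add_pow R i x \<oplus> add_pow R j x"
  using group.int_pow_mult[OF a_group, of x i j] by (simp add: add_pow_def)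

lemma int_multiple_add_right:
  assumes "x \<in> carrier R" "y \<in> carrier R"
  shows "add_pow R (i::int) (x \<oplus> y) = add_pow R i x \<oplus> add_pow R i y"
  using comm_group.int_pow_distrib[OF a_comm_group, of x y i] assms by (simp add: add_pow_def)

lemma int_multiple_mult:
  "x \<in> carrier R \<Longrightarrow> add_pow R (j::int) (add_pow R i x) = add_pow R (i * j) x"
  using group.int_pow_pow[OF a_group, of x i j] by (simp add: add_pow_def)

lemma int_combination_empty [simp]: "int_combination b c {} = \<zero>"
  unfolding int_combination_def by simp

lemma int_combination_insert:
  assumes "finite I" "i \<notin> I" "b \<in> insert i I \<rightarrow> carrier R"
  shows "int_combination b c (insert i I) = add_pow R (c i) (b i) \<oplus> int_combination b c I"
  unfolding int_combination_def by (rule finsum_insert) (use assms in auto)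

lemma int_combination_closed [simp]:
  assumes "b \<in> I \<rightarrow> carrier R" shows "int_combination b c I \<in> carrier R"
  unfolding int_combination_def by (rule finsum_closed) (use assms in auto)

lemma int_combination_cong:
  assumes "b \<in> I \<rightarrow> carrier R" "\<And>i. i \<in> I \<Longrightarrow> b i = b' i" "\<And>i. i \<in> I \<Longrightarrow> c i = c' i"
  shows "int_combination b c I = int_combination b' c' I"
proof -
  have "b' i \<in> carrier R" if "i \<in> I" for i
    using assms(1) assms(2)[OF that, symmetric] that by auto
  then show ?thesis
    unfolding int_combination_def by (intro add.finprod_cong') (use assms in auto)
qed

lemma int_combination_add:
  assumes "b \<in> I \<rightarrow> carrier R"
  shows "int_combination b (\<lambda>i. c i + d i) I = int_combination b c I \<oplus> int_combination b d I"
proof -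
  have "int_combination b (\<lambda>i. c i + d i) I = (\<Oplus>i\<in>I. add_pow R (c i) (b i) \<oplus> add_pow R (d i) (b i))"
    unfolding int_combination_def
    by (rule add.finprod_cong') (use assms in \<open>auto simp: int_multiple_add_left Pi_iff\<close>)
  also have "\<dots> = int_combination b c I \<oplus> int_combination b d I"
    unfolding int_combination_def by (rule add.finprod_multf) (use assms in auto)
  finally show ?thesis .
qed

lemma int_combination_zero [simp]: "b \<in> I \<rightarrow> carrier R \<Longrightarrow> int_combination b (\<lambda>_. 0) I = \<zero>"
  unfolding int_combination_def by (rule add.finprod_one_eqI) auto

lemma int_combination_diff:
  assumes "b \<in> I \<rightarrow> carrier R"
  shows "int_combination b (\<lambda>i. c i - d i) I = int_combination b c I \<ominus> int_combination b d I"
proof -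
  have "int_combination b (\<lambda>i. c i - d i) I \<oplus> int_combination b d I = int_combination b c I"
    using int_combination_add[OF assms, of "\<lambda>i. c i - d i" d] by simp
  then show ?thesis
    using assms by (metis add.inv_solve_right' int_combination_closed minus_eq)
qed

lemma int_combination_single:
  assumes "finite I" "i \<in> I" "b \<in> I \<rightarrow> carrier R" "\<And>j. j \<in> I \<Longrightarrow> j \<noteq> i \<Longrightarrow> c j = 0"
  shows "int_combination b c I = add_pow R (c i) (b i)"
proof -
  have I: "I = insert i (I - {i})" using assms(2) by auto
  have bI: "b \<in> I - {i} \<rightarrow> carrier R" using assms(3) by auto
  have "int_combination b c (I - {i}) = int_combination b (\<lambda>_. 0) (I - {i})"
    by (rule int_combination_cong) (use assms bI in auto)
  then have "int_combination b c (I - {i}) = \<zero>" using bI by simp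
  moreover have "int_combination b c I = add_pow R (c i) (b i) \<oplus> int_combination b c (I - {i})"
    by (subst I, rule int_combination_insert) (use assms in auto)
  moreover have "b i \<in> carrier R" using assms by auto
  ultimately show ?thesis by simp
qed

text \<open>The change \<open>b\<^sub>j := b\<^sub>j + s b\<^sub>i\<close> of generators amounts to the transposed, invertible
  change of coefficients; so it preserves the span, and it can be used to shorten
  relations.\<close>

lemma int_combination_shear:
  assumes I: "finite I" "i \<in> I" "j \<in> I" "i \<noteq> j" and b: "b \<in> I \<rightarrow> carrier R"
  shows "int_combination (b(j := b j \<oplus> add_pow R (s) (b i))) d I = int_combination b (d(i := d i + s * d j)) I"
proof -
  let ?J = "I - {i, j}"
  let ?b' = "b(j := b j \<oplus> add_pow R (s) (b i))" and ?d' = "d(i := d i + s * d j)"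
  have I': "I = insert i (insert j ?J)" using I by auto
  have bc: "b i \<in> carrier R" "b j \<in> carrier R" and bJ: "b \<in> ?J \<rightarrow> carrier R" using b I by auto
  have b': "?b' \<in> I \<rightarrow> carrier R" using b bc by auto
  have split: "int_combination f e I = add_pow R (e i) (f i) \<oplus> (add_pow R (e j) (f j) \<oplus> int_combination f e ?J)"
    if "f \<in> I \<rightarrow> carrier R" for f e
    apply (subst I', subst int_combination_insert)
    subgoal using I by auto
    subgoal using I by auto
    subgoal using that I by auto
    apply (subst int_combination_insert)
    using that I by auto
  have J: "int_combination ?b' d ?J = int_combination b ?d' ?J"
    using bJ by (intro int_combination_cong[symmetric]) auto
  define r where "r = int_combination b ?d' ?J"
  have r: "r \<in> carrier R" using bJ unfolding r_def by simp
  have "int_combination ?b' d I = add_pow R (d i) (b i) \<oplus> (add_pow R (d j) (b j \<oplus> add_pow R s (b i)) \<oplus> r)"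
    using split[OF b', of d] J I(4) unfolding r_def by simp
  also have "add_pow R (d j) (b j \<oplus> add_pow R s (b i)) = add_pow R (d j) (b j) \<oplus> add_pow R (s * d j) (b i)"
    using bc by (simp add: int_multiple_add_right int_multiple_mult)
  also have "add_pow R (d i) (b i) \<oplus> ((add_pow R (d j) (b j) \<oplus> add_pow R (s * d j) (b i)) \<oplus> r)
      = (add_pow R (d i) (b i) \<oplus> add_pow R (s * d j) (b i)) \<oplus> (add_pow R (d j) (b j) \<oplus> r)"
    using bc r by (simp add: a_ac)
  also have "add_pow R (d i) (b i) \<oplus> add_pow R (s * d j) (b i) = add_pow R (d i + s * d j) (b i)"
    using bc by (simp add: int_multiple_add_left)
  also have "\<dots> \<oplus> (add_pow R (d j) (b j) \<oplus> r) = int_combination b ?d' I"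
    using split[OF b, of ?d'] I(4) unfolding r_def by simp
  finally show ?thesis .
qed

text \<open>Euclidean algorithm on the coefficients of a nontrivial relation. While two
  coefficients are nonzero, a shear of the generators subtracts the smaller one from the
  larger one up to sign, and the sum of the absolute values drops. When a single coefficient
  is left, torsion-freeness makes its generator zero, so that it can be omitted.\<close>

lemma int_combination_drop_generator:
  assumes tf: "\<forall>x\<in>carrier R. \<forall>n::int. n \<noteq> 0 \<longrightarrow> add_pow R n x = \<zero> \<longrightarrow> x = \<zero>"
    and I: "finite I" and b: "b \<in> I \<rightarrow> carrier R"
    and c: "int_combination b c I = \<zero>" "\<exists>i\<in>I. c i \<noteq> 0"
  shows "\<exists>i\<in>I. \<exists>b'. b' \<in> I - {i} \<rightarrow> carrier R \<and>
    range (\<lambda>d. int_combination b' d (I - {i})) = range (\<lambda>d. int_combination b d I)"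
  using b c
proof (induction "nat (\<Sum>i\<in>I. \<bar>c i\<bar>)" arbitrary: b c rule: less_induct)
  case less
  note b = less.prems(1)
  show ?case
  proof (cases "\<exists>i\<in>I. \<exists>j\<in>I. i \<noteq> j \<and> c i \<noteq> 0 \<and> c j \<noteq> 0")
    case True
    then obtain i j where ij: "i \<in> I" "j \<in> I" "i \<noteq> j" "c i \<noteq> 0" "c j \<noteq> 0" "\<bar>c j\<bar> \<le> \<bar>c i\<bar>"
      by (metis linear)
    \<comment> \<open>The sign is chosen such that the absolute value of the larger coefficient decreases.\<close>
    define s where "s = sgn (c i) * sgn (c j)"
    let ?b = "b(j := b j \<oplus> add_pow R (s) (b i))" and ?c = "c(i := c i - s * c j)"
    have b': "?b \<in> I \<rightarrow> carrier R" using b ij by (auto simp: Pi_iff)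
    have shear: "int_combination ?b d I = int_combination b (d(i := d i + s * d j)) I" for d
      by (rule int_combination_shear[OF I ij(1-3) b])
    have "?c(i := ?c i + s * ?c j) = c" using ij by auto
    then have z: "int_combination ?b ?c I = \<zero>" using shear[of ?c] less.prems(2) by simp
    have "\<exists>i\<in>I. ?c i \<noteq> 0" using ij by (intro bexI[of _ j]) auto
    have "\<bar>?c i\<bar> < \<bar>c i\<bar>"
      using ij unfolding s_def by (auto simp: sgn_if abs_if split: if_splits)
    then have "(\<Sum>l\<in>I. \<bar>?c l\<bar>) < (\<Sum>l\<in>I. \<bar>c l\<bar>)"
      using ij I by (intro sum_strict_mono_ex1) auto
    moreover have "0 \<le> (\<Sum>l\<in>I. \<bar>?c l\<bar>)" by (rule sum_nonneg) simp
    ultimately have "nat (\<Sum>l\<in>I. \<bar>?c l\<bar>) < nat (\<Sum>l\<in>I. \<bar>c l\<bar>)" by linarith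
    from less.hyps[OF this b' z \<open>\<exists>i\<in>I. ?c i \<noteq> 0\<close>] obtain l b'' where
      l: "l \<in> I" "b'' \<in> I - {l} \<rightarrow> carrier R"
      "range (\<lambda>d. int_combination b'' d (I - {l})) = range (\<lambda>d. int_combination ?b d I)" by blast
    have "range (\<lambda>d. int_combination ?b d I) = range (\<lambda>d. int_combination b d I)"
    proof (intro equalityI subsetI)
      fix x assume "x \<in> range (\<lambda>d. int_combination b d I)"
      then obtain d where d: "x = int_combination b d I" by auto
      let ?d = "d(i := d i - s * d j)"
      have "?d(i := ?d i + s * ?d j) = d" using ij by auto
      then have "x = int_combination ?b ?d I" using shear[of ?d] d by simp
      then show "x \<in> range (\<lambda>d. int_combination ?b d I)" by blast
    qed (use shear in auto)
    then show ?thesis using l by auto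
  next
    case False
    obtain i where i: "i \<in> I" "c i \<noteq> 0" using less.prems by auto
    then have "add_pow R (c i) (b i) = \<zero>"
      using int_combination_single[OF I i(1) b, of c] False less.prems(2) by force
    then have bi: "b i = \<zero>" using tf funcset_mem[OF b i(1)] i(2) by blast
    have "int_combination b d I = int_combination b d (I - {i})" for d
    proof -
      have "int_combination b d (insert i (I - {i})) = add_pow R (d i) (b i) \<oplus> int_combination b d (I - {i})"
        by (rule int_combination_insert) (use I b i in auto)
      moreover have "insert i (I - {i}) = I" using i by auto
      moreover have "int_combination b d (I - {i}) \<in> carrier R" using b by (intro int_combination_closed) auto
      ultimately show ?thesis using bi by simp
    qed
    then show ?thesis using i b by (intro bexI[of _ i] exI[of _ b]) auto
  qed
qed

text \<open>A generating family of least size admits no nontrivial relation.\<close>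

lemma int_combination_basis_exists:
  fixes I :: "'i set"
  assumes tf: "\<forall>x\<in>carrier R. \<forall>n::int. n \<noteq> 0 \<longrightarrow> add_pow R n x = \<zero> \<longrightarrow> x = \<zero>"
    and I: "finite I" and b: "b \<in> I \<rightarrow> carrier R"
  shows "\<exists>(J :: 'i set) b'. finite J \<and> b' \<in> J \<rightarrow> carrier R \<and>
    range (\<lambda>d. int_combination b' d J) = range (\<lambda>d. int_combination b d I) \<and>
    (\<forall>c. int_combination b' c J = \<zero> \<longrightarrow> (\<forall>j\<in>J. c j = 0))"
  using I b
proof (induction "card I" arbitrary: I b rule: less_induct)
  case less
  show ?case
  proof (cases "\<exists>c. int_combination b c I = \<zero> \<and> (\<exists>i\<in>I. c i \<noteq> 0)")
    case True
    then obtain c where c: "int_combination b c I = \<zero>" "\<exists>i\<in>I. c i \<noteq> 0" by auto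
    from int_combination_drop_generator[OF tf less.prems c] obtain i b' where
      i: "i \<in> I" "b' \<in> I - {i} \<rightarrow> carrier R"
      "range (\<lambda>d. int_combination b' d (I - {i})) = range (\<lambda>d. int_combination b d I)" by blast
    have "card (I - {i}) < card I" using i less.prems by (intro psubset_card_mono) auto
    from less.hyps[OF this _ i(2)] less.prems(1) i(3) show ?thesis by auto
  next
    case False
    then show ?thesis using less.prems by (intro exI[of _ I] exI[of _ b]) auto
  qed
qed

text \<open>An independent family identifies its span with the free abelian group on its
  indices; the rank is well defined because free abelian groups on sets of different sizes
  are not isomorphic.\<close>

lemma additive_rank_eq:
  assumes J: "finite J" and b: "b \<in> J \<rightarrow> carrier R"
    and H: "H = range (\<lambda>d. int_combination b d J)"
    and ind: "\<And>c. int_combination b c J = \<zero> \<Longrightarrow> (\<forall>j\<in>J. c j = 0)"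
  shows "additive_rank R H = card J"
proof -
  let ?G = "(add_monoid R)\<lparr>carrier := H\<rparr>"
  let ?h = "\<lambda>f. int_combination b (Poly_Mapping.lookup f) J"
  have "?h \<in> iso (free_Abelian_group J) ?G"
  proof (rule isoI)
    show "?h \<in> hom (free_Abelian_group J) ?G"
    proof (rule homI)
      fix f g assume "f \<in> carrier (free_Abelian_group J)" "g \<in> carrier (free_Abelian_group J)"
      have "Poly_Mapping.lookup (f + g) = (\<lambda>j. Poly_Mapping.lookup f j + Poly_Mapping.lookup g j)"
        by (simp add: fun_eq_iff lookup_add)
      then show "?h (f \<otimes>\<^bsub>free_Abelian_group J\<^esub> g) = ?h f \<otimes>\<^bsub>?G\<^esub> ?h g"
        using int_combination_add[OF b] by simp
    qed (use H in auto)
    show "bij_betw ?h (carrier (free_Abelian_group J)) (carrier ?G)"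
      unfolding bij_betw_def
    proof
      show "inj_on ?h (carrier (free_Abelian_group J))"
      proof (rule inj_onI)
        fix f g assume f: "f \<in> carrier (free_Abelian_group J)" and g: "g \<in> carrier (free_Abelian_group J)"
          and eq: "?h f = ?h g"
        have "int_combination b (\<lambda>j. Poly_Mapping.lookup f j - Poly_Mapping.lookup g j) J = \<zero>"
          using int_combination_diff[OF b] eq b by (simp add: r_neg minus_eq)
        from ind[OF this] have "Poly_Mapping.lookup f j = Poly_Mapping.lookup g j" if "j \<in> J" for j
          using that by auto
        moreover have "Poly_Mapping.lookup f j = 0" "Poly_Mapping.lookup g j = 0" if "j \<notin> J" for j
          using that f g by (auto simp: in_keys_iff subset_iff)
        ultimately show "f = g" by (intro poly_mapping_eqI) metis
      qed
      show "?h ` carrier (free_Abelian_group J) = carrier ?G"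
      proof (intro equalityI subsetI)
        fix x assume "x \<in> carrier ?G"
        then obtain d where d: "x = int_combination b d J" using H by auto
        define e where "e j = (if j \<in> J then d j else 0)" for j
        let ?f = "Poly_Mapping.Abs_poly_mapping e"
        have e0: "e j = 0" if "j \<notin> J" for j using that unfolding e_def by simp
        then have "{j. e j \<noteq> 0} \<subseteq> J" by blast
        from finite_subset[OF this J] have l: "Poly_Mapping.lookup ?f = e"
          by (intro Abs_poly_mapping_inverse) simp
        have "?h ?f = x" unfolding d l using b
          by (intro int_combination_cong) (auto simp: e_def)
        moreover have "?f \<in> carrier (free_Abelian_group J)"
          unfolding carrier_free_Abelian_group_iff using e0 by (metis in_keys_iff l subsetI)
        ultimately show "x \<in> ?h ` carrier (free_Abelian_group J)" by blast
      qed (use H in auto)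
    qed
  qed
  then have iso: "free_Abelian_group J \<cong> ?G" unfolding is_iso_def by auto
  have "J \<approx> {..<card J}" using J by (simp add: eqpoll_iff_finite_card)
  then have fJ: "free_Abelian_group J \<cong> free_Abelian_group {..<card J}"
    by (simp add: isomorphic_free_Abelian_groups)
  have gJ: "?G \<cong> free_Abelian_group J"
    by (rule group.iso_sym[OF group_free_Abelian_group iso])
  show ?thesis unfolding additive_rank_def free_rank_def
  proof (rule the_equality)
    show "?G \<cong> free_Abelian_group {..<card J}" by (rule iso_trans[OF gJ fJ])
    fix n :: nat assume "?G \<cong> free_Abelian_group {..<n}"
    from iso_trans[OF iso this] have "J \<approx> {..<n}" by (simp add: isomorphic_free_Abelian_groups)
    then show "n = card J" using J by (simp add: eqpoll_iff_finite_card)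
  qed
qed

end

section \<open>Derivations and exponential solutions\<close>

text \<open>Polynomial rings and their quotients carry derivations before they are known to be
  fields, hence a locale for derivations of commutative rings.\<close>

locale differential_ring = cring R for R (structure) +
  fixes d :: "'a \<Rightarrow> 'a"
  assumes d_closed: "x \<in> carrier R \<Longrightarrow> d x \<in> carrier R"
    and d_add: "\<lbrakk>x \<in> carrier R; y \<in> carrier R\<rbrakk> \<Longrightarrow> d (x \<oplus> y) = d x \<oplus> d y"
    and d_mult: "\<lbrakk>x \<in> carrier R; y \<in> carrier R\<rbrakk> \<Longrightarrow> d (x \<otimes> y) = d x \<otimes> y \<oplus> x \<otimes> d y"
begin

lemma d_zero [simp]: "d \<zero> = \<zero>"
proof -
  have "d \<zero> \<oplus> d \<zero> = d \<zero> \<oplus> \<zero>" using d_add[of \<zero> \<zero>] d_closed by simp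
  then show ?thesis using d_closed by (metis add.l_cancel zero_closed)
qed

lemma d_one [simp]: "d \<one> = \<zero>"
proof -
  have "d \<one> \<oplus> d \<one> = d \<one> \<oplus> \<zero>" using d_mult[of \<one> \<one>] d_closed by simp
  then show ?thesis using d_closed by (metis add.l_cancel one_closed zero_closed)
qed

lemma d_minus:
  assumes "x \<in> carrier R" shows "d (\<ominus> x) = \<ominus> d x"
proof -
  have "d (\<ominus> x) \<oplus> d x = \<zero>" using d_add[of "\<ominus> x" x] assms by (simp add: l_neg)
  then show ?thesis using assms d_closed by (intro minus_equality[symmetric]) auto
qed

lemma d_diff:
  assumes "x \<in> carrier R" "y \<in> carrier R" shows "d (x \<ominus> y) = d x \<ominus> d y"
  using assms by (simp add: minus_eq d_add d_minus)

lemma d_finsum: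
  assumes "f \<in> A \<rightarrow> carrier R"
  shows "d (\<Oplus>a\<in>A. f a) = (\<Oplus>a\<in>A. d (f a))"
  using assms
proof (induction A rule: infinite_finite_induct)
  case (insert a A)
  then have "(\<Oplus>a\<in>insert a A. f a) = f a \<oplus> (\<Oplus>a\<in>A. f a)"
    "(\<Oplus>a\<in>insert a A. d (f a)) = d (f a) \<oplus> (\<Oplus>a\<in>A. d (f a))"
    using d_closed by (simp_all add: Pi_iff)
  then show ?case using insert by (simp add: d_add Pi_iff)
qed auto

lemma d_pow_eigenvector:
  assumes "a \<in> carrier R" "x \<in> carrier R" "d x = a \<otimes> x"
  shows "d (x [^] (n::nat)) = add_pow R n a \<otimes> x [^] n"
proof (induction n)
  case (Suc n)
  have "d (x [^] Suc n) = d (x [^] n) \<otimes> x \<oplus> x [^] n \<otimes> d x"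
    using assms by (simp add: d_mult)
  also have "\<dots> = add_pow R n a \<otimes> x [^] n \<otimes> x \<oplus> x [^] n \<otimes> (a \<otimes> x)" using Suc assms by simp
  also have "\<dots> = (add_pow R n a \<oplus> a) \<otimes> (x [^] n \<otimes> x)"
    using assms(1,2) nat_pow_closed[OF assms(2), of n] add.nat_pow_closed[OF assms(1), of n]
    by algebra
  finally show ?case by simp
qed (use assms in simp)

end

sublocale differential_field \<subseteq> differential_ring K \<delta>
  by unfold_locales (use der_closed der_add der_mult in auto)

context differential_field
begin

text \<open>A solution for \<open>a\<close> is an element with logarithmic derivative \<open>a\<close>.\<close>

definition solves :: "'a \<Rightarrow> 'a \<Rightarrow> bool"
  where "solves a y \<longleftrightarrow> a \<in> carrier K \<and> y \<in> carrier K \<and> y \<noteq> \<zero> \<and> \<delta> y = a \<otimes> y"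

lemma solves_one: "solves \<zero> \<one>"
  unfolding solves_def by simp

lemma solves_mult:
  assumes "solves a x" "solves b y"
  shows "solves (a \<oplus> b) (x \<otimes> y)"
proof -
  have c: "a \<in> carrier K" "b \<in> carrier K" "x \<in> carrier K" "y \<in> carrier K"
    and nz: "x \<noteq> \<zero>" "y \<noteq> \<zero>" and d: "\<delta> x = a \<otimes> x" "\<delta> y = b \<otimes> y"
    using assms unfolding solves_def by auto
  have "(a \<otimes> x) \<otimes> y \<oplus> x \<otimes> (b \<otimes> y) = (a \<oplus> b) \<otimes> (x \<otimes> y)" using c by algebra
  then show ?thesis unfolding solves_def using c nz d integral[of x y] by (auto simp: der_mult)
qed

lemma solves_inv:
  assumes "solves a x"
  shows "solves (\<ominus> a) (inv x)"
proof -
  have c: "a \<in> carrier K" "x \<in> carrier K" and nz: "x \<noteq> \<zero>" and d: "\<delta> x = a \<otimes> x"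
    using assms unfolding solves_def by auto
  have U: "x \<in> Units K" using c nz field_Units by auto
  have i: "inv x \<in> carrier K" "x \<otimes> inv x = \<one>" using U by auto
  have "inv x \<noteq> \<zero>" using i(2) c by auto
  have "(a \<otimes> x) \<otimes> inv x \<oplus> x \<otimes> \<delta> (inv x) = \<zero>"
    using der_mult[of x "inv x"] i c d by simp
  then have "inv x \<otimes> ((a \<otimes> x) \<otimes> inv x \<oplus> x \<otimes> \<delta> (inv x)) = \<zero>" using i by simp
  moreover have "inv x \<otimes> ((a \<otimes> x) \<otimes> inv x \<oplus> x \<otimes> \<delta> (inv x))
      = (x \<otimes> inv x) \<otimes> (a \<otimes> inv x) \<oplus> (x \<otimes> inv x) \<otimes> \<delta> (inv x)"
    using i(1) c der_closed[OF i(1)] by algebra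
  ultimately have "a \<otimes> inv x \<oplus> \<delta> (inv x) = \<zero>" using i c der_closed[OF i(1)] by simp
  then have "\<delta> (inv x) = \<ominus> (a \<otimes> inv x)"
    using i c der_closed[OF i(1)] by (metis a_comm m_closed minus_equality)
  then show ?thesis unfolding solves_def using i c \<open>inv x \<noteq> \<zero>\<close> by (simp add: l_minus)
qed

lemma solves_subgroup: "subgroup {a. \<exists>y. solves a y} (add_monoid K)"
proof (rule group.subgroupI[OF a_group])
  show "{a. \<exists>y. solves a y} \<noteq> {}" using solves_one by blast
  show "{a. \<exists>y. solves a y} \<subseteq> carrier (add_monoid K)" unfolding solves_def by auto
  show "inv\<^bsub>add_monoid K\<^esub> a \<in> {a. \<exists>y. solves a y}" if "a \<in> {a. \<exists>y. solves a y}" for a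
    using that solves_inv by (fold a_inv_def) blast
  show "a \<otimes>\<^bsub>add_monoid K\<^esub> b \<in> {a. \<exists>y. solves a y}"
    if "a \<in> {a. \<exists>y. solves a y}" "b \<in> {a. \<exists>y. solves a y}" for a b
  proof -
    from that obtain x y where "solves a x" "solves b y" by auto
    from solves_mult[OF this] show ?thesis by auto
  qed
qed

lemma solves_nat_multiple:
  assumes "solves a x" shows "solves (add_pow K (n::nat) a) (x [^] n)"
proof (induction n)
  case 0
  then show ?case using solves_one by simp
next
  case (Suc n)
  have "a \<in> carrier K" using assms unfolding solves_def by simp
  then show ?case using solves_mult[OF Suc assms] by simp
qed

lemma log_der_set_iff:
  "a \<in> log_der_set K \<delta> \<longleftrightarrow> a \<in> carrier K \<and> (\<exists>n::nat. 0 < n \<and> (\<exists>y. solves (add_pow K n a) y))"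
  unfolding log_der_set_def solves_def by auto

lemma solves_log_der: "solves a y \<Longrightarrow> a \<in> log_der_set K \<delta>"
  unfolding log_der_set_iff by (intro conjI exI[of _ "1::nat"]) (auto simp: solves_def)

text \<open>For the sum of \<open>a\<close> and \<open>b\<close> with solvable multiples \<open>n a\<close> and \<open>m b\<close>, the multiple by
  \<open>n m\<close> is solvable.\<close>

lemma log_der_set_subgroup: "subgroup (log_der_set K \<delta>) (add_monoid K)"
proof (rule group.subgroupI[OF a_group])
  show "log_der_set K \<delta> \<noteq> {}" using solves_log_der[OF solves_one] by blast
  show "log_der_set K \<delta> \<subseteq> carrier (add_monoid K)" unfolding log_der_set_def by auto
  fix a assume a: "a \<in> log_der_set K \<delta>"
  then obtain n :: nat and y where n: "a \<in> carrier K" "0 < n" "solves (add_pow K n a) y"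
    unfolding log_der_set_iff by auto
  have "add_pow K n (\<ominus> a) = \<ominus> (add_pow K n a)" using n(1) add.nat_pow_inv by simp
  then show "inv\<^bsub>add_monoid K\<^esub> a \<in> log_der_set K \<delta>"
    using n solves_inv[OF n(3)] unfolding log_der_set_iff by (fold a_inv_def) (metis a_inv_closed)
  fix b assume b: "b \<in> log_der_set K \<delta>"
  then obtain m :: nat and z where m: "b \<in> carrier K" "0 < m" "solves (add_pow K m b) z"
    unfolding log_der_set_iff by auto
  have "add_pow K (n * m) (a \<oplus> b) = add_pow K m (add_pow K n a) \<oplus> add_pow K n (add_pow K m b)"
    using n m by (simp add: add.nat_pow_distrib add.nat_pow_pow mult.commute)
  then have "solves (add_pow K (n * m) (a \<oplus> b)) (y [^] m \<otimes> z [^] n)"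
    using solves_mult[OF solves_nat_multiple[OF n(3)] solves_nat_multiple[OF m(3)]] by simp
  then show "a \<otimes>\<^bsub>add_monoid K\<^esub> b \<in> log_der_set K \<delta>"
    using n m unfolding log_der_set_iff by (auto intro!: exI[of _ "n * m"])
qed

lemma solves_monomial:
  assumes "finite J" "\<And>j. j \<in> J \<Longrightarrow> solves (b j) (y j)"
  shows "solves (int_combination b (\<lambda>j. int (c j)) J) (\<Otimes>j\<in>J. y j [^] (c j :: nat))"
  using assms
proof (induction J rule: finite_induct)
  case empty
  then show ?case using solves_one by simp
next
  case (insert i J)
  have "b \<in> insert i J \<rightarrow> carrier K" "y \<in> insert i J \<rightarrow> carrier K"
    using insert.prems unfolding solves_def by auto
  moreover have "add_pow K (int (c i)) (b i) = add_pow K (c i) (b i)"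
    by (simp add: add_pow_int_ge)
  ultimately show ?case
    using solves_mult[OF solves_nat_multiple[of "b i" "y i" "c i"] insert.IH] insert
    by (simp add: int_combination_insert Pi_iff)
qed

end

context differential_extension
begin

lemma embedding_ring_hom: "ring_hom_cring K E \<iota>"
  by unfold_locales (rule embedding)

lemma embedding_inj: "inj_on \<iota> (carrier K)"
  using non_trivial_field_hom_is_inj[OF embedding K.field_axioms E.field_axioms] .

lemma embedding_subfield: "subfield (\<iota> ` carrier K) E"
proof -
  have "ring_hom_ring K E \<iota>"
    by (rule ring_hom_ringI2[OF K.ring_axioms E.ring_axioms embedding])
  from ring_hom_ring.img_is_subfield(2)[OF this K.carrier_is_subfield] show ?thesis by simp
qed

lemma solves_embedding:
  assumes "K.solves a y" shows "E.solves (\<iota> a) (\<iota> y)"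
proof -
  interpret h: ring_hom_cring K E \<iota> by (rule embedding_ring_hom)
  have c: "a \<in> carrier K" "y \<in> carrier K" "y \<noteq> \<zero>\<^bsub>K\<^esub>" "\<delta> y = a \<otimes>\<^bsub>K\<^esub> y"
    using assms unfolding K.solves_def by auto
  have "\<iota> y \<noteq> \<zero>\<^bsub>E\<^esub>" using c embedding_inj h.hom_zero by (metis K.zero_closed inj_onD)
  then show ?thesis unfolding E.solves_def using c der_extends[of y] by simp
qed

text \<open>This is the argument that makes exponentials independent. In a relation with
  coefficient 1 at \<open>m0\<close>, differentiate and subtract \<open>e m0\<close> times the relation. The term at
  \<open>m0\<close> disappears, so by induction on the number of terms all coefficients of the new
  relation vanish. For \<open>m \<noteq> m0\<close> this says that the old coefficient, if nonzero, is a
  solution in \<open>K\<close> for \<open>e m0 - e m\<close>, which is excluded. Hence only the term at \<open>m0\<close> is left,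
  and \<open>z m0\<close> is not zero.\<close>

lemma eigenvectors_independent:
  assumes "finite M"
    and "\<And>m. m \<in> M \<Longrightarrow> e m \<in> carrier K"
    and "\<And>m. m \<in> M \<Longrightarrow> E.solves (\<iota> (e m)) (z m)"
    and "\<And>m m'. m \<in> M \<Longrightarrow> m' \<in> M \<Longrightarrow> m \<noteq> m' \<Longrightarrow> e m \<ominus>\<^bsub>K\<^esub> e m' \<notin> log_der_set K \<delta>"
    and "\<And>m. m \<in> M \<Longrightarrow> c m \<in> carrier K"
    and "(\<Oplus>\<^bsub>E\<^esub>m\<in>M. \<iota> (c m) \<otimes>\<^bsub>E\<^esub> z m) = \<zero>\<^bsub>E\<^esub>"
  shows "\<forall>m\<in>M. c m = \<zero>\<^bsub>K\<^esub>"
  using assms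
proof (induction "card M" arbitrary: M c rule: less_induct)
  case less
  note fin = less.prems(1) and e = less.prems(2) and sol = less.prems(3) and nld = less.prems(4)
    and c = less.prems(5) and rel = less.prems(6)
  interpret h: ring_hom_cring K E \<iota> by (rule embedding_ring_hom)
  have z: "z m \<in> carrier E" "z m \<noteq> \<zero>\<^bsub>E\<^esub>" "\<delta>\<^sub>E (z m) = \<iota> (e m) \<otimes>\<^bsub>E\<^esub> z m" if "m \<in> M" for m
    using sol[OF that] unfolding E.solves_def by auto
  show ?case
  proof (rule ccontr)
    assume "\<not> (\<forall>m\<in>M. c m = \<zero>\<^bsub>K\<^esub>)"
    then obtain m0 where m0: "m0 \<in> M" "c m0 \<noteq> \<zero>\<^bsub>K\<^esub>" by auto
    let ?i = "inv\<^bsub>K\<^esub> (c m0)"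
    have U: "c m0 \<in> Units K" using m0 c K.field_Units by auto
    have i: "?i \<in> carrier K" "?i \<otimes>\<^bsub>K\<^esub> c m0 = \<one>\<^bsub>K\<^esub>" using U by auto
    define d where "d m = ?i \<otimes>\<^bsub>K\<^esub> c m" for m
    have d: "d m \<in> carrier K" if "m \<in> M" for m using i c[OF that] unfolding d_def by simp
    have d0: "d m0 = \<one>\<^bsub>K\<^esub>" using i(2) unfolding d_def .
    have "(\<Oplus>\<^bsub>E\<^esub>m\<in>M. \<iota> (d m) \<otimes>\<^bsub>E\<^esub> z m) = (\<Oplus>\<^bsub>E\<^esub>m\<in>M. \<iota> ?i \<otimes>\<^bsub>E\<^esub> (\<iota> (c m) \<otimes>\<^bsub>E\<^esub> z m))"
      by (rule E.add.finprod_cong') (use i c z in \<open>auto simp: d_def E.m_assoc\<close>)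
    also have "\<dots> = \<iota> ?i \<otimes>\<^bsub>E\<^esub> (\<Oplus>\<^bsub>E\<^esub>m\<in>M. \<iota> (c m) \<otimes>\<^bsub>E\<^esub> z m)"
      by (rule E.finsum_rdistr[symmetric]) (use fin i c z in auto)
    also have "\<dots> = \<zero>\<^bsub>E\<^esub>" using rel i by simp
    finally have reld: "(\<Oplus>\<^bsub>E\<^esub>m\<in>M. \<iota> (d m) \<otimes>\<^bsub>E\<^esub> z m) = \<zero>\<^bsub>E\<^esub>" .
    \<comment> \<open>The coefficients of the derivative of the relation minus \<open>e m0\<close> times the relation.\<close>
    define f where "f m = \<delta> (d m) \<oplus>\<^bsub>K\<^esub> d m \<otimes>\<^bsub>K\<^esub> (e m \<ominus>\<^bsub>K\<^esub> e m0)" for m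
    have f: "f m \<in> carrier K" if "m \<in> M" for m
      using d[OF that] e[OF that] e[OF m0(1)] K.der_closed unfolding f_def by simp
    have f0: "f m0 = \<zero>\<^bsub>K\<^esub>"
      unfolding f_def d0 using e[OF m0(1)] by (simp add: K.minus_eq K.r_neg)
    have eigen: "\<iota> (f m) \<otimes>\<^bsub>E\<^esub> z m = \<delta>\<^sub>E (\<iota> (d m) \<otimes>\<^bsub>E\<^esub> z m)
        \<oplus>\<^bsub>E\<^esub> (\<ominus>\<^bsub>E\<^esub> \<iota> (e m0)) \<otimes>\<^bsub>E\<^esub> (\<iota> (d m) \<otimes>\<^bsub>E\<^esub> z m)" if "m \<in> M" for m
    proof -
      have cl: "\<iota> (d m) \<in> carrier E" "\<iota> (\<delta> (d m)) \<in> carrier E" "\<iota> (e m) \<in> carrier E" "\<iota> (e m0) \<in> carrier E"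
        using d[OF that] e[OF that] e[OF m0(1)] K.der_closed by auto
      have "\<iota> (f m) = \<iota> (\<delta> (d m)) \<oplus>\<^bsub>E\<^esub> \<iota> (d m) \<otimes>\<^bsub>E\<^esub> (\<iota> (e m) \<ominus>\<^bsub>E\<^esub> \<iota> (e m0))"
        using d[OF that] e[OF that] e[OF m0(1)] K.der_closed unfolding f_def
        by (simp add: K.minus_eq E.minus_eq)
      moreover have "\<delta>\<^sub>E (\<iota> (d m) \<otimes>\<^bsub>E\<^esub> z m)
          = \<iota> (\<delta> (d m)) \<otimes>\<^bsub>E\<^esub> z m \<oplus>\<^bsub>E\<^esub> \<iota> (d m) \<otimes>\<^bsub>E\<^esub> (\<iota> (e m) \<otimes>\<^bsub>E\<^esub> z m)"
        using E.der_mult[OF cl(1) z(1)[OF that]] der_extends[OF d[OF that]] z(3)[OF that] by simp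
      ultimately show ?thesis using cl z(1)[OF that] by (simp only:) algebra
    qed
    have tc: "(\<lambda>m. \<iota> (d m) \<otimes>\<^bsub>E\<^esub> z m) \<in> M \<rightarrow> carrier E" using d z by auto
    have "(\<Oplus>\<^bsub>E\<^esub>m\<in>M. \<iota> (f m) \<otimes>\<^bsub>E\<^esub> z m) = (\<Oplus>\<^bsub>E\<^esub>m\<in>M. \<delta>\<^sub>E (\<iota> (d m) \<otimes>\<^bsub>E\<^esub> z m)
        \<oplus>\<^bsub>E\<^esub> (\<ominus>\<^bsub>E\<^esub> \<iota> (e m0)) \<otimes>\<^bsub>E\<^esub> (\<iota> (d m) \<otimes>\<^bsub>E\<^esub> z m))"
      by (rule E.add.finprod_cong') (use tc e m0 E.der_closed eigen in \<open>auto simp: Pi_iff\<close>)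
    also have "\<dots> = (\<Oplus>\<^bsub>E\<^esub>m\<in>M. \<delta>\<^sub>E (\<iota> (d m) \<otimes>\<^bsub>E\<^esub> z m))
        \<oplus>\<^bsub>E\<^esub> (\<Oplus>\<^bsub>E\<^esub>m\<in>M. (\<ominus>\<^bsub>E\<^esub> \<iota> (e m0)) \<otimes>\<^bsub>E\<^esub> (\<iota> (d m) \<otimes>\<^bsub>E\<^esub> z m))"
      by (rule E.add.finprod_multf) (use tc e m0 E.der_closed in \<open>auto simp: Pi_iff\<close>)
    also have "(\<Oplus>\<^bsub>E\<^esub>m\<in>M. \<delta>\<^sub>E (\<iota> (d m) \<otimes>\<^bsub>E\<^esub> z m)) = \<zero>\<^bsub>E\<^esub>"
      using E.d_finsum[OF tc] reld by simp
    also have "(\<Oplus>\<^bsub>E\<^esub>m\<in>M. (\<ominus>\<^bsub>E\<^esub> \<iota> (e m0)) \<otimes>\<^bsub>E\<^esub> (\<iota> (d m) \<otimes>\<^bsub>E\<^esub> z m)) = \<zero>\<^bsub>E\<^esub>"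
      using E.finsum_rdistr[OF fin _ tc, of "\<ominus>\<^bsub>E\<^esub> \<iota> (e m0)"] e[OF m0(1)] reld by simp
    finally have relf: "(\<Oplus>\<^bsub>E\<^esub>m\<in>M. \<iota> (f m) \<otimes>\<^bsub>E\<^esub> z m) = \<zero>\<^bsub>E\<^esub>" by simp
    let ?N = "M - {m0}"
    have split: "(\<Oplus>\<^bsub>E\<^esub>m\<in>M. \<iota> (g m) \<otimes>\<^bsub>E\<^esub> z m)
        = \<iota> (g m0) \<otimes>\<^bsub>E\<^esub> z m0 \<oplus>\<^bsub>E\<^esub> (\<Oplus>\<^bsub>E\<^esub>m\<in>?N. \<iota> (g m) \<otimes>\<^bsub>E\<^esub> z m)"
      if "\<And>m. m \<in> M \<Longrightarrow> g m \<in> carrier K" for g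
    proof -
      have "insert m0 ?N = M" using m0 by auto
      then show ?thesis
        using E.finsum_insert[of ?N m0 "\<lambda>m. \<iota> (g m) \<otimes>\<^bsub>E\<^esub> z m"] fin that m0 z by auto
    qed
    have sumc: "(\<Oplus>\<^bsub>E\<^esub>m\<in>?N. \<iota> (f m) \<otimes>\<^bsub>E\<^esub> z m) \<in> carrier E"
      by (rule E.finsum_closed) (use f z in auto)
    have relN: "(\<Oplus>\<^bsub>E\<^esub>m\<in>?N. \<iota> (f m) \<otimes>\<^bsub>E\<^esub> z m) = \<zero>\<^bsub>E\<^esub>"
      using split[OF f] relf f0 z(1)[OF m0(1)] sumc by simp
    have "card ?N < card M" using m0 fin by (intro psubset_card_mono) auto
    then have fN: "\<forall>m\<in>?N. f m = \<zero>\<^bsub>K\<^esub>"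
      by (rule less.hyps) (use fin e sol nld f relN in auto)
    have dN: "d m = \<zero>\<^bsub>K\<^esub>" if "m \<in> ?N" for m
    proof (rule ccontr)
      assume nz: "d m \<noteq> \<zero>\<^bsub>K\<^esub>"
      have m: "m \<in> M" "m0 \<noteq> m" using that by auto
      note cl = d[OF m(1)] e[OF m(1)] e[OF m0(1)] K.der_closed[OF d[OF m(1)]]
      have "\<delta> (d m) = \<delta> (d m) \<oplus>\<^bsub>K\<^esub> d m \<otimes>\<^bsub>K\<^esub> (e m \<ominus>\<^bsub>K\<^esub> e m0)
          \<oplus>\<^bsub>K\<^esub> (e m0 \<ominus>\<^bsub>K\<^esub> e m) \<otimes>\<^bsub>K\<^esub> d m"
        using cl by algebra
      also have "\<dots> = (e m0 \<ominus>\<^bsub>K\<^esub> e m) \<otimes>\<^bsub>K\<^esub> d m"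
        using fN that cl unfolding f_def by simp
      finally have "K.solves (e m0 \<ominus>\<^bsub>K\<^esub> e m) (d m)" unfolding K.solves_def using cl nz by auto
      then show False using K.solves_log_der nld[OF m0(1) m] by blast
    qed
    have "(\<Oplus>\<^bsub>E\<^esub>m\<in>?N. \<iota> (d m) \<otimes>\<^bsub>E\<^esub> z m) = \<zero>\<^bsub>E\<^esub>"
      by (rule E.add.finprod_one_eqI) (use dN z in auto)
    then show False using split[OF d] reld d0 z[OF m0(1)] by simp
  qed
qed

end

section \<open>Independence of the solutions for a complement\<close>

context differential_extension
begin

lemma embedding_int_multiple:
  assumes "x \<in> carrier K" shows "\<iota> (add_pow K (n::int) x) = add_pow E n (\<iota> x)"
proof -
  have "\<iota> \<in> hom (add_monoid K) (add_monoid E)"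
    using embedding unfolding ring_hom_def hom_def by auto
  from hom_int_pow[OF this _ K.a_group E.a_group, of x n] assms show ?thesis
    by (simp add: add_pow_def)
qed

lemma embedding_int_combination:
  assumes "finite J" "b \<in> J \<rightarrow> carrier K"
  shows "\<iota> (K.int_combination b c J) = E.int_combination (\<lambda>j. \<iota> (b j)) c J"
proof -
  interpret h: ring_hom_cring K E \<iota> by (rule embedding_ring_hom)
  have "\<iota> (K.int_combination b c J) = (\<Oplus>\<^bsub>E\<^esub>j\<in>J. \<iota> (add_pow K (c j) (b j)))"
    unfolding K.int_combination_def using assms
    by (subst h.hom_finsum) (auto simp: Pi_iff comp_def)
  also have "\<dots> = E.int_combination (\<lambda>j. \<iota> (b j)) c J"
    unfolding E.int_combination_def
    by (rule E.add.finprod_cong') (use assms in \<open>auto simp: Pi_iff embedding_int_multiple\<close>)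
  finally show ?thesis .
qed

text \<open>The eigenvalue of a monomial is the combination of the \<open>b j\<close> whose coefficients are
  the exponents, so the hypothesis on \<open>b\<close> separates the eigenvalues of distinct monomials
  modulo \<open>\<A>\<close>. Injectivity of \<open>y\<close> is part of the claim because independence is a property of
  the set of the \<open>y j\<close>.\<close>

lemma solutions_algebraically_independent:
  assumes J: "finite J" and b: "b \<in> J \<rightarrow> carrier K"
    and sol: "\<And>j. j \<in> J \<Longrightarrow> E.solves (\<iota> (b j)) (y j)"
    and ind: "\<And>c. K.int_combination b c J \<in> log_der_set K \<delta> \<Longrightarrow> (\<forall>j\<in>J. c j = 0)"
  shows "inj_on y J" "E.algebraically_independent (\<iota> ` carrier K) (y ` J)"
proof -
  interpret h: ring_hom_cring K E \<iota> by (rule embedding_ring_hom)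
  have y: "y j \<in> carrier E" "y j \<noteq> \<zero>\<^bsub>E\<^esub>" "\<delta>\<^sub>E (y j) = \<iota> (b j) \<otimes>\<^bsub>E\<^esub> y j" if "j \<in> J" for j
    using sol[OF that] unfolding E.solves_def by auto
  have zero_ld: "\<zero>\<^bsub>K\<^esub> \<in> log_der_set K \<delta>" using K.solves_log_der[OF K.solves_one] .
  have bc: "b j \<in> carrier K" if "j \<in> J" for j using b that by (rule funcset_mem)
  show inj: "inj_on y J"
  proof (rule inj_onI, rule ccontr)
    fix i j assume ij: "i \<in> J" "j \<in> J" "y i = y j" "i \<noteq> j"
    then have "\<iota> (b i) \<otimes>\<^bsub>E\<^esub> y j = \<iota> (b j) \<otimes>\<^bsub>E\<^esub> y j" using y(3)[of i] y(3)[of j] by simp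
    then have "\<iota> (b i) = \<iota> (b j)"
      using E.m_rcancel[of "y j" "\<iota> (b i)" "\<iota> (b j)"] y[OF ij(2)] bc ij by simp
    then have eq: "b i = b j" using inj_onD[OF embedding_inj] bc ij by blast
    have one: "K.int_combination b (\<lambda>l. if l = k then 1 else 0) J = b k" if "k \<in> J" for k
      using K.int_combination_single[OF J that b, of "\<lambda>l. if l = k then 1 else 0"] bc[OF that] by simp
    have "K.int_combination b (\<lambda>l. (if l = i then 1 else 0) - (if l = j then 1 else 0)) J = \<zero>\<^bsub>K\<^esub>"
      using K.int_combination_diff[OF b] one[OF ij(1)] one[OF ij(2)] eq bc[OF ij(2)]
      by (simp add: K.minus_eq K.r_neg)
    with ind zero_ld have "\<forall>l\<in>J. (if l = i then 1 else 0) - (if l = j then 1 else 0) = (0::int)"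
      by (metis (mono_tags, lifting))
    then show False using ij by (auto dest!: bspec[of _ _ i])
  qed
  show "E.algebraically_independent (\<iota> ` carrier K) (y ` J)"
    unfolding E.algebraically_independent_def
  proof (intro conjI ballI impI)
    show "y ` J \<subseteq> carrier E" using y by auto
    fix P assume P: "P \<in> E.indexed_pset (y ` J) (\<iota> ` carrier K)"
      and P0: "E.indexed_value P = \<zero>\<^bsub>E\<^esub>"
    let ?M = "{m. P m \<noteq> \<zero>\<^bsub>E\<^esub>}"
    note PD = E.indexed_psetD[OF subfieldE(1)[OF embedding_subfield] P]
    define e where "e m = K.int_combination b (\<lambda>j. int (count m (y j))) J" for m
    define c where "c m = inv_into (carrier K) \<iota> (P m)" for m
    have c: "c m \<in> carrier K" "\<iota> (c m) = P m" for m
      using PD(2)[of m] unfolding c_def by (auto intro: inv_into_into f_inv_into_f)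
    have ec: "e m \<in> carrier K" for m unfolding e_def using b by simp
    have "\<forall>m\<in>?M. c m = \<zero>\<^bsub>K\<^esub>"
    proof (rule eigenvectors_independent)
      show "finite ?M" by (rule PD(1))
      show "E.solves (\<iota> (e m)) (E.monomial_value m)" if "m \<in> ?M" for m
      proof -
        have mY: "set_mset m \<subseteq> y ` J" using PD(3)[of m] that by auto
        have "E.monomial_value m = (\<Otimes>\<^bsub>E\<^esub>v\<in>y ` J. v [^]\<^bsub>E\<^esub> count m v)"
          by (rule E.monomial_value_superset) (use J mY y in auto)
        also have "\<dots> = (\<Otimes>\<^bsub>E\<^esub>j\<in>J. y j [^]\<^bsub>E\<^esub> count m (y j))"
          by (rule E.finprod_reindex) (use y inj in auto)
        finally show ?thesis
          using E.solves_monomial[OF J sol, where c = "\<lambda>j. count m (y j)"]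
            embedding_int_combination[OF J b]
          unfolding e_def by simp
      qed
      show "e m \<ominus>\<^bsub>K\<^esub> e m' \<notin> log_der_set K \<delta>" if "m \<in> ?M" "m' \<in> ?M" "m \<noteq> m'" for m m'
      proof
        assume "e m \<ominus>\<^bsub>K\<^esub> e m' \<in> log_der_set K \<delta>"
        then have "\<forall>j\<in>J. int (count m (y j)) - int (count m' (y j)) = 0"
          using ind[of "\<lambda>j. int (count m (y j)) - int (count m' (y j))"] K.int_combination_diff[OF b]
          unfolding e_def by simp
        then have eq: "count m v = count m' v" if "v \<in> y ` J" for v using that by auto
        have "count m v = count m' v" for v
        proof (cases "v \<in> y ` J")
          case False
          have "set_mset m \<subseteq> y ` J" "set_mset m' \<subseteq> y ` J" using PD(3) that by auto
          then show ?thesis using False by (metis count_eq_zero_iff subsetD)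
        qed (rule eq)
        then have "m = m'" by (rule multiset_eqI)
        then show False using that(3) by simp
      qed
      show "(\<Oplus>\<^bsub>E\<^esub>m\<in>?M. \<iota> (c m) \<otimes>\<^bsub>E\<^esub> E.monomial_value m) = \<zero>\<^bsub>E\<^esub>"
        using P0 unfolding E.indexed_value_def c(2) .
    qed (use ec c in auto)
    then have "P m = \<zero>\<^bsub>E\<^esub>" for m using c(2)[of m] h.hom_zero by (metis mem_Collect_eq)
    then show "P = E.indexed_const \<zero>\<^bsub>E\<^esub>" unfolding E.indexed_zero_def by auto
  qed
qed

end

lemma splitting_field_solves_span:
  assumes "splitting_field K \<delta> S E \<delta>\<^sub>E \<iota>" and "S \<subseteq> carrier K" and "a \<in> additive_span K S"
  shows "\<exists>y. differential_field.solves E \<delta>\<^sub>E (\<iota> a) y"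
proof -
  interpret differential_extension K \<delta> E \<delta>\<^sub>E \<iota>
    using assms(1) unfolding splitting_field_def by simp
  interpret h: ring_hom_cring K E \<iota> by (rule embedding_ring_hom)
  let ?H = "{a \<in> carrier K. \<exists>y. E.solves (\<iota> a) y}"
  have "subgroup ?H (add_monoid K)"
  proof (rule group.subgroupI[OF K.a_group])
    have "E.solves (\<iota> \<zero>\<^bsub>K\<^esub>) \<one>\<^bsub>E\<^esub>" using E.solves_one by simp
    then have "\<zero>\<^bsub>K\<^esub> \<in> ?H" by blast
    then show "?H \<noteq> {}" by blast
    show "inv\<^bsub>add_monoid K\<^esub> a \<in> ?H" if "a \<in> ?H" for a
      using that E.solves_inv by (fold a_inv_def) auto
    show "a \<otimes>\<^bsub>add_monoid K\<^esub> b \<in> ?H" if "a \<in> ?H" "b \<in> ?H" for a b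
    proof -
      from that obtain x y where "E.solves (\<iota> a) x" "E.solves (\<iota> b) y" by auto
      from E.solves_mult[OF this] that show ?thesis by auto
    qed
  qed auto
  moreover have "S \<subseteq> ?H"
  proof
    fix a assume a: "a \<in> S"
    then obtain y where "y \<in> carrier E" "y \<noteq> \<zero>\<^bsub>E\<^esub>" "\<delta>\<^sub>E y = \<iota> a \<otimes>\<^bsub>E\<^esub> y"
      using assms(1) unfolding splitting_field_def by auto
    moreover have ac: "a \<in> carrier K" using a assms(2) by auto
    ultimately have "E.solves (\<iota> a) y" unfolding E.solves_def by auto
    then show "a \<in> ?H" using ac by auto
  qed
  ultimately have "additive_span K S \<subseteq> ?H"
    unfolding additive_span_def by (intro group.generate_subgroup_incl[OF K.a_group])
  then show ?thesis using assms(3) by auto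
qed

lemma char_zero_torsion_free:
  assumes "field K" "char_zero K" "x \<in> carrier K" "(n::int) \<noteq> 0" "add_pow K n x = \<zero>\<^bsub>K\<^esub>"
  shows "x = \<zero>\<^bsub>K\<^esub>"
proof -
  interpret field K by fact
  have pos: "x = \<zero>\<^bsub>K\<^esub>" if "0 < k" "add_pow K (k::nat) x = \<zero>\<^bsub>K\<^esub>" for k
  proof -
    have "add_pow K k x = add_pow K k \<one>\<^bsub>K\<^esub> \<otimes>\<^bsub>K\<^esub> x"
      using add_pow_ldistr[of "\<one>\<^bsub>K\<^esub>" x k] assms(3) by simp
    moreover have "add_pow K k \<one>\<^bsub>K\<^esub> \<noteq> \<zero>\<^bsub>K\<^esub>" using assms(2) that unfolding char_zero_def by auto
    ultimately show ?thesis using that(2) assms(3) integral[of "add_pow K k \<one>\<^bsub>K\<^esub>" x] by auto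
  qed
  show ?thesis
  proof (cases "0 \<le> n")
    case True
    then show ?thesis using pos[of "nat n"] assms(4,5) add_pow_int_ge[of n K x] by auto
  next
    case False
    then have "\<ominus>\<^bsub>K\<^esub> add_pow K (nat (- n)) x = \<zero>\<^bsub>K\<^esub>"
      using add_pow_int_lt[of n K x] assms(5) by simp
    then have "add_pow K (nat (- n)) x = \<zero>\<^bsub>K\<^esub>"
      using assms(3) by (metis add.inv_eq_1_iff add.nat_pow_closed)
    then show ?thesis using pos[of "nat (- n)"] False by simp
  qed
qed

lemma (in ring) int_combination_mem_subgroup:
  assumes H: "subgroup H (add_monoid R)" and "finite J" "f \<in> J \<rightarrow> H"
  shows "int_combination f d J \<in> H"
  using assms(2,3)
proof (induction J rule: finite_induct)
  case empty
  then show ?case using subgroup.one_closed[OF H] by simp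
next
  case (insert i J)
  have "f \<in> insert i J \<rightarrow> carrier R" using insert.prems subgroup.subset[OF H] by auto
  moreover have "add_pow R (d i) (f i) \<in> H"
    using add.subgroup_int_pow_closed[OF H, of "f i" "d i"] insert.prems by (auto simp: add_pow_def)
  ultimately show ?case
    using insert subgroup.m_closed[OF H] by (simp add: int_combination_insert)
qed

text \<open>The components \<open>p s\<close> of \<open>s \<in> S\<close> in \<open>A'\<close> generate \<open>A'\<close>: the sums of an element of
  \<open>\<A>\<^sub>S\<close> and a combination of the \<open>p s\<close> form a group that contains \<open>S\<close>, and the decomposition
  of an element of \<open>A'\<close> is unique.\<close>

lemma complement_basis_exists:
  fixes K :: "('a, 'm) ring_scheme" (structure)
  assumes "differential_field K \<delta>" "char_zero K" "finite S" "S \<subseteq> carrier K"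
    and compl: "additive_complement K (additive_span K S) (log_der_part K \<delta> S) A'"
  shows "\<exists>(J :: 'a set) b. finite J \<and> b \<in> J \<rightarrow> carrier K \<and>
    A' = range (\<lambda>d. ring.int_combination K b d J) \<and> additive_rank K A' = card J \<and>
    (\<forall>c. ring.int_combination K b c J \<in> log_der_set K \<delta> \<longrightarrow> (\<forall>j\<in>J. c j = 0))"
proof -
  interpret differential_field K \<delta> by fact
  let ?A = "log_der_part K \<delta> S"
  let ?G = "additive_span K S"
  have G: "subgroup ?G (add_monoid K)"
    unfolding additive_span_def by (rule add.generate_is_subgroup) (use assms(4) in simp)
  have A: "subgroup ?A (add_monoid K)"
    unfolding log_der_part_def by (rule add.subgroups_Inter_pair[OF log_der_set_subgroup G])
  have A': "subgroup A' (add_monoid K)" and sum: "?A <+> A' = ?G" and int: "?A \<inter> A' = {\<zero>}"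
    using compl unfolding additive_complement_def additive_subgroup_def by auto
  have sumI: "u \<oplus> v \<in> U <+> V" if "u \<in> U" "v \<in> V" for u v U V
    using that unfolding set_add_def set_mult_def by auto
  have A'c: "A' \<subseteq> carrier K" using subgroup.subset[OF A'] by simp
  have Ac: "?A \<subseteq> carrier K" using subgroup.subset[OF A] by simp
  have "\<exists>p\<in>A'. \<exists>a\<in>?A. s = a \<oplus> p" if "s \<in> S" for s
  proof -
    have "s \<in> ?A <+> A'" unfolding sum additive_span_def using that by (rule generate.incl)
    then show ?thesis unfolding set_add_def set_mult_def by auto
  qed
  then obtain p where p: "\<And>s. s \<in> S \<Longrightarrow> p s \<in> A' \<and> (\<exists>a\<in>?A. s = a \<oplus> p s)" by metis
  have pc: "p \<in> S \<rightarrow> carrier K" using p A'c by auto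
  let ?H = "range (\<lambda>d. int_combination p d S)"
  have HA': "?H \<subseteq> A'" using int_combination_mem_subgroup[OF A' assms(3), of p] p by auto
  have "subgroup (?A <+> ?H) (add_monoid K)"
  proof -
    have "subgroup ?H (add_monoid K)"
    proof (rule group.subgroupI[OF a_group])
      show "?H \<subseteq> carrier (add_monoid K)" using HA' A'c by auto
      fix x assume "x \<in> ?H"
      then obtain d where d: "x = int_combination p d S" by auto
      have "\<ominus> x = int_combination p (\<lambda>i. 0 - d i) S"
        unfolding d int_combination_diff[OF pc, of "\<lambda>_. 0" d] using pc by (simp add: minus_eq)
      then show "inv\<^bsub>add_monoid K\<^esub> x \<in> ?H" by (fold a_inv_def) auto
      fix y assume "y \<in> ?H"
      then obtain d' where "y = int_combination p d' S" by auto
      then have "x \<oplus> y = int_combination p (\<lambda>i. d i + d' i) S"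
        unfolding d int_combination_add[OF pc] by simp
      then show "x \<otimes>\<^bsub>add_monoid K\<^esub> y \<in> ?H" by auto
    qed auto
    then have "additive_subgroup ?A K" "additive_subgroup ?H K" using A by (auto intro: additive_subgroup.intro)
    from add_additive_subgroups[OF this] show ?thesis by (rule additive_subgroup.a_subgroup)
  qed
  moreover have "S \<subseteq> ?A <+> ?H"
  proof
    fix s assume s: "s \<in> S"
    obtain a where a: "a \<in> ?A" "s = a \<oplus> p s" using p[OF s] by auto
    have "int_combination p (\<lambda>l. if l = s then 1 else 0) S = p s"
      using int_combination_single[OF assms(3) s pc, of "\<lambda>l. if l = s then 1 else 0"] funcset_mem[OF pc s] by simp
    then have "p s \<in> ?H" by (metis rangeI)
    then show "s \<in> ?A <+> ?H" using a sumI by metis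
  qed
  ultimately have GH: "?G \<subseteq> ?A <+> ?H"
    unfolding additive_span_def by (intro add.generate_subgroup_incl)
  have A'G: "A' \<subseteq> ?G"
  proof
    fix x assume "x \<in> A'"
    moreover have "\<zero> \<in> ?A" using subgroup.one_closed[OF A] by simp
    ultimately have "\<zero> \<oplus> x \<in> ?A <+> A'" by (intro sumI)
    then show "x \<in> ?G" using sum \<open>x \<in> A'\<close> A'c by auto
  qed
  have "A' \<subseteq> ?H"
  proof
    fix x assume x: "x \<in> A'"
    obtain a h where ah: "a \<in> ?A" "h \<in> ?H" "x = a \<oplus> h"
      using x A'G GH unfolding set_add_def set_mult_def by force
    have c: "a \<in> carrier K" "h \<in> carrier K" "h \<in> A'" using ah HA' Ac A'c by auto
    have "\<ominus> h \<in> A'" using subgroup.m_inv_closed[OF A' c(3)] by (fold a_inv_def) simp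
    then have "x \<oplus> \<ominus> h \<in> A'" using subgroup.m_closed[OF A' x] by simp
    moreover have "x \<oplus> \<ominus> h = a" unfolding ah(3) using c by algebra
    ultimately have "a = \<zero>" using int ah(1) by auto
    then show "x \<in> ?H" using ah c by simp
  qed
  then have A'H: "A' = ?H" using HA' by auto
  have tf: "\<forall>x\<in>carrier K. \<forall>n::int. n \<noteq> 0 \<longrightarrow> add_pow K n x = \<zero> \<longrightarrow> x = \<zero>"
    using char_zero_torsion_free[OF field_axioms assms(2)] by blast
  from int_combination_basis_exists[OF tf assms(3) pc] obtain J :: "'a set" and b where
    J: "finite J" "b \<in> J \<rightarrow> carrier K" "range (\<lambda>d. int_combination b d J) = ?H"
    "\<forall>c. int_combination b c J = \<zero> \<longrightarrow> (\<forall>j\<in>J. c j = 0)" by blast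
  have A'J: "A' = range (\<lambda>d. int_combination b d J)" using J(3) A'H by simp
  have "additive_rank K A' = card J"
    by (rule additive_rank_eq[OF J(1,2) A'J]) (use J(4) in blast)
  moreover have "\<forall>j\<in>J. c j = 0" if "int_combination b c J \<in> log_der_set K \<delta>" for c
  proof -
    have "int_combination b c J \<in> A'" using A'J by auto
    then have "int_combination b c J \<in> ?A \<inter> A'" using that A'G unfolding log_der_part_def by auto
    then show ?thesis using int J(4) by auto
  qed
  ultimately show ?thesis using J(1,2) A'J by blast
qed

section \<open>Twisted derivations of polynomial rings\<close>

text \<open>The library's polynomials are coefficient lists that start with the leading
  coefficient, so a list with prescribed coefficients is a map over a reversed interval.\<close>

lemma (in ring) coeff_map_rev_upt:
  "coeff (map g (rev [0..<n])) = (\<lambda>i. if i < n then g i else \<zero>)"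
  by (induction n) (auto simp: fun_eq_iff)

lemma (in ring) poly_ring_eqI:
  assumes "p \<in> carrier (poly_ring R)" "q \<in> carrier (poly_ring R)" "\<And>i. coeff p i = coeff q i"
  shows "p = q"
  using coeff_iff_polynomial_cond[of "carrier R" p q] assms by (auto simp: univ_poly_carrier)

context differential_field
begin

text \<open>The derivation of \<open>K[X]\<close> that extends \<open>\<delta>\<close> and maps \<open>X\<close> to \<open>c X\<close>. It acts on each
  monomial separately and may cancel the leading coefficient, hence the normalization.\<close>

definition twisted_derivation :: "'a \<Rightarrow> 'a list \<Rightarrow> 'a list"
  where "twisted_derivation c p =
    normalize (map (\<lambda>i. \<delta> (coeff p i) \<oplus> add_pow K i c \<otimes> coeff p i) (rev [0..<length p]))"

lemma coeff_closed: "p \<in> carrier (poly_ring K) \<Longrightarrow> coeff p i \<in> carrier K"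
  using coeff_in_carrier[of p i] by (auto simp: univ_poly_carrier[symmetric] polynomial_def)

lemma twisted_derivation_closed:
  assumes "c \<in> carrier K" "p \<in> carrier (poly_ring K)"
  shows "twisted_derivation c p \<in> carrier (poly_ring K)"
proof -
  have "polynomial (carrier K) (twisted_derivation c p)"
    unfolding twisted_derivation_def
    by (rule normalize_gives_polynomial) (use assms coeff_closed der_closed in auto)
  then show ?thesis by (simp add: univ_poly_carrier)
qed

lemma coeff_twisted_derivation:
  assumes "c \<in> carrier K" "p \<in> carrier (poly_ring K)"
  shows "coeff (twisted_derivation c p) i = \<delta> (coeff p i) \<oplus> add_pow K i c \<otimes> coeff p i"
proof -
  have "coeff (twisted_derivation c p) i
      = (if i < length p then \<delta> (coeff p i) \<oplus> add_pow K i c \<otimes> coeff p i else \<zero>)"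
    unfolding twisted_derivation_def normalize_coeff[symmetric] coeff_map_rev_upt ..
  then show ?thesis using coeff_length[of p i] assms by auto
qed

text \<open>The Leibniz rule holds for the coefficients because a factor \<open>X\<^sup>i\<close> contributes
  \<open>i c\<close>, which splits as \<open>k c + (i - k) c\<close> over the factors \<open>X\<^sup>k\<close> and \<open>X\<^bsup>i-k\<^esup>\<close>.\<close>

lemma twisted_derivation_differential_ring:
  assumes c: "c \<in> carrier K"
  shows "differential_ring (poly_ring K) (twisted_derivation c)"
proof -
  interpret UP: domain "poly_ring K" by (rule univ_poly_is_domain[OF carrier_is_subring])
  let ?D = "twisted_derivation c"
  have pc: "set p \<subseteq> carrier K" if "p \<in> carrier (poly_ring K)" for p
    using that by (auto simp: univ_poly_carrier[symmetric] polynomial_def)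
  have add: "coeff (p \<oplus>\<^bsub>poly_ring K\<^esub> q) i = coeff p i \<oplus> coeff q i"
    if "p \<in> carrier (poly_ring K)" "q \<in> carrier (poly_ring K)" for p q i
    using poly_add_coeff[OF pc[OF that(1)] pc[OF that(2)]] by (simp add: univ_poly_add)
  have mult: "coeff (p \<otimes>\<^bsub>poly_ring K\<^esub> q) i = (\<Oplus>k\<in>{..i}. coeff p k \<otimes> coeff q (i - k))"
    if "p \<in> carrier (poly_ring K)" "q \<in> carrier (poly_ring K)" for p q i
    using poly_mult_coeff[OF pc[OF that(1)] pc[OF that(2)]] by (simp add: univ_poly_mult)
  show ?thesis
  proof unfold_locales
    fix p q assume p: "p \<in> carrier (poly_ring K)" and q: "q \<in> carrier (poly_ring K)"
    note Dp = twisted_derivation_closed[OF c p] and Dq = twisted_derivation_closed[OF c q]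
    note cc = coeff_closed[OF p] coeff_closed[OF q]
    show "?D p \<in> carrier (poly_ring K)" by (rule Dp)
    show "?D (p \<oplus>\<^bsub>poly_ring K\<^esub> q) = ?D p \<oplus>\<^bsub>poly_ring K\<^esub> ?D q"
    proof (rule poly_ring_eqI)
      fix i
      have "coeff (?D (p \<oplus>\<^bsub>poly_ring K\<^esub> q)) i
          = (\<delta> (coeff p i) \<oplus> \<delta> (coeff q i)) \<oplus> add_pow K i c \<otimes> (coeff p i \<oplus> coeff q i)"
        using coeff_twisted_derivation[OF c UP.a_closed[OF p q]] add[OF p q] cc by (simp add: der_add)
      also have "\<dots> = (\<delta> (coeff p i) \<oplus> add_pow K i c \<otimes> coeff p i)
          \<oplus> (\<delta> (coeff q i) \<oplus> add_pow K i c \<otimes> coeff q i)"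
        using cc[of i] der_closed add.nat_pow_closed[OF c, of i] by (simp add: r_distr a_ac)
      finally show "coeff (?D (p \<oplus>\<^bsub>poly_ring K\<^esub> q)) i = coeff (?D p \<oplus>\<^bsub>poly_ring K\<^esub> ?D q) i"
        using add[OF Dp Dq] coeff_twisted_derivation[OF c] p q by simp
    qed (use twisted_derivation_closed[OF c] p q Dp Dq in auto)
    show "?D (p \<otimes>\<^bsub>poly_ring K\<^esub> q) = ?D p \<otimes>\<^bsub>poly_ring K\<^esub> q \<oplus>\<^bsub>poly_ring K\<^esub> p \<otimes>\<^bsub>poly_ring K\<^esub> ?D q"
    proof (rule poly_ring_eqI)
      fix i
      let ?s = "\<lambda>k. coeff p k \<otimes> coeff q (i - k)"
      have sc: "?s \<in> {..i} \<rightarrow> carrier K" using cc by auto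
      have ic: "add_pow K j c \<in> carrier K" for j :: nat using c by simp
      have each: "\<delta> (?s k) \<oplus> add_pow K i c \<otimes> ?s k
          = coeff (?D p) k \<otimes> coeff q (i - k) \<oplus> coeff p k \<otimes> coeff (?D q) (i - k)"
        if "k \<in> {..i}" for k
      proof -
        have "add_pow K i c = add_pow K k c \<oplus> add_pow K (i - k) c"
          using that c by (simp add: add.nat_pow_mult)
        moreover have "\<delta> (?s k) = \<delta> (coeff p k) \<otimes> coeff q (i - k) \<oplus> coeff p k \<otimes> \<delta> (coeff q (i - k))"
          using cc by (simp add: der_mult)
        moreover note coeff_twisted_derivation[OF c p, of k] coeff_twisted_derivation[OF c q, of "i - k"]
        ultimately show ?thesis
          using cc(1)[of k] cc(2)[of "i - k"] der_closed[OF cc(1)[of k]] der_closed[OF cc(2)[of "i - k"]]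
            ic[of k] ic[of "i - k"] by (simp only:) algebra
      qed
      have "coeff (?D (p \<otimes>\<^bsub>poly_ring K\<^esub> q)) i = \<delta> (\<Oplus>k\<in>{..i}. ?s k) \<oplus> add_pow K i c \<otimes> (\<Oplus>k\<in>{..i}. ?s k)"
        using coeff_twisted_derivation[OF c UP.m_closed[OF p q]] mult[OF p q] by simp
      also have "\<delta> (\<Oplus>k\<in>{..i}. ?s k) = (\<Oplus>k\<in>{..i}. \<delta> (?s k))" by (rule d_finsum[OF sc])
      also have "add_pow K i c \<otimes> (\<Oplus>k\<in>{..i}. ?s k) = (\<Oplus>k\<in>{..i}. add_pow K i c \<otimes> ?s k)"
        by (rule finsum_rdistr[OF _ ic sc]) simp
      also have "(\<Oplus>k\<in>{..i}. \<delta> (?s k)) \<oplus> (\<Oplus>k\<in>{..i}. add_pow K i c \<otimes> ?s k)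
          = (\<Oplus>k\<in>{..i}. \<delta> (?s k) \<oplus> add_pow K i c \<otimes> ?s k)"
        by (rule add.finprod_multf[symmetric]) (use cc ic der_closed in auto)
      also have "\<dots> = (\<Oplus>k\<in>{..i}. coeff (?D p) k \<otimes> coeff q (i - k) \<oplus> coeff p k \<otimes> coeff (?D q) (i - k))"
        by (rule add.finprod_cong') (use each cc coeff_closed[OF Dp] coeff_closed[OF Dq] in auto)
      also have "\<dots> = (\<Oplus>k\<in>{..i}. coeff (?D p) k \<otimes> coeff q (i - k))
          \<oplus> (\<Oplus>k\<in>{..i}. coeff p k \<otimes> coeff (?D q) (i - k))"
        by (rule add.finprod_multf) (use cc coeff_closed[OF Dp] coeff_closed[OF Dq] in auto)
      finally show "coeff (?D (p \<otimes>\<^bsub>poly_ring K\<^esub> q)) i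
          = coeff (?D p \<otimes>\<^bsub>poly_ring K\<^esub> q \<oplus>\<^bsub>poly_ring K\<^esub> p \<otimes>\<^bsub>poly_ring K\<^esub> ?D q) i"
        using add[OF UP.m_closed[OF Dp q] UP.m_closed[OF p Dq], of i] mult[OF Dp q, of i] mult[OF p Dq, of i]
        by simp
    qed (use twisted_derivation_closed[OF c] p q Dp Dq in auto)
  qed
qed

lemma poly_of_const_closed: "a \<in> carrier K \<Longrightarrow> poly_of_const a \<in> carrier (poly_ring K)"
  using ring_hom_closed[OF canonical_embedding_is_hom[OF carrier_is_subring], of a] by simp

lemma twisted_derivation_const:
  assumes "c \<in> carrier K" "a \<in> carrier K"
  shows "twisted_derivation c (poly_of_const a) = poly_of_const (\<delta> a)"
proof (rule poly_ring_eqI)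
  have coeff_const: "coeff (poly_of_const x) i = (if i = 0 then x else \<zero>)" for x i
    unfolding poly_of_const_def normalize_coeff[symmetric] by simp
  show "coeff (twisted_derivation c (poly_of_const a)) i = coeff (poly_of_const (\<delta> a)) i" for i
    unfolding coeff_twisted_derivation[OF assms(1) poly_of_const_closed[OF assms(2)]] coeff_const
    using assms der_closed by simp
qed (use assms poly_of_const_closed twisted_derivation_closed der_closed in auto)

lemma twisted_derivation_var:
  assumes c: "c \<in> carrier K"
  shows "twisted_derivation c X = poly_of_const c \<otimes>\<^bsub>poly_ring K\<^esub> X"
proof -
  have "[0..<Suc (Suc 0)] = [0, 1]" by (simp add: upt_rec)
  then have "twisted_derivation c X = normalize [c, \<zero>]"
    unfolding twisted_derivation_def var_def using c by simp
  also have "\<dots> = poly_of_const c \<otimes>\<^bsub>poly_ring K\<^esub> X"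
    unfolding poly_mult_var[OF carrier_is_subring poly_of_const_closed[OF c]]
    by (simp add: poly_of_const_def)
  finally show ?thesis .
qed

end

text \<open>On cosets the derivation is defined through chosen representatives; stability of the
  ideal makes the choice irrelevant.\<close>

lemma (in differential_ring) quotient_derivation:
  assumes I: "ideal I R" and stable: "\<And>x. x \<in> I \<Longrightarrow> d x \<in> I"
  shows "\<exists>d'. differential_ring (R Quot I) d' \<and> (\<forall>x\<in>carrier R. d' (I +> x) = I +> d x)"
proof -
  interpret I: ideal I R by fact
  interpret Q: cring "R Quot I" by (rule I.quotient_is_cring[OF is_cring])
  have eqI: "I +> x = I +> y \<longleftrightarrow> x \<ominus> y \<in> I" if "x \<in> carrier R" "y \<in> carrier R" for x y
    using quotient_eq_iff_same_a_r_cos[OF I that] by blast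
  define d' where "d' A = I +> d (SOME x. x \<in> carrier R \<and> A = I +> x)" for A
  have d': "d' (I +> x) = I +> d x" if x: "x \<in> carrier R" for x
  proof -
    define y where "y = (SOME y. y \<in> carrier R \<and> I +> x = I +> y)"
    have y: "y \<in> carrier R" "I +> x = I +> y"
      using someI[of "\<lambda>y. y \<in> carrier R \<and> I +> x = I +> y" x] x unfolding y_def by auto
    then have "d (y \<ominus> x) \<in> I" using stable eqI[OF y(1) x] by simp
    then have "I +> d y = I +> d x" using eqI d_diff d_closed x y by simp
    then show ?thesis unfolding d'_def y_def .
  qed
  have car: "\<exists>x\<in>carrier R. A = I +> x" if "A \<in> carrier (R Quot I)" for A
    using that unfolding FactRing_def A_RCOSETS_def' by auto
  have add: "(I +> x) \<oplus>\<^bsub>R Quot I\<^esub> (I +> y) = I +> (x \<oplus> y)" if "x \<in> carrier R" "y \<in> carrier R" for x y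
    using I.a_rcos_sum[OF that] by (simp add: FactRing_def)
  have mult: "(I +> x) \<otimes>\<^bsub>R Quot I\<^esub> (I +> y) = I +> (x \<otimes> y)" if "x \<in> carrier R" "y \<in> carrier R" for x y
    using I.rcoset_mult_add[OF that] by (simp add: FactRing_def)
  have mem: "I +> x \<in> carrier (R Quot I)" if "x \<in> carrier R" for x
    using that unfolding FactRing_def A_RCOSETS_def' by auto
  have "differential_ring (R Quot I) d'"
  proof unfold_locales
    fix A B assume "A \<in> carrier (R Quot I)" "B \<in> carrier (R Quot I)"
    then obtain x y where xy: "x \<in> carrier R" "A = I +> x" "y \<in> carrier R" "B = I +> y"
      using car by metis
    show "d' A \<in> carrier (R Quot I)" using xy d' mem d_closed by simp
    show "d' (A \<oplus>\<^bsub>R Quot I\<^esub> B) = d' A \<oplus>\<^bsub>R Quot I\<^esub> d' B"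
      using xy d' add d_closed d_add by simp
    show "d' (A \<otimes>\<^bsub>R Quot I\<^esub> B) = d' A \<otimes>\<^bsub>R Quot I\<^esub> B \<oplus>\<^bsub>R Quot I\<^esub> A \<otimes>\<^bsub>R Quot I\<^esub> d' B"
      using xy d' add mult d_closed d_mult by simp
  qed
  then show ?thesis using d' by blast
qed

section \<open>Adjoining roots\<close>

lemma (in ring) add_minus_cancel_left:
  assumes "x \<in> carrier R" "y \<in> carrier R" shows "x \<oplus> y \<ominus> x = y"
  using assms by algebra

text \<open>The twisted derivation over the zero derivation with \<open>c = 1\<close> is \<open>X\<close> times the formal
  derivative; it serves to detect multiple factors.\<close>

lemma (in differential_field) trivial_derivation: "differential_field K (\<lambda>_. \<zero>)"
  by unfold_locales auto

text \<open>A set that is covered by an encodable set is encodable, by choosing preimages.\<close>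

lemma inj_on_image_exists:
  fixes h :: "'b \<Rightarrow> 'c"
  assumes "inj_on h T" shows "\<exists>f :: _ \<Rightarrow> 'c. inj_on f (g ` T)"
proof -
  have "inj_on (h \<circ> inv_into T g) (g ` T)"
    by (rule comp_inj_on[OF inj_on_inv_into])
      (auto intro!: inj_on_subset[OF assms] inv_into_into)
  then show ?thesis by blast
qed

lemma (in differential_field) poly_ring_lists: "carrier (poly_ring K) \<subseteq> lists (carrier K)"
  by (auto simp: univ_poly_carrier[symmetric] polynomial_def)

text \<open>Put \<open>p = X\<^sup>n - z\<close> and let \<open>f\<close> be an irreducible factor, \<open>p = f g\<close>. The twisted
  derivation \<open>D\<close> with \<open>D X = a X\<close> maps \<open>p\<close> to \<open>n a p\<close>, so \<open>f\<close> divides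
  \<open>D p = (D f) g + f (D g)\<close> and hence \<open>(D f) g\<close>. If \<open>f\<close> divided \<open>g\<close>, it would also divide
  \<open>X p' = n X\<^sup>n\<close> and therefore the nonzero constant \<open>X p' - n p = n z\<close>. So \<open>f\<close> divides
  \<open>D f\<close>, the ideal \<open>(f)\<close> is stable, and the class of \<open>X\<close> solves for \<open>a\<close> in the field
  \<open>K[X]/(f)\<close>. The injection \<open>code\<close> is carried along to bound the size of the new field.\<close>

lemma (in differential_field) adjoin_root:
  fixes code :: "_ \<Rightarrow> 'c"
  assumes cz: "char_zero K" and inj: "inj_on code (lists (carrier K))" and a: "a \<in> carrier K" and n: "0 < (n::nat)"
    and z: "solves (add_pow K n a) z"
  shows "\<exists>(E :: 'a list set ring) \<delta>\<^sub>E \<iota> y (f :: _ \<Rightarrow> 'c). inj_on f (carrier E) \<and>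
    differential_extension K \<delta> E \<delta>\<^sub>E \<iota> \<and>
    ring.finite_dimension E (\<iota> ` carrier K) (carrier E) \<and> differential_field.solves E \<delta>\<^sub>E (\<iota> a) y"
proof -
  \<comment> \<open>\<open>Q\<close> is \<open>X\<close> times the formal derivative.\<close>
  define Q where "Q = differential_field.twisted_derivation K (\<lambda>_. \<zero>) \<one>"
  let ?P = "poly_ring K" and ?C = poly_of_const
  interpret UP: principal_domain ?P by (rule univ_poly_is_principal[OF carrier_is_subfield])
  interpret D: differential_ring ?P "twisted_derivation a"
    by (rule twisted_derivation_differential_ring[OF a])
  interpret D0: differential_ring ?P Q
    unfolding Q_def
    by (rule differential_field.twisted_derivation_differential_ring[OF trivial_derivation one_closed])
  note XP = var_closed(1)[OF carrier_is_subring]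
  have Chom: "?C \<in> ring_hom K ?P" using canonical_embedding_is_hom[OF carrier_is_subring] by simp
  have Cring: "ring_hom_cring K ?P ?C"
    by (rule ring_hom_cring.intro[OF is_cring UP.is_cring ring_hom_cring_axioms.intro[OF Chom]])
  interpret C: ring_hom_cring K ?P ?C by (rule Cring)
  have zc: "z \<in> carrier K" "z \<noteq> \<zero>" "\<delta> z = add_pow K n a \<otimes> z"
    using z unfolding solves_def by blast+
  have Cn: "add_pow ?P m (?C x) = ?C (add_pow K m x)" if "x \<in> carrier K" for m :: nat and x
    using that by (induction m) auto
  have unit: "?C x \<in> Units ?P" if "x \<in> carrier K" "x \<noteq> \<zero>" for x
  proof -
    have "x \<in> Units K" using that field_Units by auto
    then have "inv x \<in> carrier K" "x \<otimes> inv x = \<one>" by auto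
    then have "?C x \<otimes>\<^bsub>?P\<^esub> ?C (inv x) = \<one>\<^bsub>?P\<^esub>" using that C.hom_mult C.hom_one by metis
    then show ?thesis using that \<open>inv x \<in> carrier K\<close> UP.unit_factor[of "?C x" "?C (inv x)"] by simp
  qed
  \<comment> \<open>Below \<open>p = X\<^sup>n + w\<close>, which avoids subtraction, and \<open>k\<close> is the number \<open>n\<close> in \<open>K\<close>.\<close>
  define w where "w = \<ominus> z"
  define k where "k = add_pow K n \<one>"
  define p where "p = X [^]\<^bsub>?P\<^esub> n \<oplus>\<^bsub>?P\<^esub> ?C w"
  have w: "w \<in> carrier K" "w \<noteq> \<zero>" "\<delta> w = add_pow K n a \<otimes> w"
    using zc a unfolding w_def by (auto simp: d_minus r_minus)
  have k: "k \<in> carrier K" "k \<noteq> \<zero>" using cz n unfolding k_def char_zero_def by auto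
  have Xn: "X [^]\<^bsub>?P\<^esub> m \<in> carrier ?P" for m :: nat using XP by simp
  have pP: "p \<in> carrier ?P" unfolding p_def using Xn w by simp
  have QX: "Q X = ?C \<one> \<otimes>\<^bsub>?P\<^esub> X" and QC: "Q (?C w) = ?C \<zero>"
    unfolding Q_def using differential_field.twisted_derivation_var[OF trivial_derivation one_closed]
      differential_field.twisted_derivation_const[OF trivial_derivation one_closed w(1)] by blast+
  have Dp: "twisted_derivation a p = ?C (add_pow K n a) \<otimes>\<^bsub>?P\<^esub> p"
  proof -
    have "twisted_derivation a (X [^]\<^bsub>?P\<^esub> n) = ?C (add_pow K n a) \<otimes>\<^bsub>?P\<^esub> X [^]\<^bsub>?P\<^esub> n"
      using D.d_pow_eigenvector[OF _ XP twisted_derivation_var[OF a]] Cn a by simp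
    moreover have "twisted_derivation a (?C w) = ?C (add_pow K n a) \<otimes>\<^bsub>?P\<^esub> ?C w"
      using twisted_derivation_const[OF a w(1)] w a by simp
    ultimately show ?thesis unfolding p_def using Xn w a by (simp add: D.d_add UP.r_distr)
  qed
  have D0p: "Q p \<oplus>\<^bsub>?P\<^esub> ?C (k \<otimes> w) = ?C k \<otimes>\<^bsub>?P\<^esub> p"
  proof -
    have "Q (X [^]\<^bsub>?P\<^esub> n) = ?C k \<otimes>\<^bsub>?P\<^esub> X [^]\<^bsub>?P\<^esub> n"
      unfolding k_def
      using D0.d_pow_eigenvector[OF _ XP QX, of n] Cn[of \<one> n] by simp
    moreover have "Q (?C w) = \<zero>\<^bsub>?P\<^esub>"
      using QC by simp
    ultimately show ?thesis unfolding p_def using Xn w k by (simp add: D0.d_add UP.r_distr)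
  qed
  have not_unit: "p \<noteq> \<zero>\<^bsub>?P\<^esub>" "p \<notin> Units ?P"
  proof -
    have pc: "set q \<subseteq> carrier K" if "q \<in> carrier ?P" for q
      using that by (auto simp: univ_poly_carrier[symmetric] polynomial_def)
    have "coeff (X [^]\<^bsub>?P\<^esub> n) n = \<one>"
      unfolding unitary_monom_eq_var_pow[OF carrier_is_subring, symmetric] monom_coeff by simp
    moreover have "coeff (?C w) n = \<zero>"
      unfolding poly_of_const_def normalize_coeff[symmetric] using n by simp
    moreover have "coeff p n = coeff (X [^]\<^bsub>?P\<^esub> n) n \<oplus> coeff (?C w) n"
      unfolding p_def univ_poly_add using poly_add_coeff[OF pc[OF Xn] pc[OF C.hom_closed[OF w(1)]]] by simp
    ultimately have one: "coeff p n = \<one>" by simp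
    then show "p \<noteq> \<zero>\<^bsub>?P\<^esub>" unfolding univ_poly_zero by auto
    show "p \<notin> Units ?P"
    proof
      assume "p \<in> Units ?P"
      then obtain c where "p = [c]" using univ_poly_units[OF carrier_is_subfield] by auto
      then show False using one n by simp
    qed
  qed
  then obtain f where f: "f \<in> carrier ?P" "pirreducible (carrier K) f" "f divides\<^bsub>?P\<^esub> p"
    using UP.exists_irreducible_divisor[of p] pP by blast
  let ?I = "PIdl\<^bsub>?P\<^esub> f"
  have I: "ideal ?I ?P" by (rule UP.cgenideal_ideal[OF f(1)])
  interpret I: ideal ?I ?P by (rule I)
  have mem: "x \<in> ?I \<longleftrightarrow> f divides\<^bsub>?P\<^esub> x" if "x \<in> carrier ?P" for x
  proof -
    have "x \<in> ?I \<longleftrightarrow> (\<exists>r\<in>carrier ?P. x = r \<otimes>\<^bsub>?P\<^esub> f)" unfolding cgenideal_def by blast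
    also have "\<dots> \<longleftrightarrow> (\<exists>r\<in>carrier ?P. x = f \<otimes>\<^bsub>?P\<^esub> r)" using UP.m_comm f(1) by metis
    finally show ?thesis unfolding factor_def .
  qed
  have mult: "f \<otimes>\<^bsub>?P\<^esub> x \<in> ?I" if "x \<in> carrier ?P" for x
    using that f(1) mem[of "f \<otimes>\<^bsub>?P\<^esub> x"] unfolding factor_def by auto
  have prime: "x \<in> ?I \<or> y \<in> ?I" if "x \<otimes>\<^bsub>?P\<^esub> y \<in> ?I" "x \<in> carrier ?P" "y \<in> carrier ?P" for x y
  proof -
    have "prime ?P f"
      using f pprime_iff_pirreducible[OF carrier_is_subfield f(1)] UP.ring_primeE(3) by blast
    then show ?thesis using that mem unfolding prime_def by auto
  qed
  have no_const: "?C x \<notin> ?I" if "x \<in> carrier K" "x \<noteq> \<zero>" for x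
  proof
    assume "?C x \<in> ?I"
    then have "f divides\<^bsub>?P\<^esub> ?C x" using mem[of "?C x"] that by blast
    then have "f \<in> Units ?P" using UP.divides_unit[OF _ f(1) unit[OF that]] by blast
    then show False using UP.ring_irreducibleE(4)[OF f(1,2)] by blast
  qed
  have pI: "p \<in> ?I" using mem pP f(3) by simp
  obtain g where g: "g \<in> carrier ?P" "p = f \<otimes>\<^bsub>?P\<^esub> g" using f(3) unfolding factor_def by auto
  have gI: "g \<notin> ?I"
  proof
    assume "g \<in> ?I"
    then obtain h where h: "h \<in> carrier ?P" "g = f \<otimes>\<^bsub>?P\<^esub> h" using mem g unfolding factor_def by auto
    let ?D = Q
    have "?D p = ?D f \<otimes>\<^bsub>?P\<^esub> g \<oplus>\<^bsub>?P\<^esub> f \<otimes>\<^bsub>?P\<^esub> ?D g" using g f D0.d_mult by simp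
    also have "?D f \<otimes>\<^bsub>?P\<^esub> g = f \<otimes>\<^bsub>?P\<^esub> (?D f \<otimes>\<^bsub>?P\<^esub> h)"
      unfolding h(2) using f h D0.d_closed by (simp add: UP.m_lcomm)
    finally have "?D p \<in> ?I" using mult f g h D0.d_closed I.a_closed by simp
    moreover have "?C k \<otimes>\<^bsub>?P\<^esub> p \<in> ?I" using I.I_l_closed pI k by simp
    moreover have "?C (k \<otimes> w) = ?C k \<otimes>\<^bsub>?P\<^esub> p \<ominus>\<^bsub>?P\<^esub> ?D p"
      unfolding D0p[symmetric]
      using UP.add_minus_cancel_left[OF D0.d_closed[OF pP] C.hom_closed[of "k \<otimes> w"]] k w by simp
    ultimately have "?C (k \<otimes> w) \<in> ?I"
      using I.a_closed I.a_inv_closed by (simp add: UP.minus_eq)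
    then show False using no_const[of "k \<otimes> w"] k w integral by auto
  qed
  let ?D = "twisted_derivation a"
  have "?D f \<in> ?I"
  proof -
    have "?D p = ?D f \<otimes>\<^bsub>?P\<^esub> g \<oplus>\<^bsub>?P\<^esub> f \<otimes>\<^bsub>?P\<^esub> ?D g" using g f D.d_mult by simp
    then have "?D f \<otimes>\<^bsub>?P\<^esub> g = ?D p \<ominus>\<^bsub>?P\<^esub> f \<otimes>\<^bsub>?P\<^esub> ?D g"
      using D.d_closed[OF f(1)] D.d_closed[OF g(1)] f(1) g(1) by (simp only:) algebra
    moreover have "?D p \<in> ?I" unfolding Dp using I.I_l_closed pI a by simp
    ultimately have "?D f \<otimes>\<^bsub>?P\<^esub> g \<in> ?I"
      using mult[OF D.d_closed[OF g(1)]] I.a_closed I.a_inv_closed by (simp add: UP.minus_eq)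
    then show ?thesis using prime gI D.d_closed f g by blast
  qed
  have stable: "?D x \<in> ?I" if "x \<in> ?I" for x
  proof -
    obtain r where r: "r \<in> carrier ?P" "x = r \<otimes>\<^bsub>?P\<^esub> f" using \<open>x \<in> ?I\<close> unfolding cgenideal_def by auto
    have "?D x = ?D r \<otimes>\<^bsub>?P\<^esub> f \<oplus>\<^bsub>?P\<^esub> r \<otimes>\<^bsub>?P\<^esub> ?D f" unfolding r(2) using r f D.d_mult by simp
    then show ?thesis
      using I.I_l_closed[OF UP.cgenideal_self[OF f(1)] D.d_closed[OF r(1)]]
        I.I_l_closed[OF \<open>?D f \<in> ?I\<close> r(1)] I.a_closed by simp
  qed
  obtain \<delta>\<^sub>E where dr: "differential_ring (?P Quot ?I) \<delta>\<^sub>E"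
    and dE: "\<And>x. x \<in> carrier ?P \<Longrightarrow> \<delta>\<^sub>E (?I +>\<^bsub>?P\<^esub> x) = ?I +>\<^bsub>?P\<^esub> ?D x"
    using D.quotient_derivation[OF I stable] by blast
  define E where "E = Rupt (carrier K) f"
  have EQ: "E = ?P Quot ?I" unfolding E_def rupture_def ..
  have "field E"
    unfolding E_def using rupture_is_field_iff_pirreducible[OF carrier_is_subfield f(1)] f(2) by simp
  then interpret E: field E .
  interpret dr: differential_ring E \<delta>\<^sub>E using dr unfolding EQ .
  have DE: "differential_field E \<delta>\<^sub>E"
    by unfold_locales (use dr.d_closed dr.d_add dr.d_mult in auto)
  interpret E: differential_field E \<delta>\<^sub>E by (rule DE)
  let ?s = "\<lambda>q. ?I +>\<^bsub>?P\<^esub> q"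
  let ?\<iota> = "?s \<circ> ?C"
  have sh: "?s \<in> ring_hom ?P E" unfolding E_def by (rule rupture_surj_hom(1)[OF carrier_is_subring f(1)])
  have \<iota>: "?\<iota> \<in> ring_hom K E" by (rule ring_hom_trans[OF Chom sh])
  have ext: "differential_extension K \<delta> E \<delta>\<^sub>E ?\<iota>"
  proof (intro differential_extension.intro differential_extension_axioms.intro)
    show "differential_field K \<delta>" by (rule differential_field_axioms)
    show "\<delta>\<^sub>E (?\<iota> x) = ?\<iota> (\<delta> x)" if "x \<in> carrier K" for x
      using that dE[of "?C x"] twisted_derivation_const[OF a that] by simp
  qed (rule DE \<iota>)+
  have "degree f > 0" using pirreducible_degree[OF carrier_is_subfield f(1,2)] by simp
  then have "ring.dimension E (degree f) (?s ` ?C ` carrier K) (carrier E)"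
    unfolding E_def by (rule rupture_dimension[OF carrier_is_subfield f(1)])
  then have fin: "E.finite_dimension (?\<iota> ` carrier K) (carrier E)"
    unfolding image_comp[symmetric] by (rule E.finite_dimensionI)
  have "?s X \<noteq> \<zero>\<^bsub>E\<^esub>"
  proof
    assume "?s X = \<zero>\<^bsub>E\<^esub>"
    then have "?s X = ?I" unfolding EQ FactRing_def by simp
    then have XI: "X \<in> ?I" using I.a_rcos_self[OF XP] by simp
    then have "X [^]\<^bsub>?P\<^esub> n \<in> ?I"
      using n I.I_l_closed[OF XI Xn[of "n - 1"]] UP.nat_pow_Suc[of X "n - 1"] by simp
    moreover have "?C w = p \<ominus>\<^bsub>?P\<^esub> X [^]\<^bsub>?P\<^esub> n"
      unfolding p_def using UP.add_minus_cancel_left[OF Xn[of n] C.hom_closed[OF w(1)]] by simp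
    ultimately have "?C w \<in> ?I"
      using pI I.a_closed I.a_inv_closed by (simp add: UP.minus_eq)
    then show False using no_const w by blast
  qed
  moreover have "\<delta>\<^sub>E (?s X) = ?\<iota> a \<otimes>\<^bsub>E\<^esub> ?s X"
    using dE[OF XP] twisted_derivation_var[OF a] ring_hom_mult[OF sh _ XP, of "?C a"] a by simp
  ultimately have "E.solves (?\<iota> a) (?s X)"
    unfolding E.solves_def using ring_hom_closed[OF sh XP] ring_hom_closed[OF \<iota> a] by simp
  moreover have "carrier E = ?s ` carrier ?P"
    unfolding EQ FactRing_def A_RCOSETS_def' by auto
  moreover have "\<exists>f :: _ \<Rightarrow> 'c. inj_on f (?s ` carrier ?P)"
    by (rule inj_on_image_exists[OF inj_on_subset[OF inj poly_ring_lists]])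
  ultimately show ?thesis using ext fin by metis
qed

section \<open>Fraction fields with a derivation\<close>

text \<open>A fraction is the set of all pairs that represent it. The operations are defined on
  one chosen representative; \<open>fraction_mult\<close>, \<open>fraction_add\<close> and
  \<open>fraction_derivation_fraction\<close> show that any representative gives the same result, and
  everything else is computed from these rules.\<close>

lemma (in ring) add_minus_cancel_common:
  assumes "a \<in> carrier R" "b \<in> carrier R" "w \<in> carrier R"
  shows "(a \<oplus> w) \<ominus> (b \<oplus> w) = a \<ominus> b"
proof -
  have "(a \<oplus> w) \<ominus> (b \<oplus> w) = (a \<ominus> b) \<oplus> (w \<oplus> \<ominus> w)"
    using assms by (simp add: minus_eq minus_add a_ac)
  then show ?thesis using assms by (simp add: r_neg)
qed

context cring
begin

lemmas expand_simps = minus_eq l_distr r_distr l_minus r_minus minus_add m_ac a_ac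

text \<open>The derivatives of two representatives of a fraction agree: a common term is added
  on both sides of the difference so that \<open>eq\<close> and its derivative \<open>eq'\<close> can be substituted,
  after which another common term cancels.\<close>

lemma quotient_rule_consistent:
  assumes cl: "p \<in> carrier R" "q \<in> carrier R" "u \<in> carrier R" "v \<in> carrier R"
      "p' \<in> carrier R" "q' \<in> carrier R" "u' \<in> carrier R" "v' \<in> carrier R"
    and eq: "p \<otimes> v = u \<otimes> q" and eq': "p' \<otimes> v \<oplus> p \<otimes> v' = u' \<otimes> q \<oplus> u \<otimes> q'"
  shows "(u' \<otimes> v \<ominus> u \<otimes> v') \<otimes> (q \<otimes> q) = (p' \<otimes> q \<ominus> p \<otimes> q') \<otimes> (v \<otimes> v)"
proof -
  have "(u' \<otimes> v \<ominus> u \<otimes> v') \<otimes> (q \<otimes> q) = (u' \<otimes> q) \<otimes> (q \<otimes> v) \<ominus> (u \<otimes> q) \<otimes> (v' \<otimes> q)"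
    using cl by (simp add: expand_simps)
  also have "\<dots> = ((u' \<otimes> q) \<otimes> (q \<otimes> v) \<oplus> (u \<otimes> q') \<otimes> (q \<otimes> v))
      \<ominus> ((u \<otimes> q) \<otimes> (v' \<otimes> q) \<oplus> (u \<otimes> q') \<otimes> (q \<otimes> v))"
    using cl by (intro add_minus_cancel_common[symmetric]) auto
  also have "\<dots> = (u' \<otimes> q \<oplus> u \<otimes> q') \<otimes> (q \<otimes> v) \<ominus> ((u \<otimes> q) \<otimes> (v' \<otimes> q) \<oplus> (u \<otimes> q) \<otimes> (q' \<otimes> v))"
    using cl by (simp add: expand_simps)
  also have "\<dots> = (p' \<otimes> v \<oplus> p \<otimes> v') \<otimes> (q \<otimes> v) \<ominus> ((p \<otimes> v) \<otimes> (v' \<otimes> q) \<oplus> (p \<otimes> v) \<otimes> (q' \<otimes> v))"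
    unfolding eq eq' ..
  also have "\<dots> = ((p' \<otimes> v) \<otimes> (q \<otimes> v) \<oplus> (p \<otimes> v') \<otimes> (q \<otimes> v))
      \<ominus> ((p \<otimes> v) \<otimes> (q' \<otimes> v) \<oplus> (p \<otimes> v') \<otimes> (q \<otimes> v))"
    using cl by (simp add: expand_simps)
  also have "\<dots> = (p' \<otimes> v) \<otimes> (q \<otimes> v) \<ominus> (p \<otimes> v) \<otimes> (q' \<otimes> v)"
    using cl by (intro add_minus_cancel_common) auto
  also have "\<dots> = (p' \<otimes> q \<ominus> p \<otimes> q') \<otimes> (v \<otimes> v)"
    using cl by (simp add: expand_simps)
  finally show ?thesis .
qed

text \<open>Sum rule for fractions \<open>p/q\<close> and \<open>u/v\<close>, with denominators cleared; primes denote
  derivatives.\<close>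

lemma quotient_rule_add:
  assumes cl: "p \<in> carrier R" "q \<in> carrier R" "u \<in> carrier R" "v \<in> carrier R"
      "p' \<in> carrier R" "q' \<in> carrier R" "u' \<in> carrier R" "v' \<in> carrier R"
  shows "(((p' \<otimes> v \<oplus> p \<otimes> v') \<oplus> (u' \<otimes> q \<oplus> u \<otimes> q')) \<otimes> (q \<otimes> v) \<ominus> (p \<otimes> v \<oplus> u \<otimes> q) \<otimes> (q' \<otimes> v \<oplus> q \<otimes> v'))
      \<otimes> ((q \<otimes> q) \<otimes> (v \<otimes> v))
    = ((p' \<otimes> q \<ominus> p \<otimes> q') \<otimes> (v \<otimes> v) \<oplus> (u' \<otimes> v \<ominus> u \<otimes> v') \<otimes> (q \<otimes> q)) \<otimes> ((q \<otimes> v) \<otimes> (q \<otimes> v))"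
proof -
  let ?a = "p' \<otimes> v \<otimes> (q \<otimes> v) \<oplus> u' \<otimes> q \<otimes> (q \<otimes> v)"
  let ?b = "p \<otimes> v \<otimes> (q' \<otimes> v) \<oplus> u \<otimes> q \<otimes> (q \<otimes> v')"
  let ?w = "p \<otimes> v' \<otimes> (q \<otimes> v) \<oplus> u \<otimes> q' \<otimes> (q \<otimes> v)"
  have "((p' \<otimes> v \<oplus> p \<otimes> v') \<oplus> (u' \<otimes> q \<oplus> u \<otimes> q')) \<otimes> (q \<otimes> v) \<ominus> (p \<otimes> v \<oplus> u \<otimes> q) \<otimes> (q' \<otimes> v \<oplus> q \<otimes> v')
      = (?a \<oplus> ?w) \<ominus> (?b \<oplus> ?w)"
    using cl by (simp add: expand_simps)
  also have "\<dots> = ?a \<ominus> ?b" using cl by (intro add_minus_cancel_common) auto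
  also have "\<dots> = (p' \<otimes> q \<ominus> p \<otimes> q') \<otimes> (v \<otimes> v) \<oplus> (u' \<otimes> v \<ominus> u \<otimes> v') \<otimes> (q \<otimes> q)"
    using cl by (simp add: expand_simps)
  moreover have "(q \<otimes> q) \<otimes> (v \<otimes> v) = (q \<otimes> v) \<otimes> (q \<otimes> v)" using cl by (simp add: m_ac)
  ultimately show ?thesis by (simp only:)
qed

lemma quotient_rule_mult:
  assumes cl: "p \<in> carrier R" "q \<in> carrier R" "u \<in> carrier R" "v \<in> carrier R"
      "p' \<in> carrier R" "q' \<in> carrier R" "u' \<in> carrier R" "v' \<in> carrier R"
  shows "((p' \<otimes> u \<oplus> p \<otimes> u') \<otimes> (q \<otimes> v) \<ominus> (p \<otimes> u) \<otimes> (q' \<otimes> v \<oplus> q \<otimes> v')) \<otimes> ((q \<otimes> q \<otimes> v) \<otimes> (q \<otimes> (v \<otimes> v)))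
    = (((p' \<otimes> q \<ominus> p \<otimes> q') \<otimes> u) \<otimes> (q \<otimes> (v \<otimes> v)) \<oplus> (p \<otimes> (u' \<otimes> v \<ominus> u \<otimes> v')) \<otimes> (q \<otimes> q \<otimes> v))
      \<otimes> ((q \<otimes> v) \<otimes> (q \<otimes> v))"
  using cl by (simp add: expand_simps)

end

definition fraction :: "('a, 'm) ring_scheme \<Rightarrow> 'a \<Rightarrow> 'a \<Rightarrow> ('a \<times> 'a) set"
  where "fraction R p q = {(u, v). u \<in> carrier R \<and> v \<in> carrier R - {\<zero>\<^bsub>R\<^esub>} \<and> p \<otimes>\<^bsub>R\<^esub> v = u \<otimes>\<^bsub>R\<^esub> q}"

definition numerator :: "('a \<times> 'a) set \<Rightarrow> 'a"
  where "numerator A = fst (SOME x. x \<in> A)"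

definition denominator :: "('a \<times> 'a) set \<Rightarrow> 'a"
  where "denominator A = snd (SOME x. x \<in> A)"

definition fraction_field :: "('a, 'm) ring_scheme \<Rightarrow> ('a \<times> 'a) set ring"
  where "fraction_field R =
    \<lparr>carrier = {fraction R p q | p q. p \<in> carrier R \<and> q \<in> carrier R - {\<zero>\<^bsub>R\<^esub>}},
     monoid.mult = (\<lambda>A B. fraction R (numerator A \<otimes>\<^bsub>R\<^esub> numerator B) (denominator A \<otimes>\<^bsub>R\<^esub> denominator B)),
     monoid.one = fraction R \<one>\<^bsub>R\<^esub> \<one>\<^bsub>R\<^esub>,
     ring.zero = fraction R \<zero>\<^bsub>R\<^esub> \<one>\<^bsub>R\<^esub>,
     ring.add = (\<lambda>A B. fraction R
       (numerator A \<otimes>\<^bsub>R\<^esub> denominator B \<oplus>\<^bsub>R\<^esub> numerator B \<otimes>\<^bsub>R\<^esub> denominator A)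
       (denominator A \<otimes>\<^bsub>R\<^esub> denominator B))\<rparr>"

definition fraction_derivation :: "('a, 'm) ring_scheme \<Rightarrow> ('a \<Rightarrow> 'a) \<Rightarrow> ('a \<times> 'a) set \<Rightarrow> ('a \<times> 'a) set"
  where "fraction_derivation R d A = fraction R
    (d (numerator A) \<otimes>\<^bsub>R\<^esub> denominator A \<ominus>\<^bsub>R\<^esub> numerator A \<otimes>\<^bsub>R\<^esub> d (denominator A))
    (denominator A \<otimes>\<^bsub>R\<^esub> denominator A)"

context domain
begin

lemma nonzero_mult: "q \<in> carrier R - {\<zero>} \<Longrightarrow> v \<in> carrier R - {\<zero>} \<Longrightarrow> q \<otimes> v \<in> carrier R - {\<zero>}"
  using integral by auto

text \<open>Transitivity of the equivalence of pairs is where cancellation, and so the absence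
  of zero divisors, enters.\<close>

lemma fraction_eq_iff:
  assumes "p \<in> carrier R" "q \<in> carrier R - {\<zero>}" "u \<in> carrier R" "v \<in> carrier R - {\<zero>}"
  shows "fraction R p q = fraction R u v \<longleftrightarrow> p \<otimes> v = u \<otimes> q"
proof
  assume "fraction R p q = fraction R u v"
  moreover have "(p, q) \<in> fraction R p q" using assms unfolding fraction_def by auto
  ultimately have "(p, q) \<in> fraction R u v" by simp
  then show "p \<otimes> v = u \<otimes> q" unfolding fraction_def by auto
next
  have sub: "fraction R p q \<subseteq> fraction R u v"
    if c: "p \<in> carrier R" "q \<in> carrier R - {\<zero>}" "u \<in> carrier R" "v \<in> carrier R - {\<zero>}"
      and eq: "p \<otimes> v = u \<otimes> q" for p q u v
  proof
    fix x assume "x \<in> fraction R p q"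
    then obtain s t where x: "x = (s, t)" "s \<in> carrier R" "t \<in> carrier R - {\<zero>}" "p \<otimes> t = s \<otimes> q"
      unfolding fraction_def by auto
    have cl: "p \<in> carrier R" "q \<in> carrier R" "u \<in> carrier R" "v \<in> carrier R" "s \<in> carrier R" "t \<in> carrier R"
      using c x by auto
    have "q \<otimes> (u \<otimes> t) = (u \<otimes> q) \<otimes> t" using cl by algebra
    also have "\<dots> = (p \<otimes> t) \<otimes> v" unfolding eq[symmetric] using cl by algebra
    also have "\<dots> = q \<otimes> (s \<otimes> v)" unfolding x(4) using cl by algebra
    finally have "u \<otimes> t = s \<otimes> v" using m_lcancel[of q "u \<otimes> t" "s \<otimes> v"] cl c(2) by auto
    then show "x \<in> fraction R u v" unfolding fraction_def using x by auto
  qed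
  assume eq: "p \<otimes> v = u \<otimes> q"
  from sub[OF assms eq] sub[OF assms(3,4,1,2) eq[symmetric]]
  show "fraction R p q = fraction R u v" by auto
qed

lemma fraction_representative:
  assumes "p \<in> carrier R" "q \<in> carrier R - {\<zero>}"
  defines "A \<equiv> fraction R p q"
  shows "numerator A \<in> carrier R" "denominator A \<in> carrier R - {\<zero>}"
    "p \<otimes> denominator A = numerator A \<otimes> q"
proof -
  have "(p, q) \<in> A" using assms unfolding A_def fraction_def by auto
  then have "(SOME x. x \<in> A) \<in> A" by (rule someI)
  then have "(numerator A, denominator A) \<in> A" unfolding numerator_def denominator_def by simp
  then show "numerator A \<in> carrier R" "denominator A \<in> carrier R - {\<zero>}"
    "p \<otimes> denominator A = numerator A \<otimes> q"
    unfolding A_def by (auto simp: fraction_def[of R p q])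
qed

lemma fraction_mem:
  "p \<in> carrier R \<Longrightarrow> q \<in> carrier R - {\<zero>} \<Longrightarrow> fraction R p q \<in> carrier (fraction_field R)"
  unfolding fraction_field_def by auto

lemma fraction_cases:
  assumes "A \<in> carrier (fraction_field R)"
  obtains p q where "p \<in> carrier R" "q \<in> carrier R - {\<zero>}" "A = fraction R p q"
  using assms unfolding fraction_field_def by auto

lemma fraction_mult:
  assumes pq: "p \<in> carrier R" "q \<in> carrier R - {\<zero>}" and uv: "u \<in> carrier R" "v \<in> carrier R - {\<zero>}"
  shows "fraction R p q \<otimes>\<^bsub>fraction_field R\<^esub> fraction R u v = fraction R (p \<otimes> u) (q \<otimes> v)"
proof -
  let ?A = "fraction R p q" and ?B = "fraction R u v"
  let ?a = "numerator ?A" and ?b = "denominator ?A" and ?c = "numerator ?B" and ?e = "denominator ?B"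
  note A = fraction_representative[OF pq] and B = fraction_representative[OF uv]
  have cl: "p \<in> carrier R" "q \<in> carrier R" "u \<in> carrier R" "v \<in> carrier R" "?a \<in> carrier R"
    "?b \<in> carrier R" "?c \<in> carrier R" "?e \<in> carrier R" using A B pq uv by auto
  have "(?a \<otimes> ?c) \<otimes> (q \<otimes> v) = (?a \<otimes> q) \<otimes> (?c \<otimes> v)" using cl by (simp add: m_ac)
  also have "\<dots> = (p \<otimes> ?b) \<otimes> (u \<otimes> ?e)" unfolding A(3) B(3) ..
  also have "\<dots> = (p \<otimes> u) \<otimes> (?b \<otimes> ?e)" using cl by (simp add: m_ac)
  finally have "fraction R (?a \<otimes> ?c) (?b \<otimes> ?e) = fraction R (p \<otimes> u) (q \<otimes> v)"
    using cl nonzero_mult[OF A(2) B(2)] nonzero_mult[OF pq(2) uv(2)] by (subst fraction_eq_iff) auto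
  then show ?thesis unfolding fraction_field_def by simp
qed

lemma fraction_add:
  assumes pq: "p \<in> carrier R" "q \<in> carrier R - {\<zero>}" and uv: "u \<in> carrier R" "v \<in> carrier R - {\<zero>}"
  shows "fraction R p q \<oplus>\<^bsub>fraction_field R\<^esub> fraction R u v = fraction R (p \<otimes> v \<oplus> u \<otimes> q) (q \<otimes> v)"
proof -
  let ?A = "fraction R p q" and ?B = "fraction R u v"
  let ?a = "numerator ?A" and ?b = "denominator ?A" and ?c = "numerator ?B" and ?e = "denominator ?B"
  note A = fraction_representative[OF pq] and B = fraction_representative[OF uv]
  have cl: "p \<in> carrier R" "q \<in> carrier R" "u \<in> carrier R" "v \<in> carrier R" "?a \<in> carrier R"
    "?b \<in> carrier R" "?c \<in> carrier R" "?e \<in> carrier R" using A B pq uv by auto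
  have "(?a \<otimes> ?e \<oplus> ?c \<otimes> ?b) \<otimes> (q \<otimes> v) = (?a \<otimes> q) \<otimes> (?e \<otimes> v) \<oplus> (?c \<otimes> v) \<otimes> (?b \<otimes> q)"
    using cl by (simp add: expand_simps)
  also have "\<dots> = (p \<otimes> ?b) \<otimes> (?e \<otimes> v) \<oplus> (u \<otimes> ?e) \<otimes> (?b \<otimes> q)" unfolding A(3) B(3) ..
  also have "\<dots> = (p \<otimes> v \<oplus> u \<otimes> q) \<otimes> (?b \<otimes> ?e)" using cl by (simp add: expand_simps)
  finally have "fraction R (?a \<otimes> ?e \<oplus> ?c \<otimes> ?b) (?b \<otimes> ?e) = fraction R (p \<otimes> v \<oplus> u \<otimes> q) (q \<otimes> v)"
    using cl nonzero_mult[OF A(2) B(2)] nonzero_mult[OF pq(2) uv(2)] by (subst fraction_eq_iff) auto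
  then show ?thesis unfolding fraction_field_def by simp
qed

lemma fraction_field_one: "\<one>\<^bsub>fraction_field R\<^esub> = fraction R \<one> \<one>"
  and fraction_field_zero: "\<zero>\<^bsub>fraction_field R\<^esub> = fraction R \<zero> \<one>"
  unfolding fraction_field_def by auto

lemma fraction_field_field: "field (fraction_field R)"
proof -
  let ?F = "fraction_field R"
  have o: "\<one> \<in> carrier R - {\<zero>}" by auto
  have ab: "abelian_group ?F"
  proof (rule abelian_groupI)
    fix A B assume "A \<in> carrier ?F" "B \<in> carrier ?F"
    then obtain p q u v where A: "p \<in> carrier R" "q \<in> carrier R - {\<zero>}" "A = fraction R p q"
      and B: "u \<in> carrier R" "v \<in> carrier R - {\<zero>}" "B = fraction R u v"
      using fraction_cases by metis
    note qv = nonzero_mult[OF A(2) B(2)] nonzero_mult[OF B(2) A(2)]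
    show "A \<oplus>\<^bsub>?F\<^esub> B \<in> carrier ?F"
      unfolding A(3) B(3) fraction_add[OF A(1,2) B(1,2)] using A B qv by (intro fraction_mem) auto
    show "A \<oplus>\<^bsub>?F\<^esub> B = B \<oplus>\<^bsub>?F\<^esub> A"
      unfolding A(3) B(3) fraction_add[OF A(1,2) B(1,2)] fraction_add[OF B(1,2) A(1,2)]
      using A B by (simp add: m_ac a_ac)
    fix C assume "C \<in> carrier ?F"
    then obtain s t where C: "s \<in> carrier R" "t \<in> carrier R - {\<zero>}" "C = fraction R s t"
      using fraction_cases by metis
    note vt = nonzero_mult[OF B(2) C(2)]
    have e: "p \<otimes> v \<oplus> u \<otimes> q \<in> carrier R" "u \<otimes> t \<oplus> s \<otimes> v \<in> carrier R" using A B C by auto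
    show "A \<oplus>\<^bsub>?F\<^esub> B \<oplus>\<^bsub>?F\<^esub> C = A \<oplus>\<^bsub>?F\<^esub> (B \<oplus>\<^bsub>?F\<^esub> C)"
      unfolding A(3) B(3) C(3) fraction_add[OF A(1,2) B(1,2)] fraction_add[OF B(1,2) C(1,2)]
        fraction_add[OF e(1) qv(1) C(1,2)] fraction_add[OF A(1,2) e(2) vt]
      using A B C by (simp add: m_ac a_ac l_distr r_distr)
  next
    show "\<zero>\<^bsub>?F\<^esub> \<in> carrier ?F" unfolding fraction_field_zero by (intro fraction_mem) auto
    fix A assume "A \<in> carrier ?F"
    then obtain p q where A: "p \<in> carrier R" "q \<in> carrier R - {\<zero>}" "A = fraction R p q"
      using fraction_cases by metis
    show "\<zero>\<^bsub>?F\<^esub> \<oplus>\<^bsub>?F\<^esub> A = A"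
      unfolding fraction_field_zero A(3) fraction_add[OF zero_closed o A(1,2)] using A by simp
    have "fraction R (\<ominus> p) q \<oplus>\<^bsub>?F\<^esub> A = \<zero>\<^bsub>?F\<^esub>"
      unfolding A(3) fraction_field_zero
      using fraction_add[OF a_inv_closed[OF A(1)] A(2) A(1,2)] nonzero_mult[OF A(2) A(2)] A
      by (simp add: fraction_eq_iff l_minus l_neg)
    then show "\<exists>B\<in>carrier ?F. B \<oplus>\<^bsub>?F\<^esub> A = \<zero>\<^bsub>?F\<^esub>"
      using fraction_mem[OF a_inv_closed[OF A(1)] A(2)] by blast
  qed
  have mo: "comm_monoid ?F"
  proof (rule comm_monoidI)
    show "\<one>\<^bsub>?F\<^esub> \<in> carrier ?F" unfolding fraction_field_one by (intro fraction_mem) auto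
    fix A assume "A \<in> carrier ?F"
    then obtain p q where A: "p \<in> carrier R" "q \<in> carrier R - {\<zero>}" "A = fraction R p q"
      using fraction_cases by metis
    show "\<one>\<^bsub>?F\<^esub> \<otimes>\<^bsub>?F\<^esub> A = A"
      unfolding fraction_field_one A(3) fraction_mult[OF one_closed o A(1,2)] using A by simp
    fix B assume "B \<in> carrier ?F"
    then obtain u v where B: "u \<in> carrier R" "v \<in> carrier R - {\<zero>}" "B = fraction R u v"
      using fraction_cases by metis
    note qv = nonzero_mult[OF A(2) B(2)]
    show "A \<otimes>\<^bsub>?F\<^esub> B \<in> carrier ?F"
      unfolding A(3) B(3) fraction_mult[OF A(1,2) B(1,2)] using A B qv by (intro fraction_mem) auto
    show "A \<otimes>\<^bsub>?F\<^esub> B = B \<otimes>\<^bsub>?F\<^esub> A"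
      unfolding A(3) B(3) fraction_mult[OF A(1,2) B(1,2)] fraction_mult[OF B(1,2) A(1,2)]
      using A B by (simp add: m_ac)
    fix C assume "C \<in> carrier ?F"
    then obtain s t where C: "s \<in> carrier R" "t \<in> carrier R - {\<zero>}" "C = fraction R s t"
      using fraction_cases by metis
    note vt = nonzero_mult[OF B(2) C(2)]
    have e: "p \<otimes> u \<in> carrier R" "u \<otimes> s \<in> carrier R" using A B C by auto
    show "A \<otimes>\<^bsub>?F\<^esub> B \<otimes>\<^bsub>?F\<^esub> C = A \<otimes>\<^bsub>?F\<^esub> (B \<otimes>\<^bsub>?F\<^esub> C)"
      unfolding A(3) B(3) C(3) fraction_mult[OF A(1,2) B(1,2)] fraction_mult[OF B(1,2) C(1,2)]
        fraction_mult[OF e(1) qv C(1,2)] fraction_mult[OF A(1,2) e(2) vt]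
      using A B C by (simp add: m_ac)
  qed
  have "cring ?F"
  proof (rule cringI[OF ab mo])
    fix A B C assume "A \<in> carrier ?F" "B \<in> carrier ?F" and C': "C \<in> carrier ?F"
    then obtain p q u v where A: "p \<in> carrier R" "q \<in> carrier R - {\<zero>}" "A = fraction R p q"
      and B: "u \<in> carrier R" "v \<in> carrier R - {\<zero>}" "B = fraction R u v"
      using fraction_cases by metis
    from C' obtain s t where C: "s \<in> carrier R" "t \<in> carrier R - {\<zero>}" "C = fraction R s t"
      by (rule fraction_cases)
    have e: "p \<otimes> v \<oplus> u \<otimes> q \<in> carrier R" "p \<otimes> s \<in> carrier R" "u \<otimes> s \<in> carrier R" using A B C by auto
    note n = nonzero_mult[OF A(2) B(2)] nonzero_mult[OF A(2) C(2)] nonzero_mult[OF B(2) C(2)]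
    have cl: "p \<in> carrier R" "q \<in> carrier R" "u \<in> carrier R" "v \<in> carrier R" "s \<in> carrier R" "t \<in> carrier R"
      using A B C by auto
    have eq: "((p \<otimes> v \<oplus> u \<otimes> q) \<otimes> s) \<otimes> ((q \<otimes> t) \<otimes> (v \<otimes> t))
        = ((p \<otimes> s) \<otimes> (v \<otimes> t) \<oplus> (u \<otimes> s) \<otimes> (q \<otimes> t)) \<otimes> ((q \<otimes> v) \<otimes> t)"
      using cl by (simp add: expand_simps)
    show "(A \<oplus>\<^bsub>?F\<^esub> B) \<otimes>\<^bsub>?F\<^esub> C = A \<otimes>\<^bsub>?F\<^esub> C \<oplus>\<^bsub>?F\<^esub> B \<otimes>\<^bsub>?F\<^esub> C"
      unfolding A(3) B(3) C(3) fraction_add[OF A(1,2) B(1,2)] fraction_mult[OF A(1,2) C(1,2)]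
        fraction_mult[OF B(1,2) C(1,2)] fraction_mult[OF e(1) n(1) C(1,2)] fraction_add[OF e(2) n(2) e(3) n(3)]
      by (rule fraction_eq_iff[THEN iffD2, OF _ nonzero_mult[OF n(1) C(2)] _ nonzero_mult[OF n(2,3)] eq])
        (use cl in auto)
  qed
  then show ?thesis
  proof (rule cring.cring_fieldI2)
    show "\<zero>\<^bsub>?F\<^esub> \<noteq> \<one>\<^bsub>?F\<^esub>"
      unfolding fraction_field_zero fraction_field_one using fraction_eq_iff[OF zero_closed o one_closed o] by simp
    fix A assume "A \<in> carrier ?F" "A \<noteq> \<zero>\<^bsub>?F\<^esub>"
    then obtain p q where A: "p \<in> carrier R" "q \<in> carrier R - {\<zero>}" "A = fraction R p q"
      using fraction_cases by metis
    have "p \<noteq> \<zero>"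
      using \<open>A \<noteq> \<zero>\<^bsub>?F\<^esub>\<close> fraction_eq_iff[OF A(1,2) zero_closed o] A unfolding fraction_field_zero by auto
    then have p: "p \<in> carrier R - {\<zero>}" using A by auto
    have qc: "q \<in> carrier R" using A by auto
    have "A \<otimes>\<^bsub>?F\<^esub> fraction R q p = \<one>\<^bsub>?F\<^esub>"
      unfolding A(3) fraction_mult[OF A(1,2) qc p] fraction_field_one
      using fraction_eq_iff[OF _ nonzero_mult[OF A(2) p] one_closed o, of "p \<otimes> q"] A qc by (simp add: m_comm)
    then show "\<exists>B\<in>carrier ?F. A \<otimes>\<^bsub>?F\<^esub> B = \<one>\<^bsub>?F\<^esub>" using fraction_mem[OF qc p] by blast
  qed
qed

lemma fraction_embedding: "(\<lambda>p. fraction R p \<one>) \<in> ring_hom R (fraction_field R)"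
proof (rule ring_hom_memI)
  have o: "\<one> \<in> carrier R - {\<zero>}" by auto
  fix p q assume p: "p \<in> carrier R" and q: "q \<in> carrier R"
  show "fraction R p \<one> \<in> carrier (fraction_field R)" by (rule fraction_mem[OF p o])
  show "fraction R (p \<otimes> q) \<one> = fraction R p \<one> \<otimes>\<^bsub>fraction_field R\<^esub> fraction R q \<one>"
    using fraction_mult[OF p o q o] by simp
  show "fraction R (p \<oplus> q) \<one> = fraction R p \<one> \<oplus>\<^bsub>fraction_field R\<^esub> fraction R q \<one>"
    using fraction_add[OF p o q o] p q by simp
qed (simp add: fraction_field_one)

lemma fraction_as_quotient:
  assumes p: "p \<in> carrier R" and q: "q \<in> carrier R - {\<zero>}"
  shows "fraction R p q = fraction R p \<one> \<otimes>\<^bsub>fraction_field R\<^esub> inv\<^bsub>fraction_field R\<^esub> fraction R q \<one>"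
proof -
  interpret F: field "fraction_field R" by (rule fraction_field_field)
  have o: "\<one> \<in> carrier R - {\<zero>}" by auto
  have qc: "q \<in> carrier R" using q by simp
  have "fraction R q \<one> \<otimes>\<^bsub>fraction_field R\<^esub> fraction R \<one> q = \<one>\<^bsub>fraction_field R\<^esub>"
    unfolding fraction_mult[OF qc o one_closed q] fraction_field_one
    using fraction_eq_iff[OF qc q one_closed o] qc by simp
  then have "inv\<^bsub>fraction_field R\<^esub> fraction R q \<one> = fraction R \<one> q"
    by (intro F.comm_inv_char fraction_mem o q qc one_closed)
  then show ?thesis using fraction_mult[OF p o one_closed q] p qc by simp
qed

end

lemma (in differential_ring) fraction_derivation_fraction:
  assumes "domain R" and pq: "p \<in> carrier R" "q \<in> carrier R - {\<zero>}"
  shows "fraction_derivation R d (fraction R p q) = fraction R (d p \<otimes> q \<ominus> p \<otimes> d q) (q \<otimes> q)"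
proof -
  interpret domain R by fact
  let ?A = "fraction R p q"
  let ?u = "numerator ?A" and ?v = "denominator ?A"
  note A = fraction_representative[OF pq]
  have qc: "q \<in> carrier R" "?v \<in> carrier R" using pq A by auto
  note cl = pq(1) A(1) qc d_closed[OF pq(1)] d_closed[OF A(1)] d_closed[OF qc(1)] d_closed[OF qc(2)]
  have d_eq: "d p \<otimes> ?v \<oplus> p \<otimes> d ?v = d ?u \<otimes> q \<oplus> ?u \<otimes> d q"
    using arg_cong[OF A(3), of d] d_mult[OF pq(1) qc(2)] d_mult[OF A(1) qc(1)] by (simp only:)
  have eq: "(d ?u \<otimes> ?v \<ominus> ?u \<otimes> d ?v) \<otimes> (q \<otimes> q) = (d p \<otimes> q \<ominus> p \<otimes> d q) \<otimes> (?v \<otimes> ?v)"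
    by (rule quotient_rule_consistent[OF _ _ _ _ _ _ _ _ A(3) d_eq]) (use cl in auto)
  show ?thesis unfolding fraction_derivation_def
    by (rule fraction_eq_iff[THEN iffD2, OF _ nonzero_mult[OF A(2) A(2)] _ nonzero_mult[OF pq(2) pq(2)] eq])
      (use cl in auto)
qed

lemma (in differential_ring) fraction_field_differential:
  assumes "domain R"
  shows "differential_field (fraction_field R) (fraction_derivation R d)"
    "p \<in> carrier R \<Longrightarrow> fraction_derivation R d (fraction R p \<one>) = fraction R (d p) \<one>"
proof -
  interpret domain R by fact
  let ?F = "fraction_field R" and ?d = "fraction_derivation R d"
  interpret F: field ?F by (rule fraction_field_field)
  note der = fraction_derivation_fraction[OF assms]
  show "?d (fraction R p \<one>) = fraction R (d p) \<one>" if "p \<in> carrier R" for p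
    using der[OF that] that d_closed[OF that] by (simp add: minus_eq)
  show "differential_field ?F ?d"
  proof unfold_locales
    fix A B assume "A \<in> carrier ?F" "B \<in> carrier ?F"
    then obtain p q u v where A: "p \<in> carrier R" "q \<in> carrier R - {\<zero>}" "A = fraction R p q"
      and B: "u \<in> carrier R" "v \<in> carrier R - {\<zero>}" "B = fraction R u v"
      using fraction_cases by metis
    have qv: "q \<in> carrier R" "v \<in> carrier R" using A B by auto
    note cl = A(1) B(1) qv d_closed[OF A(1)] d_closed[OF B(1)] d_closed[OF qv(1)] d_closed[OF qv(2)]
    note n = nonzero_mult[OF A(2) B(2)] nonzero_mult[OF A(2) A(2)] nonzero_mult[OF B(2) B(2)]
    have c: "p \<otimes> v \<oplus> u \<otimes> q \<in> carrier R" "p \<otimes> u \<in> carrier R"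
      "d p \<otimes> q \<ominus> p \<otimes> d q \<in> carrier R" "d u \<otimes> v \<ominus> u \<otimes> d v \<in> carrier R" using cl by auto
    show "?d A \<in> carrier ?F"
      unfolding A(3) der[OF A(1,2)] by (rule fraction_mem[OF c(3) n(2)])
    have eq: "(d (p \<otimes> v \<oplus> u \<otimes> q) \<otimes> (q \<otimes> v) \<ominus> (p \<otimes> v \<oplus> u \<otimes> q) \<otimes> d (q \<otimes> v)) \<otimes> ((q \<otimes> q) \<otimes> (v \<otimes> v))
        = ((d p \<otimes> q \<ominus> p \<otimes> d q) \<otimes> (v \<otimes> v) \<oplus> (d u \<otimes> v \<ominus> u \<otimes> d v) \<otimes> (q \<otimes> q)) \<otimes> ((q \<otimes> v) \<otimes> (q \<otimes> v))"
    proof -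
      have e: "d (p \<otimes> v \<oplus> u \<otimes> q) = (d p \<otimes> v \<oplus> p \<otimes> d v) \<oplus> (d u \<otimes> q \<oplus> u \<otimes> d q)"
        "d (q \<otimes> v) = d q \<otimes> v \<oplus> q \<otimes> d v" using cl(1-4) by (simp_all add: d_add d_mult)
      show ?thesis unfolding e by (rule quotient_rule_add) (use cl in auto)
    qed
    show "?d (A \<oplus>\<^bsub>?F\<^esub> B) = ?d A \<oplus>\<^bsub>?F\<^esub> ?d B"
      unfolding A(3) B(3) fraction_add[OF A(1,2) B(1,2)] der[OF A(1,2)] der[OF B(1,2)] der[OF c(1) n(1)]
        fraction_add[OF c(3) n(2) c(4) n(3)]
      by (rule fraction_eq_iff[THEN iffD2, OF _ nonzero_mult[OF n(1) n(1)] _ nonzero_mult[OF n(2,3)] eq])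
        (use cl d_closed in auto)
    note c1 = m_closed[OF c(3) B(1)] and c2 = m_closed[OF A(1) c(4)]
      and n1 = nonzero_mult[OF n(2) B(2)] and n2 = nonzero_mult[OF A(2) n(3)]
    have eq: "(d (p \<otimes> u) \<otimes> (q \<otimes> v) \<ominus> (p \<otimes> u) \<otimes> d (q \<otimes> v)) \<otimes> ((q \<otimes> q \<otimes> v) \<otimes> (q \<otimes> (v \<otimes> v)))
        = (((d p \<otimes> q \<ominus> p \<otimes> d q) \<otimes> u) \<otimes> (q \<otimes> (v \<otimes> v)) \<oplus> (p \<otimes> (d u \<otimes> v \<ominus> u \<otimes> d v)) \<otimes> (q \<otimes> q \<otimes> v))
          \<otimes> ((q \<otimes> v) \<otimes> (q \<otimes> v))"
    proof -
      have e: "d (p \<otimes> u) = d p \<otimes> u \<oplus> p \<otimes> d u" "d (q \<otimes> v) = d q \<otimes> v \<oplus> q \<otimes> d v"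
        using cl(1-4) by (simp_all add: d_mult)
      show ?thesis unfolding e by (rule quotient_rule_mult) (use cl in auto)
    qed
    show "?d (A \<otimes>\<^bsub>?F\<^esub> B) = ?d A \<otimes>\<^bsub>?F\<^esub> B \<oplus>\<^bsub>?F\<^esub> A \<otimes>\<^bsub>?F\<^esub> ?d B"
      unfolding A(3) B(3) fraction_mult[OF A(1,2) B(1,2)] der[OF A(1,2)] der[OF B(1,2)] der[OF c(2) n(1)]
        fraction_mult[OF c(3) n(2) B(1,2)] fraction_mult[OF A(1,2) c(4) n(3)] fraction_add[OF c1 n1 c2 n2]
      by (rule fraction_eq_iff[THEN iffD2, OF _ nonzero_mult[OF n(1) n(1)] _ nonzero_mult[OF n1 n2] eq])
        (use cl d_closed in auto)
  qed
qed

section \<open>Towers of differential extensions\<close>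

text \<open>Stated through subfields, generation composes along towers without any description
  of the elements of \<open>E\<close>.\<close>

definition generated_by :: "('a, 'm) ring_scheme \<Rightarrow> 'a set \<Rightarrow> 'a set \<Rightarrow> bool"
  where "generated_by E k Y \<longleftrightarrow> (\<forall>F. subfield F E \<longrightarrow> k \<union> Y \<subseteq> F \<longrightarrow> carrier E \<subseteq> F)"

text \<open>The field is \<open>K(X)\<close> with \<open>\<delta> X = a X\<close>. A subfield that contains \<open>K\<close> and \<open>X\<close> contains
  all polynomials, by their expansion in powers of \<open>X\<close>, and so all fractions.\<close>

lemma (in differential_field) adjoin_transcendental:
  fixes code :: "_ \<Rightarrow> 'c"
  assumes inj: "inj_on code (lists (carrier K) \<times> lists (carrier K))" and a: "a \<in> carrier K"
  shows "\<exists>(E :: ('a list \<times> 'a list) set ring) \<delta>\<^sub>E \<iota> y (f :: _ \<Rightarrow> 'c). inj_on f (carrier E) \<and>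
    differential_extension K \<delta> E \<delta>\<^sub>E \<iota> \<and> differential_field.solves E \<delta>\<^sub>E (\<iota> a) y \<and>
    generated_by E (\<iota> ` carrier K) {y}"
proof -
  let ?P = "poly_ring K" and ?C = poly_of_const
  interpret UP: domain ?P by (rule univ_poly_is_domain[OF carrier_is_subring])
  interpret D: differential_ring ?P "twisted_derivation a"
    by (rule twisted_derivation_differential_ring[OF a])
  note XP = var_closed(1)[OF carrier_is_subring]
  define E where "E = fraction_field ?P"
  define \<delta>\<^sub>E where "\<delta>\<^sub>E = fraction_derivation ?P (twisted_derivation a)"
  let ?s = "\<lambda>p. fraction ?P p \<one>\<^bsub>?P\<^esub>"
  let ?\<iota> = "?s \<circ> ?C"
  note DD = D.fraction_field_differential[OF UP.domain_axioms, folded E_def \<delta>\<^sub>E_def]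
  interpret E: differential_field E \<delta>\<^sub>E by (rule DD(1))
  have Chom: "?C \<in> ring_hom K ?P" using canonical_embedding_is_hom[OF carrier_is_subring] by simp
  have sh: "?s \<in> ring_hom ?P E" unfolding E_def by (rule UP.fraction_embedding)
  have \<iota>: "?\<iota> \<in> ring_hom K E" by (rule ring_hom_trans[OF Chom sh])
  have ext: "differential_extension K \<delta> E \<delta>\<^sub>E ?\<iota>"
  proof (intro differential_extension.intro differential_extension_axioms.intro)
    show "differential_field K \<delta>" by (rule differential_field_axioms)
    show "\<delta>\<^sub>E (?\<iota> x) = ?\<iota> (\<delta> x)" if "x \<in> carrier K" for x
      using that DD(2)[of "?C x"] twisted_derivation_const[OF a that] poly_of_const_closed by simp
  qed (rule DD(1) \<iota>)+
  have "?s X \<noteq> \<zero>\<^bsub>E\<^esub>"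
  proof
    assume "?s X = \<zero>\<^bsub>E\<^esub>"
    then have "X \<otimes>\<^bsub>?P\<^esub> \<one>\<^bsub>?P\<^esub> = \<zero>\<^bsub>?P\<^esub> \<otimes>\<^bsub>?P\<^esub> \<one>\<^bsub>?P\<^esub>"
      unfolding E_def UP.fraction_field_zero
      using UP.fraction_eq_iff[OF XP _ UP.zero_closed] by simp
    then have "X = \<zero>\<^bsub>?P\<^esub>" using XP by simp
    then show False by (simp add: univ_poly_zero var_def)
  qed
  moreover have "\<delta>\<^sub>E (?s X) = ?\<iota> a \<otimes>\<^bsub>E\<^esub> ?s X"
    using DD(2)[OF XP] twisted_derivation_var[OF a] ring_hom_mult[OF sh poly_of_const_closed[OF a] XP]
    by simp
  ultimately have sol: "E.solves (?\<iota> a) (?s X)"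
    unfolding E.solves_def using ring_hom_closed[OF sh XP] ring_hom_closed[OF \<iota> a] by simp
  have gen: "generated_by E (?\<iota> ` carrier K) {?s X}"
    unfolding generated_by_def
  proof (intro allI impI)
    fix F assume F: "subfield F E" and sub: "?\<iota> ` carrier K \<union> {?s X} \<subseteq> F"
    note Fr = subfieldE(1)[OF F]
    have s: "?s p \<in> F" if p: "p \<in> carrier ?P" for p
    proof -
      have pc: "set p \<subseteq> carrier K" using p poly_ring_lists by auto
      have pow: "?s (X [^]\<^bsub>?P\<^esub> n) \<in> F" for n :: nat
      proof (induction n)
        case 0
        then show ?case using ring_hom_one[OF sh] subringE(3)[OF Fr] by simp
      next
        case (Suc n)
        then show ?case
          using ring_hom_mult[OF sh UP.nat_pow_closed[OF XP, of n] XP] sub subringE(6)[OF Fr] by simp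
      qed
      have "UP.eval qs X \<in> carrier ?P \<and> ?s (UP.eval qs X) \<in> F"
        if "set qs \<subseteq> ?C ` carrier K" for qs
        using that
      proof (induction qs)
        case Nil
        have "?s \<zero>\<^bsub>?P\<^esub> = \<zero>\<^bsub>E\<^esub>" unfolding E_def UP.fraction_field_zero ..
        then show ?case using subringE(2)[OF Fr] by simp
      next
        case (Cons q qs)
        then have q: "q \<in> carrier ?P" "?s q \<in> F"
          using poly_of_const_closed sub by auto
        have m: "q \<otimes>\<^bsub>?P\<^esub> X [^]\<^bsub>?P\<^esub> length qs \<in> carrier ?P" using q XP by simp
        have "?s (q \<otimes>\<^bsub>?P\<^esub> X [^]\<^bsub>?P\<^esub> length qs) \<in> F"
          using ring_hom_mult[OF sh q(1) UP.nat_pow_closed[OF XP, of "length qs"]] q(2) pow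
            subringE(6)[OF Fr] by simp
        then have "?s (q \<otimes>\<^bsub>?P\<^esub> X [^]\<^bsub>?P\<^esub> length qs \<oplus>\<^bsub>?P\<^esub> UP.eval qs X) \<in> F"
          using ring_hom_add[OF sh m, of "UP.eval qs X"] Cons subringE(7)[OF Fr] by simp
        then show ?case using m Cons by simp
      qed
      from this[of "map ?C p"] have "?s (UP.eval (map ?C p) X) \<in> F" using pc by auto
      then show ?thesis using eval_rewrite[OF carrier_is_subring p] by simp
    qed
    show "carrier E \<subseteq> F"
    proof
      fix A assume "A \<in> carrier E"
      then obtain p q where pq: "p \<in> carrier ?P" "q \<in> carrier ?P - {\<zero>\<^bsub>?P\<^esub>}" "A = fraction ?P p q"
        unfolding E_def by (rule UP.fraction_cases)
      have qc: "q \<in> carrier ?P" "q \<noteq> \<zero>\<^bsub>?P\<^esub>" using pq by auto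
      have "\<one>\<^bsub>?P\<^esub> \<in> carrier ?P - {\<zero>\<^bsub>?P\<^esub>}" by auto
      then have "?s q \<noteq> \<zero>\<^bsub>E\<^esub>"
        unfolding E_def UP.fraction_field_zero
        using UP.fraction_eq_iff[OF qc(1) _ UP.zero_closed] qc by simp
      then have "inv\<^bsub>E\<^esub> (?s q) \<in> F"
        using E.subfield_m_inv(1)[OF F, of "?s q"] s[OF qc(1)] by auto
      then show "A \<in> F"
        unfolding pq(3) UP.fraction_as_quotient[OF pq(1,2)] E_def[symmetric]
        using s[OF pq(1)] subringE(6)[OF Fr] by blast
    qed
  qed
  have "carrier E = (\<lambda>(p, q). fraction ?P p q) ` (carrier ?P \<times> (carrier ?P - {\<zero>\<^bsub>?P\<^esub>}))"
    unfolding E_def fraction_field_def by auto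
  moreover have "carrier ?P \<times> (carrier ?P - {\<zero>\<^bsub>?P\<^esub>}) \<subseteq> lists (carrier K) \<times> lists (carrier K)"
    using poly_ring_lists by blast
  from inj_on_image_exists[OF inj_on_subset[OF inj this]]
  have "\<exists>f :: _ \<Rightarrow> 'c. inj_on f ((\<lambda>(p, q). fraction ?P p q) ` (carrier ?P \<times> (carrier ?P - {\<zero>\<^bsub>?P\<^esub>})))" .
  ultimately show ?thesis using ext sol gen by metis
qed

text \<open>Fold a pairing function of \<open>A\<close> over the list. Lists of different lengths may collide
  under this, so the length is encoded as well.\<close>

lemma infinite_lists_encoding:
  assumes "infinite A"
  shows "\<exists>f :: 'a list \<times> 'a list \<Rightarrow> 'a. inj_on f (lists A \<times> lists A)"
    "\<exists>f :: 'a list \<Rightarrow> 'a. inj_on f (lists A)"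
proof -
  have "|A \<times> A| \<le>o |A|"
    using card_of_Times_same_infinite[OF assms] ordIso_iff_ordLeq by blast
  then obtain pair where pair: "inj_on pair (A \<times> A)" "pair ` (A \<times> A) \<subseteq> A"
    unfolding card_of_ordLeq[symmetric] by blast
  obtain num :: "nat \<Rightarrow> 'a" where num: "inj num" "range num \<subseteq> A"
    using infinite_countable_subset[OF assms] by blast
  define enc where "enc = rec_list (num 0) (\<lambda>x _ e. pair (x, e))"
  have enc_simps: "enc [] = num 0" "enc (x # xs) = pair (x, enc xs)" for x xs
    unfolding enc_def by simp_all
  have encA: "enc xs \<in> A" if "xs \<in> lists A" for xs
    using that
  proof (induction xs)
    case Nil
    then show ?case using num enc_simps by auto
  next
    case (Cons x xs)
    then show ?case using pair(2) unfolding enc_simps by auto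
  qed
  have enc_inj: "xs = ys" if "xs \<in> lists A" "ys \<in> lists A" "length xs = length ys" "enc xs = enc ys" for xs ys
    using that(3,1,2,4)
  proof (induction xs ys rule: list_induct2)
    case (Cons x xs y ys)
    then have "(x, enc xs) = (y, enc ys)"
      using inj_onD[OF pair(1), of "(x, enc xs)" "(y, enc ys)"] encA unfolding enc_simps by auto
    then show ?case using Cons by auto
  qed simp
  define code where "code xs = pair (num (length xs), enc xs)" for xs
  have codeA: "code xs \<in> A" if "xs \<in> lists A" for xs
    unfolding code_def using pair(2) encA[OF that] num(2) by blast
  have code_inj: "inj_on code (lists A)"
  proof (rule inj_onI)
    fix xs ys assume xy: "xs \<in> lists A" "ys \<in> lists A" "code xs = code ys"
    have "(num (length xs), enc xs) = (num (length ys), enc ys)"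
      using inj_onD[OF pair(1) xy(3)[unfolded code_def]] encA xy num(2) by blast
    then show "xs = ys" using enc_inj xy injD[OF num(1)] by auto
  qed
  then show "\<exists>f :: 'a list \<Rightarrow> 'a. inj_on f (lists A)" by blast
  have "inj_on (\<lambda>(xs, ys). pair (code xs, code ys)) (lists A \<times> lists A)"
  proof (rule inj_onI)
    fix x y assume xy: "x \<in> lists A \<times> lists A" "y \<in> lists A \<times> lists A"
      and eq: "(\<lambda>(xs, ys). pair (code xs, code ys)) x = (\<lambda>(xs, ys). pair (code xs, code ys)) y"
    obtain xs ys us vs where s: "x = (xs, ys)" "y = (us, vs)" by (metis surj_pair)
    then have l: "xs \<in> lists A" "ys \<in> lists A" "us \<in> lists A" "vs \<in> lists A" using xy by blast+
    have "pair (code xs, code ys) = pair (code us, code vs)" using eq s by simp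
    then have "(code xs, code ys) = (code us, code vs)"
      by (rule inj_onD[OF pair(1)]) (use codeA l in blast)+
    then show "x = y" using l s inj_onD[OF code_inj] by blast
  qed
  then show "\<exists>f :: 'a list \<times> 'a list \<Rightarrow> 'a. inj_on f (lists A \<times> lists A)" by blast
qed

text \<open>The integer multiples of 1 are distinct.\<close>

lemma char_zero_infinite:
  assumes "field K" "char_zero K" shows "infinite (carrier K)"
proof -
  interpret field K by fact
  have "inj (\<lambda>n::nat. add_pow K (int n) \<one>\<^bsub>K\<^esub>)"
  proof (rule injI, rule ccontr)
    fix m n :: nat assume eq: "add_pow K (int m) \<one>\<^bsub>K\<^esub> = add_pow K (int n) \<one>\<^bsub>K\<^esub>" and "m \<noteq> n"
    have "add_pow K (int m - int n) \<one>\<^bsub>K\<^esub> \<oplus>\<^bsub>K\<^esub> add_pow K (int n) \<one>\<^bsub>K\<^esub> = add_pow K (int m) \<one>\<^bsub>K\<^esub>"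
      using int_multiple_add_left[of "\<one>\<^bsub>K\<^esub>" "int m - int n" "int n"] by simp
    then have "add_pow K (int m - int n) \<one>\<^bsub>K\<^esub> = \<zero>\<^bsub>K\<^esub>"
      unfolding eq using add.r_cancel_one'[of "add_pow K (int n) \<one>\<^bsub>K\<^esub>" "add_pow K (int m - int n) \<one>\<^bsub>K\<^esub>"]
      by (metis int_multiple_closed one_closed add.r_cancel l_zero zero_closed)
    then show False
      using char_zero_torsion_free[OF assms one_closed, of "int m - int n"] \<open>m \<noteq> n\<close> by simp
  qed
  moreover have "range (\<lambda>n::nat. add_pow K (int n) \<one>\<^bsub>K\<^esub>) \<subseteq> carrier K" by auto
  ultimately show ?thesis using infinite_iff_countable_subset by blast
qed

lemma (in differential_extension) char_zero_extension:
  assumes "char_zero K" shows "char_zero E"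
  unfolding char_zero_def
proof (intro allI impI)
  interpret h: ring_hom_cring K E \<iota> by (rule embedding_ring_hom)
  fix n :: nat assume n: "0 < n"
  have "add_pow E n \<one>\<^bsub>E\<^esub> = \<iota> (add_pow K n \<one>\<^bsub>K\<^esub>)"
    using embedding_int_multiple[OF K.one_closed, of "int n"] by (simp add: add_pow_int_ge)
  moreover have "add_pow K n \<one>\<^bsub>K\<^esub> \<noteq> \<zero>\<^bsub>K\<^esub>" using assms n unfolding char_zero_def by blast
  ultimately show "add_pow E n \<one>\<^bsub>E\<^esub> \<noteq> \<zero>\<^bsub>E\<^esub>"
    using inj_onD[OF embedding_inj, of "add_pow K n \<one>\<^bsub>K\<^esub>" "\<zero>\<^bsub>K\<^esub>"] h.hom_zero by auto
qed

lemma (in differential_extension) log_der_set_embedding: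
  assumes "b \<in> log_der_set K \<delta>" shows "\<iota> b \<in> log_der_set E \<delta>\<^sub>E"
proof -
  interpret h: ring_hom_cring K E \<iota> by (rule embedding_ring_hom)
  obtain n :: nat and z where n: "b \<in> carrier K" "0 < n" "K.solves (add_pow K n b) z"
    using assms unfolding K.log_der_set_iff by auto
  have "\<iota> (add_pow K n b) = add_pow E n (\<iota> b)"
    using embedding_int_multiple[OF n(1), of "int n"] by (simp add: add_pow_int_ge)
  then have "E.solves (add_pow E n (\<iota> b)) (\<iota> z)" using solves_embedding[OF n(3)] by simp
  then show ?thesis unfolding E.log_der_set_iff using n h.hom_closed by blast
qed

lemma differential_extension_trans:
  assumes "differential_extension K \<delta> E \<delta>\<^sub>E \<iota>" "differential_extension E \<delta>\<^sub>E F \<delta>\<^sub>F j"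
  shows "differential_extension K \<delta> F \<delta>\<^sub>F (j \<circ> \<iota>)"
proof -
  interpret I: differential_extension K \<delta> E \<delta>\<^sub>E \<iota> by fact
  interpret J: differential_extension E \<delta>\<^sub>E F \<delta>\<^sub>F j by fact
  interpret h: ring_hom_cring K E \<iota> by (rule I.embedding_ring_hom)
  show ?thesis
  proof (intro differential_extension.intro differential_extension_axioms.intro)
    show "j \<circ> \<iota> \<in> ring_hom K F" by (rule ring_hom_trans[OF I.embedding J.embedding])
    show "\<delta>\<^sub>F ((j \<circ> \<iota>) x) = (j \<circ> \<iota>) (\<delta> x)" if "x \<in> carrier K" for x
      using I.der_extends[OF that] J.der_extends[of "\<iota> x"] that by simp
  qed (rule I.K.differential_field_axioms J.E.differential_field_axioms)+
qed

lemma differential_extension_refl: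
  assumes "differential_field K \<delta>" shows "differential_extension K \<delta> K \<delta> id"
proof -
  interpret differential_field K \<delta> by fact
  show ?thesis by unfold_locales (auto intro: ring_hom_memI)
qed

lemma finite_dimension_trans:
  assumes I: "differential_extension K \<delta> E \<delta>\<^sub>E \<iota>" and J: "differential_extension E \<delta>\<^sub>E F \<delta>\<^sub>F j"
    and fE: "ring.finite_dimension E (\<iota> ` carrier K) (carrier E)"
    and fF: "ring.finite_dimension F (j ` carrier E) (carrier F)"
  shows "ring.finite_dimension F ((j \<circ> \<iota>) ` carrier K) (carrier F)"
proof -
  interpret I: differential_extension K \<delta> E \<delta>\<^sub>E \<iota> by fact
  interpret J: differential_extension E \<delta>\<^sub>E F \<delta>\<^sub>F j by fact
  interpret IJ: differential_extension K \<delta> F \<delta>\<^sub>F "j \<circ> \<iota>" by (rule differential_extension_trans[OF I J])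
  have h: "ring_hom_ring E F j"
    by (rule ring_hom_ringI2[OF I.E.ring_axioms J.E.ring_axioms J.embedding])
  obtain n where n: "I.E.dimension n (\<iota> ` carrier K) (carrier E)"
    using fE by (rule I.E.finite_dimensionE')
  have "J.E.dimension n (j ` \<iota> ` carrier K) (j ` carrier E)"
    using ring_hom_ring.inj_hom_dimension[OF h I.embedding_subfield _ J.embedding_inj n] by simp
  then have "J.E.finite_dimension ((j \<circ> \<iota>) ` carrier K) (j ` carrier E)"
    unfolding image_comp by (rule J.E.finite_dimensionI)
  then show ?thesis
    using J.E.telescopic_base_dim(1)[OF IJ.embedding_subfield J.embedding_subfield _ fF] by simp
qed

lemma (in differential_extension) preimage_subfield:
  assumes F: "subfield F E" shows "subfield {x \<in> carrier K. \<iota> x \<in> F} K"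
proof -
  interpret h: ring_hom_cring K E \<iota> by (rule embedding_ring_hom)
  note Fr = subfieldE(1)[OF F]
  show ?thesis
  proof (rule K.subfieldI'[OF K.subringI])
    fix x assume "x \<in> {x \<in> carrier K. \<iota> x \<in> F} - {\<zero>\<^bsub>K\<^esub>}"
    then have x: "x \<in> carrier K" "\<iota> x \<in> F" "x \<noteq> \<zero>\<^bsub>K\<^esub>" by auto
    then have "x \<in> Units K" using K.field_Units by auto
    then have i: "inv\<^bsub>K\<^esub> x \<in> carrier K" "x \<otimes>\<^bsub>K\<^esub> inv\<^bsub>K\<^esub> x = \<one>\<^bsub>K\<^esub>" by auto
    have nz: "\<iota> x \<noteq> \<zero>\<^bsub>E\<^esub>" using x inj_onD[OF embedding_inj, of x "\<zero>\<^bsub>K\<^esub>"] h.hom_zero by auto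
    have "\<iota> x \<otimes>\<^bsub>E\<^esub> \<iota> (inv\<^bsub>K\<^esub> x) = \<one>\<^bsub>E\<^esub>" using h.hom_mult[OF x(1) i(1)] i(2) h.hom_one by simp
    then have "inv\<^bsub>E\<^esub> (\<iota> x) = \<iota> (inv\<^bsub>K\<^esub> x)" using x(1) i(1) by (intro E.comm_inv_char) auto
    moreover have "inv\<^bsub>E\<^esub> (\<iota> x) \<in> F" using E.subfield_m_inv(1)[OF F, of "\<iota> x"] x nz by auto
    ultimately show "inv\<^bsub>K\<^esub> x \<in> {x \<in> carrier K. \<iota> x \<in> F}" using i by simp
  qed (use subringE(3,5,6,7)[OF Fr] in auto)
qed

text \<open>The preimage of a subfield of \<open>F\<close> is a subfield of \<open>E\<close>, to which generation of \<open>E\<close>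
  applies.\<close>

lemma generated_by_trans:
  assumes I: "differential_extension K \<delta> E \<delta>\<^sub>E \<iota>" and J: "differential_extension E \<delta>\<^sub>E F \<delta>\<^sub>F j"
    and Y: "Y \<subseteq> carrier E"
    and gE: "generated_by E (\<iota> ` carrier K) Y" and gF: "generated_by F (j ` carrier E) Z"
  shows "generated_by F ((j \<circ> \<iota>) ` carrier K) (j ` Y \<union> Z)"
  unfolding generated_by_def
proof (intro allI impI)
  interpret I: differential_extension K \<delta> E \<delta>\<^sub>E \<iota> by fact
  interpret J: differential_extension E \<delta>\<^sub>E F \<delta>\<^sub>F j by fact
  interpret h: ring_hom_cring K E \<iota> by (rule I.embedding_ring_hom)
  fix L assume L: "subfield L F" and sub: "(j \<circ> \<iota>) ` carrier K \<union> (j ` Y \<union> Z) \<subseteq> L"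
  have "\<iota> ` carrier K \<union> Y \<subseteq> {x \<in> carrier E. j x \<in> L}" using sub Y by auto
  then have "carrier E \<subseteq> {x \<in> carrier E. j x \<in> L}"
    using gE J.preimage_subfield[OF L] unfolding generated_by_def by blast
  then have "j ` carrier E \<union> Z \<subseteq> L" using sub by auto
  then show "carrier F \<subseteq> L" using gF L unfolding generated_by_def by blast
qed

text \<open>Transport of structure along an injection into another type.\<close>

lemma relocation:
  assumes "differential_field E \<delta>\<^sub>E" and f: "inj_on f (carrier E)"
  shows "\<exists>(F :: 'c ring) \<delta>\<^sub>F. differential_extension E \<delta>\<^sub>E F \<delta>\<^sub>F (f :: _ \<Rightarrow> 'c) \<and> f ` carrier E = carrier F"
proof -
  interpret E: differential_field E \<delta>\<^sub>E by fact
  define F where "F = image_ring f E"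
  define \<delta>\<^sub>F where "\<delta>\<^sub>F x = f (\<delta>\<^sub>E (inv_into (carrier E) f x))" for x
  interpret F: field F unfolding F_def by (rule E.inj_imp_image_ring_is_field[OF f])
  have hom: "f \<in> ring_hom E F"
    using inj_imp_image_ring_iso[OF f] unfolding F_def ring_iso_def by auto
  have car: "carrier F = f ` carrier E" unfolding F_def by (rule image_ring_carrier)
  have dF: "\<delta>\<^sub>F (f x) = f (\<delta>\<^sub>E x)" if "x \<in> carrier E" for x
    unfolding \<delta>\<^sub>F_def using inv_into_f_f[OF f that] by simp
  have "differential_field F \<delta>\<^sub>F"
  proof unfold_locales
    fix x y assume "x \<in> carrier F" "y \<in> carrier F"
    then obtain u v where uv: "u \<in> carrier E" "x = f u" "v \<in> carrier E" "y = f v" unfolding car by auto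
    note du = E.der_closed[OF uv(1)] and dv = E.der_closed[OF uv(3)]
    show "\<delta>\<^sub>F x \<in> carrier F" unfolding uv(2) dF[OF uv(1)] using du car by auto
    show "\<delta>\<^sub>F (x \<oplus>\<^bsub>F\<^esub> y) = \<delta>\<^sub>F x \<oplus>\<^bsub>F\<^esub> \<delta>\<^sub>F y"
      unfolding uv(2,4) ring_hom_add[OF hom uv(1,3), symmetric] dF[OF uv(1)] dF[OF uv(3)]
        dF[OF E.a_closed[OF uv(1,3)]] ring_hom_add[OF hom du dv, symmetric]
      using E.der_add[OF uv(1,3)] by simp
    show "\<delta>\<^sub>F (x \<otimes>\<^bsub>F\<^esub> y) = \<delta>\<^sub>F x \<otimes>\<^bsub>F\<^esub> y \<oplus>\<^bsub>F\<^esub> x \<otimes>\<^bsub>F\<^esub> \<delta>\<^sub>F y"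
      unfolding uv(2,4) ring_hom_mult[OF hom uv(1,3), symmetric] dF[OF uv(1)] dF[OF uv(3)]
        dF[OF E.m_closed[OF uv(1,3)]] ring_hom_mult[OF hom du uv(3), symmetric]
        ring_hom_mult[OF hom uv(1) dv, symmetric]
        ring_hom_add[OF hom E.m_closed[OF du uv(3)] E.m_closed[OF uv(1) dv], symmetric]
      using E.der_mult[OF uv(1,3)] by simp
  qed
  then have "differential_extension E \<delta>\<^sub>E F \<delta>\<^sub>F f"
    by (intro differential_extension.intro differential_extension_axioms.intro)
      (use assms(1) hom dF in auto)
  then show ?thesis using car by blast
qed

section \<open>Existence and minimality of splitting fields\<close>

lemma exponential_extension:
  fixes K :: "'a ring"
  assumes "differential_field K \<delta>" "char_zero K" "a \<in> carrier K"
  shows "\<exists>(E :: 'a ring) \<delta>\<^sub>E \<iota> y. differential_extension K \<delta> E \<delta>\<^sub>E \<iota> \<and>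
    differential_field.solves E \<delta>\<^sub>E (\<iota> a) y \<and> generated_by E (\<iota> ` carrier K) {y}"
proof -
  interpret differential_field K \<delta> by fact
  obtain code :: "'a list \<times> 'a list \<Rightarrow> 'a" where
    code: "inj_on code (lists (carrier K) \<times> lists (carrier K))"
    using infinite_lists_encoding(1)[OF char_zero_infinite[OF field_axioms assms(2)]] by blast
  obtain E0 :: "('a list \<times> 'a list) set ring" and \<delta>0 \<iota> y and f :: "_ \<Rightarrow> 'a" where
    E0: "inj_on f (carrier E0)" "differential_extension K \<delta> E0 \<delta>0 \<iota>"
      "differential_field.solves E0 \<delta>0 (\<iota> a) y" "generated_by E0 (\<iota> ` carrier K) {y}"
    using adjoin_transcendental[OF code assms(3)] by blast
  interpret I: differential_extension K \<delta> E0 \<delta>0 \<iota> by (rule E0(2))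
  obtain E :: "'a ring" and \<delta>\<^sub>E where E: "differential_extension E0 \<delta>0 E \<delta>\<^sub>E f" "f ` carrier E0 = carrier E"
    using relocation[OF I.E.differential_field_axioms E0(1)] by blast
  interpret J: differential_extension E0 \<delta>0 E \<delta>\<^sub>E f by (rule E(1))
  have y: "y \<in> carrier E0" using E0(3) unfolding I.E.solves_def by simp
  have "generated_by E (f ` carrier E0) {}" unfolding generated_by_def E(2) by blast
  from generated_by_trans[OF E0(2) E(1) _ E0(4) this] y
  have "generated_by E ((f \<circ> \<iota>) ` carrier K) {f y}" by simp
  moreover have "J.E.solves ((f \<circ> \<iota>) a) (f y)" using J.solves_embedding[OF E0(3)] by simp
  ultimately show ?thesis using differential_extension_trans[OF E0(2) E(1)] by blast
qed

lemma root_extension: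
  fixes K :: "'a ring"
  assumes "differential_field K \<delta>" "char_zero K" "a \<in> log_der_set K \<delta>"
  shows "\<exists>(E :: 'a ring) \<delta>\<^sub>E \<iota> y. differential_extension K \<delta> E \<delta>\<^sub>E \<iota> \<and>
    differential_field.solves E \<delta>\<^sub>E (\<iota> a) y \<and> ring.finite_dimension E (\<iota> ` carrier K) (carrier E)"
proof -
  interpret differential_field K \<delta> by fact
  obtain code :: "'a list \<Rightarrow> 'a" where code: "inj_on code (lists (carrier K))"
    using infinite_lists_encoding(2)[OF char_zero_infinite[OF field_axioms assms(2)]] by blast
  obtain n :: nat and z where n: "a \<in> carrier K" "0 < n" "solves (add_pow K n a) z"
    using assms(3) unfolding log_der_set_iff by blast
  obtain E0 :: "'a list set ring" and \<delta>0 \<iota> y and f :: "_ \<Rightarrow> 'a" where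
    E0: "inj_on f (carrier E0)" "differential_extension K \<delta> E0 \<delta>0 \<iota>"
      "ring.finite_dimension E0 (\<iota> ` carrier K) (carrier E0)" "differential_field.solves E0 \<delta>0 (\<iota> a) y"
    using adjoin_root[OF assms(2) code n] by blast
  interpret I: differential_extension K \<delta> E0 \<delta>0 \<iota> by (rule E0(2))
  obtain E :: "'a ring" and \<delta>\<^sub>E where E: "differential_extension E0 \<delta>0 E \<delta>\<^sub>E f" "f ` carrier E0 = carrier E"
    using relocation[OF I.E.differential_field_axioms E0(1)] by blast
  interpret J: differential_extension E0 \<delta>0 E \<delta>\<^sub>E f by (rule E(1))
  have "J.E.finite_dimension (f ` carrier E0) (carrier E)"
    unfolding E(2) using J.E.finite_dimensionI[OF J.E.dimension_one[OF J.E.carrier_is_subfield]] .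
  from finite_dimension_trans[OF E0(2) E(1) E0(3) this]
  have "J.E.finite_dimension ((f \<circ> \<iota>) ` carrier K) (carrier E)" .
  moreover have "J.E.solves ((f \<circ> \<iota>) a) (f y)" using J.solves_embedding[OF E0(4)] by simp
  ultimately show ?thesis using differential_extension_trans[OF E0(2) E(1)] by blast
qed

text \<open>The construction continues over the field obtained for the first index, with the
  images of the remaining elements. Generation composes along the tower.\<close>

lemma exponential_tower:
  fixes K :: "'a ring"
  assumes "finite J" "differential_field K \<delta>" "char_zero K" "b \<in> J \<rightarrow> carrier K"
  shows "\<exists>(E :: 'a ring) \<delta>\<^sub>E \<iota> y. differential_extension K \<delta> E \<delta>\<^sub>E \<iota> \<and>
    (\<forall>j\<in>J. differential_field.solves E \<delta>\<^sub>E (\<iota> (b j)) (y j)) \<and> generated_by E (\<iota> ` carrier K) (y ` J)"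
  using assms
proof (induction J arbitrary: K \<delta> b rule: finite_induct)
  case empty
  have "generated_by K (id ` carrier K) {}" unfolding generated_by_def by simp
  then show ?case
    using differential_extension_refl[OF empty(1)]
    by (metis empty_iff image_empty)
next
  case (insert i J)
  have "b i \<in> carrier K" using insert.prems(3) by auto
  from exponential_extension[OF insert.prems(1,2) this]
  obtain E1 :: "'a ring" and \<delta>1 \<iota>1 y1 where
    E1: "differential_extension K \<delta> E1 \<delta>1 \<iota>1" "differential_field.solves E1 \<delta>1 (\<iota>1 (b i)) y1"
      "generated_by E1 (\<iota>1 ` carrier K) {y1}" by blast
  interpret I: differential_extension K \<delta> E1 \<delta>1 \<iota>1 by (rule E1(1))
  interpret h: ring_hom_cring K E1 \<iota>1 by (rule I.embedding_ring_hom)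
  have b1: "(\<iota>1 \<circ> b) \<in> J \<rightarrow> carrier E1" using insert.prems(3) by (auto simp: Pi_iff)
  from insert.IH[OF I.E.differential_field_axioms I.char_zero_extension[OF insert.prems(2)] b1]
  obtain E :: "'a ring" and \<delta>\<^sub>E \<iota>2 y where
    E: "differential_extension E1 \<delta>1 E \<delta>\<^sub>E \<iota>2"
      "\<forall>j\<in>J. differential_field.solves E \<delta>\<^sub>E (\<iota>2 ((\<iota>1 \<circ> b) j)) (y j)"
      "generated_by E (\<iota>2 ` carrier E1) (y ` J)" by blast
  interpret J: differential_extension E1 \<delta>1 E \<delta>\<^sub>E \<iota>2 by (rule E(1))
  let ?y = "y(i := \<iota>2 y1)"
  have y1: "y1 \<in> carrier E1" using E1(2) unfolding I.E.solves_def by simp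
  have "\<forall>j\<in>insert i J. J.E.solves ((\<iota>2 \<circ> \<iota>1) (b j)) (?y j)"
    using E(2) J.solves_embedding[OF E1(2)] insert.hyps by auto
  moreover have "?y ` insert i J = \<iota>2 ` {y1} \<union> y ` J" using insert.hyps(2) by auto
  then have "generated_by E ((\<iota>2 \<circ> \<iota>1) ` carrier K) (?y ` insert i J)"
    using generated_by_trans[OF E1(1) E(1) _ E1(3) E(3)] y1 by simp
  ultimately show ?case using differential_extension_trans[OF E1(1) E(1)] by blast
qed

text \<open>Membership in \<open>\<A>\<close> passes to extensions, so the remaining elements can be treated one
  after the other; dimensions multiply.\<close>

lemma root_tower:
  fixes K :: "'a ring"
  assumes "finite J" "differential_field K \<delta>" "char_zero K" "b \<in> J \<rightarrow> log_der_set K \<delta>"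
  shows "\<exists>(E :: 'a ring) \<delta>\<^sub>E \<iota>. differential_extension K \<delta> E \<delta>\<^sub>E \<iota> \<and>
    (\<forall>j\<in>J. \<exists>y. differential_field.solves E \<delta>\<^sub>E (\<iota> (b j)) y) \<and>
    ring.finite_dimension E (\<iota> ` carrier K) (carrier E)"
  using assms
proof (induction J arbitrary: K \<delta> b rule: finite_induct)
  case empty
  interpret differential_field K \<delta> by (rule empty(1))
  have "finite_dimension (id ` carrier K) (carrier K)"
    using finite_dimensionI[OF dimension_one[OF carrier_is_subfield]] by simp
  then show ?case using differential_extension_refl[OF empty(1)] by blast
next
  case (insert i J)
  have "b i \<in> log_der_set K \<delta>" using insert.prems(3) by auto
  from root_extension[OF insert.prems(1,2) this]
  obtain E1 :: "'a ring" and \<delta>1 \<iota>1 y1 where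
    E1: "differential_extension K \<delta> E1 \<delta>1 \<iota>1" "differential_field.solves E1 \<delta>1 (\<iota>1 (b i)) y1"
      "ring.finite_dimension E1 (\<iota>1 ` carrier K) (carrier E1)" by blast
  interpret I: differential_extension K \<delta> E1 \<delta>1 \<iota>1 by (rule E1(1))
  have b1: "(\<iota>1 \<circ> b) \<in> J \<rightarrow> log_der_set E1 \<delta>1"
    using insert.prems(3) I.log_der_set_embedding by (auto simp: Pi_iff)
  from insert.IH[OF I.E.differential_field_axioms I.char_zero_extension[OF insert.prems(2)] b1]
  obtain E :: "'a ring" and \<delta>\<^sub>E \<iota>2 where
    E: "differential_extension E1 \<delta>1 E \<delta>\<^sub>E \<iota>2"
      "\<forall>j\<in>J. \<exists>y. differential_field.solves E \<delta>\<^sub>E (\<iota>2 ((\<iota>1 \<circ> b) j)) y"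
      "ring.finite_dimension E (\<iota>2 ` carrier E1) (carrier E)" by blast
  interpret J: differential_extension E1 \<delta>1 E \<delta>\<^sub>E \<iota>2 by (rule E(1))
  have "\<forall>j\<in>insert i J. \<exists>y. J.E.solves ((\<iota>2 \<circ> \<iota>1) (b j)) y"
    using E(2) J.solves_embedding[OF E1(2)] by auto
  then show ?case
    using differential_extension_trans[OF E1(1) E(1)] finite_dimension_trans[OF E1(1) E(1) E1(3) E(3)]
    by blast
qed

lemma splitting_field_iff_solves:
  assumes "differential_extension K \<delta> E \<delta>\<^sub>E \<iota>" "S \<subseteq> carrier K"
  shows "splitting_field K \<delta> S E \<delta>\<^sub>E \<iota> \<longleftrightarrow> (\<forall>a\<in>S. \<exists>y. differential_field.solves E \<delta>\<^sub>E (\<iota> a) y)"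
proof -
  interpret differential_extension K \<delta> E \<delta>\<^sub>E \<iota> by fact
  interpret h: ring_hom_cring K E \<iota> by (rule embedding_ring_hom)
  show ?thesis using assms unfolding splitting_field_def E.solves_def by blast
qed

theorem theorem1p1:
  fixes K :: "'a ring" and \<delta> :: "'a \<Rightarrow> 'a" and S A' :: "'a set"
  assumes "differential_field K \<delta>"
    and "char_zero K"
    and "finite S"
    and "S \<subseteq> carrier K - {\<zero>\<^bsub>K\<^esub>}"
    and "additive_complement K (additive_span K S) (log_der_part K \<delta> S) A'"
  shows
    "(A' = {\<zero>\<^bsub>K\<^esub>} \<longrightarrow>
        (\<exists>(E :: 'a ring) \<delta>\<^sub>E \<iota>. splitting_field K \<delta> S E \<delta>\<^sub>E \<iota> \<and>
           (ring.finite_dimension E over (\<iota> ` carrier K)) (carrier E))) \<and>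
     (A' \<noteq> {\<zero>\<^bsub>K\<^esub>} \<longrightarrow>
        (\<forall>(E :: 'e ring) \<delta>\<^sub>E \<iota>. splitting_field K \<delta> S E \<delta>\<^sub>E \<iota> \<longrightarrow>
           \<not> ring.algebraic_extension E (\<iota> ` carrier K) \<and>
           ring.trdeg E (\<iota> ` carrier K) \<ge> enat (additive_rank K A'))) \<and>
     (\<exists>(E :: 'a ring) \<delta>\<^sub>E \<iota>. splitting_field K \<delta> S E \<delta>\<^sub>E \<iota> \<and>
        ring.trdeg E (\<iota> ` carrier K) = enat (additive_rank K A'))"
proof -
  interpret K: differential_field K \<delta> by (rule assms(1))
  have Sc: "S \<subseteq> carrier K" using assms(4) by auto
  have sum: "log_der_part K \<delta> S <+>\<^bsub>K\<^esub> A' = additive_span K S"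
    using assms(5) unfolding additive_complement_def by simp
  have span: "s \<in> additive_span K S" if "s \<in> S" for s
    unfolding additive_span_def using that by (rule generate.incl)
  have decomp: "\<exists>\<alpha>\<in>log_der_set K \<delta>. \<exists>\<beta>\<in>A'. s = \<alpha> \<oplus>\<^bsub>K\<^esub> \<beta>" if "s \<in> S" for s
    using span[OF that, folded sum] unfolding log_der_part_def set_add_def set_mult_def by auto
  obtain J :: "'a set" and b where J: "finite J" and b: "b \<in> J \<rightarrow> carrier K"
    and A'J: "A' = range (\<lambda>d. K.int_combination b d J)" and rank: "additive_rank K A' = card J"
    and ind: "\<And>c. K.int_combination b c J \<in> log_der_set K \<delta> \<Longrightarrow> (\<forall>j\<in>J. c j = 0)"
    using complement_basis_exists[OF assms(1-3) Sc assms(5)] by blast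
  have "\<exists>(E :: 'a ring) \<delta>\<^sub>E \<iota>. splitting_field K \<delta> S E \<delta>\<^sub>E \<iota> \<and>
      ring.finite_dimension E (\<iota> ` carrier K) (carrier E)" if A'0: "A' = {\<zero>\<^bsub>K\<^esub>}"
  proof -
    have "id \<in> S \<rightarrow> log_der_set K \<delta>"
    proof
      fix s assume "s \<in> S"
      then obtain \<alpha> where \<alpha>: "\<alpha> \<in> log_der_set K \<delta>" "s = \<alpha> \<oplus>\<^bsub>K\<^esub> \<zero>\<^bsub>K\<^esub>" using decomp A'0 by blast
      then have "\<alpha> \<in> carrier K" unfolding log_der_set_def by simp
      then show "id s \<in> log_der_set K \<delta>" using \<alpha> by simp
    qed
    from root_tower[OF assms(3,1,2) this] obtain E :: "'a ring" and \<delta>\<^sub>E \<iota> where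
      E: "differential_extension K \<delta> E \<delta>\<^sub>E \<iota>" "\<forall>s\<in>S. \<exists>y. differential_field.solves E \<delta>\<^sub>E (\<iota> (id s)) y"
        "ring.finite_dimension E (\<iota> ` carrier K) (carrier E)" by blast
    then show ?thesis using splitting_field_iff_solves[OF E(1) Sc] by auto
  qed
  moreover have "\<not> ring.algebraic_extension E (\<iota> ` carrier K) \<and>
      ring.trdeg E (\<iota> ` carrier K) \<ge> enat (additive_rank K A')"
    if A'0: "A' \<noteq> {\<zero>\<^bsub>K\<^esub>}" and sf: "splitting_field K \<delta> S E \<delta>\<^sub>E \<iota>" for E :: "'e ring" and \<delta>\<^sub>E \<iota>
  proof -
    interpret differential_extension K \<delta> E \<delta>\<^sub>E \<iota> using sf unfolding splitting_field_def by simp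
    have "\<exists>y. E.solves (\<iota> (b j)) y" if j: "j \<in> J" for j
    proof (rule splitting_field_solves_span[OF sf Sc])
      have bj: "b j \<in> carrier K" using b j by (rule funcset_mem)
      have "K.int_combination b (\<lambda>l. if l = j then 1 else 0) J = b j"
        using K.int_combination_single[OF J j b, of "\<lambda>l. if l = j then 1 else 0"] bj by simp
      then have "b j \<in> A'" unfolding A'J by (metis rangeI)
      moreover have "\<zero>\<^bsub>K\<^esub> \<in> log_der_part K \<delta> S"
        unfolding log_der_part_def additive_span_def
        using K.solves_log_der[OF K.solves_one] generate.one[of "add_monoid K" S] by simp
      ultimately have "\<zero>\<^bsub>K\<^esub> \<oplus>\<^bsub>K\<^esub> b j \<in> additive_span K S"
        unfolding sum[symmetric] set_add_def set_mult_def by force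
      then show "b j \<in> additive_span K S" using bj by simp
    qed
    then obtain y where y: "\<And>j. j \<in> J \<Longrightarrow> E.solves (\<iota> (b j)) (y j)" by metis
    note ai = solutions_algebraically_independent[OF J b y ind]
    have "J \<noteq> {}" using A'0 A'J by auto
    then have "\<not> E.algebraic_extension (\<iota> ` carrier K)"
      by (intro E.not_algebraic_extension[OF embedding_subfield ai(2)]) auto
    moreover have "enat (card (y ` J)) \<le> E.trdeg (\<iota> ` carrier K)"
      by (rule E.trdeg_ge[OF embedding_subfield ai(2) finite_imageI[OF J]])
    ultimately show ?thesis unfolding rank using card_image[OF ai(1)] by simp
  qed
  moreover have "\<exists>(E :: 'a ring) \<delta>\<^sub>E \<iota>. splitting_field K \<delta> S E \<delta>\<^sub>E \<iota> \<and>
      ring.trdeg E (\<iota> ` carrier K) = enat (additive_rank K A')"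
  proof -
    from exponential_tower[OF J assms(1,2) b] obtain F :: "'a ring" and \<delta>\<^sub>F j y where
      F: "differential_extension K \<delta> F \<delta>\<^sub>F j" "\<forall>i\<in>J. differential_field.solves F \<delta>\<^sub>F (j (b i)) (y i)"
        "generated_by F (j ` carrier K) (y ` J)" by blast
    interpret F: differential_extension K \<delta> F \<delta>\<^sub>F j by (rule F(1))
    interpret hF: ring_hom_cring K F j by (rule F.embedding_ring_hom)
    \<comment> \<open>In \<open>F\<close> the part of \<open>s\<close> in \<open>A'\<close> has become a logarithmic derivative.\<close>
    have "j \<in> S \<rightarrow> log_der_set F \<delta>\<^sub>F"
    proof
      fix s assume "s \<in> S"
      then obtain \<alpha> \<beta> where \<alpha>: "\<alpha> \<in> log_der_set K \<delta>" and \<beta>: "\<beta> \<in> A'" and s: "s = \<alpha> \<oplus>\<^bsub>K\<^esub> \<beta>"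
        using decomp by blast
      obtain d where d: "\<beta> = K.int_combination b d J" using \<beta> A'J by blast
      have c: "\<alpha> \<in> carrier K" "\<beta> \<in> carrier K" using \<alpha> d b unfolding log_der_set_def by auto
      have "j \<beta> \<in> {a. \<exists>y. F.E.solves a y}"
        unfolding d F.embedding_int_combination[OF J b]
        by (rule F.E.int_combination_mem_subgroup[OF F.E.solves_subgroup J]) (use F(2) in blast)
      then have "j \<beta> \<in> log_der_set F \<delta>\<^sub>F" using F.E.solves_log_der by blast
      then show "j s \<in> log_der_set F \<delta>\<^sub>F"
        using subgroup.m_closed[OF F.E.log_der_set_subgroup F.log_der_set_embedding[OF \<alpha>]] c s by simp
    qed
    from root_tower[OF assms(3) F.E.differential_field_axioms F.char_zero_extension[OF assms(2)] this]
    obtain E :: "'a ring" and \<delta>\<^sub>E i where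
      E: "differential_extension F \<delta>\<^sub>F E \<delta>\<^sub>E i" "\<forall>s\<in>S. \<exists>y. differential_field.solves E \<delta>\<^sub>E (i (j s)) y"
        "ring.finite_dimension E (i ` carrier F) (carrier E)" by blast
    interpret FE: differential_extension F \<delta>\<^sub>F E \<delta>\<^sub>E i by (rule E(1))
    let ?\<iota> = "i \<circ> j"
    have KE: "differential_extension K \<delta> E \<delta>\<^sub>E ?\<iota>" by (rule differential_extension_trans[OF F(1) E(1)])
    interpret KE: differential_extension K \<delta> E \<delta>\<^sub>E ?\<iota> by (rule KE)
    have sf: "splitting_field K \<delta> S E \<delta>\<^sub>E ?\<iota>"
      using splitting_field_iff_solves[OF KE Sc] E(2) by simp
    let ?y = "\<lambda>l. i (y l)"
    have "FE.E.solves (?\<iota> (b l)) (?y l)" if "l \<in> J" for l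
      using FE.solves_embedding[of "j (b l)" "y l"] F(2) that by simp
    note ai = KE.solutions_algebraically_independent[OF J b this ind]
    let ?k = "?\<iota> ` carrier K"
    let ?G = "generate_field E (?k \<union> ?y ` J)"
    have yc: "y l \<in> carrier F" if "l \<in> J" for l using F(2) that unfolding F.E.solves_def by blast
    interpret hE: ring_hom_cring F E i by (rule FE.embedding_ring_hom)
    have kY: "?k \<union> ?y ` J \<subseteq> carrier E" using yc by auto
    have G: "subfield ?G E" by (rule FE.E.generate_field_is_subfield[OF kY])
    \<comment> \<open>\<open>F\<close> is generated by \<open>K\<close> and the \<open>y l\<close>, so its image in \<open>E\<close> lies in the subfield \<open>?G\<close>.\<close>
    have "j ` carrier K \<union> y ` J \<subseteq> {x \<in> carrier F. i x \<in> ?G}"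
      using yc by (auto intro!: generate_field.incl)
    then have "carrier F \<subseteq> {x \<in> carrier F. i x \<in> ?G}"
      using F(3) FE.preimage_subfield[OF G] unfolding generated_by_def by blast
    then have sub: "i ` carrier F \<subseteq> ?G" by auto
    have "(FE.E.algebraic over ?G) e" if "e \<in> carrier E" for e
      using FE.E.finite_dimension_imp_algebraic[OF FE.embedding_subfield FE.E.carrier_is_subring E(3) that]
        FE.E.algebraic_mono[OF sub] by blast
    then have "FE.E.trdeg ?k = enat (card (?y ` J))"
      by (intro FE.E.trdeg_eq[OF KE.embedding_subfield ai(2) finite_imageI[OF J]])
    then have "FE.E.trdeg ?k = enat (additive_rank K A')" unfolding rank using card_image[OF ai(1)] by simp
    then show ?thesis using sf by blast
  qed
  ultimately show ?thesis unfolding over_def by blast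
qed

end
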